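(* There exists a universal constant $C>0$ such that for all integers $k\ge 2$ and $n\ge 1$, all $W_0\in\mathcal W^+[k]$ and all $\rho_n\in(0,1]$, with $f_0=\rho_nW_0$ and $\boldsymbol\Theta_0$ generated from $W_0$ and $\rho_n$ as in the $W$-random graph model, $$\mathbb E_{W_0}\big[\delta_{\square}(\widetilde f_{\boldsymbol\Theta_0},f_0)\big]\le C\rho_n\begin{cases}\sqrt{\dfrac{k}{n\log(k)}} & \text{if } k\le n,\\[2mm] \sqrt{\dfrac{1}{\log(n)}} & \text{if } k>n,\end{cases}$$ where for $n=1$ the quantity $\sqrt{1/\log(n)}$ is read as $+\infty$.
   Context: $[m]=\{1,\dots,m\}$. $\mathcal W^+$ is the set of graphons, i.e. symmetric measurable functions $W:[0,1]^2\to[0,1]$. $\mathcal W^+[k]$ is the set of $k$-step graphons: those $W\in\mathcal W^+$ such that for some symmetric $\boldsymbol Q\in[0,1]^{k\times k}$ and some $\phi:[0,1]\to[k]$, $W(x,y)=\boldsymbol Q_{\phi(x),\phi(y)}$ for all $x,y\in[0,1]$. $W$-random graph model: $\xi_1,\dots,\xi_n$ are i.i.d. uniform on $[0,1]$; given $W_0\in\mathcal W^+$ and a scale parameter $\rho_n\in(0,1]$, $\boldsymbol\Theta_0$ is the random symmetric $n\times n$ matrix with entries $\boldsymbol\Theta_{ij}=\rho_nW_0(\xi_i,\xi_j)$ for $i\ne j$ and $\boldsymbol\Theta_{ii}=0$. $\mathbb E_{W_0}$ denotes expectation in this model. For an $n\times n$ matrix $\boldsymbol\Theta$ with entries in $[0,1]$,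 the empirical graphon is $\widetilde f_{\boldsymbol\Theta}(x,y)=\boldsymbol\Theta_{\lceil nx\rceil,\lceil ny\rceil}$ for $x,y\in(0,1]$. The cut norm of a bounded symmetric measurable $W$ on $[0,1]^2$ is $\|W\|_\square=\sup_{S,T\subset[0,1]}\big|\int_{S\times T}W(x,y)\,dx\,dy\big|$ (sup over measurable $S,T$). The cut distance is $\delta_\square(W_1,W_2)=\inf_{\tau}\|W_1-W_2^\tau\|_\square$, the infimum being over all measure-preserving bijections $\tau:[0,1]\to[0,1]$, with $W^\tau(x,y)=W(\tau(x),\tau(y))$. *)

theory Defs
  imports "HOL-Probability.Probability"
begin

text \<open>
  Kernels on the unit square are curried functions on the reals; only their values on
  \<open>{0..1} \<times> {0..1}\<close> matter. ``Measurable'' means Lebesgue measurable throughout.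
\<close>

definition graphons :: "(real \<Rightarrow> real \<Rightarrow> real) set" where
  "graphons = {W.
     (\<lambda>(x, y). W x y) \<in> borel_measurable (lebesgue_on ({0..1} \<times> {0..1})) \<and>
     (\<forall>x\<in>{0..1}. \<forall>y\<in>{0..1}. W x y = W y x \<and> 0 \<le> W x y \<and> W x y \<le> 1)}"

text \<open>The labelling \<open>\<phi>\<close> is an arbitrary function; only \<open>W\<close> itself has to be measurable.\<close>

definition step_graphons :: "nat \<Rightarrow> (real \<Rightarrow> real \<Rightarrow> real) set" where
  "step_graphons k = {W \<in> graphons.
     \<exists>(Q :: nat \<Rightarrow> nat \<Rightarrow> real) (\<phi> :: real \<Rightarrow> nat).
       (\<forall>a\<in>{1..k}. \<forall>b\<in>{1..k}. Q a b = Q b a \<and> 0 \<le> Q a b \<and> Q a b \<le> 1) \<and>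
       \<phi> ` {0..1} \<subseteq> {1..k} \<and>
       (\<forall>x\<in>{0..1}. \<forall>y\<in>{0..1}. W x y = Q (\<phi> x) (\<phi> y))}"

definition cut_norm :: "(real \<Rightarrow> real \<Rightarrow> real) \<Rightarrow> real" where
  "cut_norm W =
     (SUP (S, T) \<in> {S \<in> sets lebesgue. S \<subseteq> {0..1}} \<times> {T \<in> sets lebesgue. T \<subseteq> {0..1}}.
        \<bar>LINT z:S \<times> T|lebesgue. W (fst z) (snd z)\<bar>)"

definition measure_preserving_bijections :: "(real \<Rightarrow> real) set" where
  "measure_preserving_bijections = {\<tau>.
     bij_betw \<tau> {0..1} {0..1} \<and>
     \<tau> \<in> measurable (lebesgue_on {0..1}) (lebesgue_on {0..1}) \<and>
     distr (lebesgue_on {0..1}) (lebesgue_on {0..1}) \<tau> = lebesgue_on {0..1}}"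

definition cut_distance ::
    "(real \<Rightarrow> real \<Rightarrow> real) \<Rightarrow> (real \<Rightarrow> real \<Rightarrow> real) \<Rightarrow> real" where
  "cut_distance W\<^sub>1 W\<^sub>2 =
     (INF \<tau> \<in> measure_preserving_bijections. cut_norm (\<lambda>x y. W\<^sub>1 x y - W\<^sub>2 (\<tau> x) (\<tau> y)))"

text \<open>
  An \<open>n \<times> n\<close> matrix is a function on indices, read on \<open>{1..n}\<close>. The empirical graphon lives on
  \<open>{0<..1} \<times> {0<..1}\<close>; it is extended by \<open>0\<close> to the remaining null set of the closed square.
\<close>

definition empirical_graphon :: "nat \<Rightarrow> (nat \<Rightarrow> nat \<Rightarrow> real) \<Rightarrow> real \<Rightarrow> real \<Rightarrow> real" where
  "empirical_graphon n \<Theta> x y =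
     (if x \<in> {0<..1} \<and> y \<in> {0<..1}
      then \<Theta> (nat \<lceil>real n * x\<rceil>) (nat \<lceil>real n * y\<rceil>) else 0)"

text \<open>
  The sample \<open>\<xi>\<^sub>1, \<dots>, \<xi>\<^sub>n\<close> is realised canonically, as the coordinates of a product space. The
  completion is needed because for a Lebesgue measurable \<open>W\<close> the map \<open>\<xi> \<mapsto> W (\<xi> i) (\<xi> j)\<close> need not
  be measurable for the product sigma-algebra itself.
\<close>

definition uniform_sample :: "nat \<Rightarrow> (nat \<Rightarrow> real) measure" where
  "uniform_sample n = completion (PiM {1..n} (\<lambda>_. lebesgue_on {0..1}))"

definition random_matrix ::
    "real \<Rightarrow> (real \<Rightarrow> real \<Rightarrow> real) \<Rightarrow> (nat \<Rightarrow> real) \<Rightarrow> nat \<Rightarrow> nat \<Rightarrow> real" where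
  "random_matrix \<rho> W \<xi> i j = (if i = j then 0 else \<rho> * W (\<xi> i) (\<xi> j))"

end

theory Submission
  imports Defs
begin

text \<open>
  Write \<open>W\<^sub>0(x, y) = Q(\<phi>(x), \<phi>(y))\<close>, let \<open>\<lambda>\<close> be the law of \<open>\<phi>(\<xi>\<^sub>1)\<close> on labels and \<open>\<lambda>'\<close> the empirical
  law. Up to its diagonal (measure \<open>1 / n\<close>) the empirical graphon is the step graphon with the same \<open>Q\<close>
  and weights \<open>\<lambda>'\<close>. An energy-decrement argument with quantised singular vectors writes \<open>Q\<close> as a
  kernel that is constant on products of \<open>exp(O(1 / \<epsilon>\<^sup>2))\<close> cells of labels plus a residual \<open>R\<close> of operator
  norm at most \<open>\<epsilon>\<close>. With \<open>\<epsilon>\<^sup>2\<close> of order \<open>1 / log k\<close> (or \<open>1 / log n\<close>) there are at most \<open>sqrt k\<close> (or \<open>sqrt n\<close>)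
  cells, so a rearrangement that matches as many labels as possible, and matches cells where it cannot match
  labels, leaves a mass of only \<open>sqrt (sqrt k / n)\<close> with unmatched cells. On the remaining mismatch only \<open>R\<close>
  contributes. If \<open>k \<le> n\<close> its contribution is \<open>\<epsilon>\<close> times a weighted \<open>L\<^sup>2\<close> norm of \<open>\<lambda> - \<lambda>'\<close>, which is of order
  \<open>sqrt (k / n)\<close>. If \<open>k > n\<close> one needs that the operator norm of \<open>R\<close> is still \<open>O(\<epsilon>)\<close> on the sample, which follows
  from second moments of the two Gram matrices of \<open>R\<close>.

  Since the cut distance is an infimum, rearrangements permuting the cells of a fine grid suffice.
\<close>

section \<open>Regularity in operator norm\<close>

text \<open>The cell count tolerates no logarithmic loss: with \<epsilon>^2 of order 1 / log k, a
  count exp(log(1/\<epsilon>) / \<epsilon>^2) would exceed every power of k. Rounding unit vectors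
  to a generic net risks such a loss. Hence each correction is a rank-one kernel g z(a) y(b) with
  integer vectors z, y, chosen as a maximiser, so that the energy of every single row and column
  drops in proportion to the square of its own coefficient. Rows of Q have energy at most 1, so for
  each label, and not only on average, the squared coefficients over all steps add up to
  O(1/\<epsilon>^2); integers satisfy |x| <= x^2, and there are only exp(O(1/\<epsilon>^2)) integer
  lists of that length and l^1 size.

  The operator norm, rather than the cut norm, is what pairs with a mismatch that is small in
  weighted L^2. The same coefficient bound keeps the entries of R of order 1/\<epsilon>^2, hence
  logarithmic in n when k > n, so the fluctuations of the Gram matrices are a power of log n over
  sqrt n and negligible against 1 / log n.\<close>

lemma weighted_Cauchy_Schwarz:
  fixes w f g :: "'a \<Rightarrow> real"
  assumes "\<And>x. x \<in> A \<Longrightarrow> 0 \<le> w x"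
  shows "(\<Sum>x\<in>A. w x * f x * g x)\<^sup>2 \<le> (\<Sum>x\<in>A. w x * (f x)\<^sup>2) * (\<Sum>x\<in>A. w x * (g x)\<^sup>2)"
proof -
  have "(\<Sum>x\<in>A. w x * f x * g x) = (\<Sum>x\<in>A. (sqrt (w x) * f x) * (sqrt (w x) * g x))"
    by (rule sum.cong) (use assms in \<open>auto simp: algebra_simps\<close>)
  moreover have "(\<Sum>x\<in>A. w x * (h x)\<^sup>2) = (\<Sum>x\<in>A. (sqrt (w x) * h x)\<^sup>2)" for h :: "'a \<Rightarrow> real"
    by (rule sum.cong) (use assms in \<open>auto simp: power_mult_distrib\<close>)
  ultimately show ?thesis
    using Cauchy_Schwarz_ineq_sum[of "\<lambda>x. sqrt (w x) * f x" "\<lambda>x. sqrt (w x) * g x" A] by simp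
qed

section \<open>Bilinear forms on a finite weighted set\<close>

locale weighted_set =
  fixes I :: "'a set" and p :: "'a \<Rightarrow> real"
  assumes finite_I: "finite I"
    and p_pos: "a \<in> I \<Longrightarrow> 0 < p a"
    and sum_p_le: "sum p I \<le> 1"
begin

definition sqnorm :: "('a \<Rightarrow> real) \<Rightarrow> real" where
  "sqnorm f = (\<Sum>a\<in>I. p a * (f a)\<^sup>2)"

definition form :: "('a \<Rightarrow> 'a \<Rightarrow> real) \<Rightarrow> ('a \<Rightarrow> real) \<Rightarrow> ('a \<Rightarrow> real) \<Rightarrow> real" where
  "form R v s = (\<Sum>a\<in>I. \<Sum>b\<in>I. p a * p b * v a * R a b * s b)"

text \<open>The integral operator with kernel \<open>R\<close> on L^2(\<open>p\<close>) has norm at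
  most \<open>\<sigma>\<close>; \<open>R\<close> may be asymmetric.\<close>

definition form_bounded :: "('a \<Rightarrow> 'a \<Rightarrow> real) \<Rightarrow> real \<Rightarrow> bool" where
  "form_bounded R \<sigma> \<longleftrightarrow> (\<forall>v s. \<bar>form R v s\<bar> \<le> \<sigma> * sqrt (sqnorm v) * sqrt (sqnorm s))"

text \<open>The squared Hilbert-Schmidt norm of \<open>R\<close>, written row by row because the
  decrement below acts on single rows.\<close>

abbreviation energy :: "('a \<Rightarrow> 'a \<Rightarrow> real) \<Rightarrow> real" where
  "energy R \<equiv> (\<Sum>a\<in>I. p a * sqnorm (R a))"

lemma p_nonneg: "a \<in> I \<Longrightarrow> 0 \<le> p a"
  using p_pos less_imp_le by blast

lemma sqnorm_nonneg [simp]: "0 \<le> sqnorm f"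
  unfolding sqnorm_def by (intro sum_nonneg mult_nonneg_nonneg) (auto simp: p_nonneg)

lemma sqnorm_scale: "sqnorm (\<lambda>a. c * f a) = c\<^sup>2 * sqnorm f"
  unfolding sqnorm_def by (simp add: sum_distrib_left power_mult_distrib algebra_simps)

lemma sqnorm_mono: "(\<And>a. a \<in> I \<Longrightarrow> \<bar>f a\<bar> \<le> \<bar>g a\<bar>) \<Longrightarrow> sqnorm f \<le> sqnorm g"
  unfolding sqnorm_def by (intro sum_mono mult_left_mono) (auto simp: p_nonneg abs_le_square_iff)

lemma sqnorm_le_const:
  assumes "\<And>a. a \<in> I \<Longrightarrow> \<bar>f a\<bar> \<le> c"
  shows "sqnorm f \<le> c\<^sup>2"
proof -
  have "sqnorm f \<le> (\<Sum>a\<in>I. p a * c\<^sup>2)"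
    unfolding sqnorm_def using assms
    by (intro sum_mono mult_left_mono) (use assms in \<open>fastforce simp: p_nonneg abs_le_square_iff[symmetric]\<close>)+
  also have "\<dots> = sum p I * c\<^sup>2" by (simp add: sum_distrib_right)
  also have "\<dots> \<le> 1 * c\<^sup>2" by (intro mult_right_mono sum_p_le) auto
  finally show ?thesis by simp
qed

lemma sqnorm_0_imp: "sqnorm f = 0 \<Longrightarrow> a \<in> I \<Longrightarrow> f a = 0"
  unfolding sqnorm_def
  by (subst (asm) sum_nonneg_eq_0_iff) (auto simp: finite_I p_nonneg dest: p_pos dest!: bspec[where x = a])

lemma form_scale: "form R (\<lambda>a. c * v a) (\<lambda>a. d * s a) = c * d * form R v s"
  unfolding form_def by (simp add: sum_distrib_left algebra_simps)

lemma form_diff_left: "form R (\<lambda>a. v a - v' a) s = form R v s - form R v' s"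
  unfolding form_def by (simp add: sum_subtractf algebra_simps)

lemma form_diff_right: "form R v (\<lambda>a. s a - s' a) = form R v s - form R v s'"
  unfolding form_def by (simp add: sum_subtractf algebra_simps)

lemma form_transpose: "form (\<lambda>a b. R b a) v s = form R s v"
  unfolding form_def by (subst sum.swap) (simp add: algebra_simps)

lemma energy_nonneg: "0 \<le> energy R"
  by (intro sum_nonneg mult_nonneg_nonneg) (auto simp: p_nonneg)

lemma form_bounded_energy: "form_bounded R (sqrt (energy R))"
  unfolding form_bounded_def
proof (intro allI)
  fix v s
  have "(form R v s)\<^sup>2 \<le> energy R * (sqnorm v * sqnorm s)"
  proof -
    have 1: "form R v s = (\<Sum>z\<in>I\<times>I. (p (fst z) * p (snd z)) * R (fst z) (snd z) * (v (fst z) * s (snd z)))"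
      unfolding form_def sum.cartesian_product by (simp add: algebra_simps case_prod_unfold)
    have 2: "energy R = (\<Sum>z\<in>I\<times>I. (p (fst z) * p (snd z)) * (R (fst z) (snd z))\<^sup>2)"
      unfolding sqnorm_def sum_distrib_left sum.cartesian_product by (simp add: algebra_simps case_prod_unfold)
    have 3: "sqnorm v * sqnorm s = (\<Sum>z\<in>I\<times>I. (p (fst z) * p (snd z)) * (v (fst z) * s (snd z))\<^sup>2)"
      unfolding sqnorm_def sum_product sum.cartesian_product
      by (simp add: algebra_simps case_prod_unfold power_mult_distrib)
    show ?thesis unfolding 1 2 3
      by (rule weighted_Cauchy_Schwarz) (auto simp: p_nonneg)
  qed
  then have "\<bar>form R v s\<bar> \<le> sqrt (energy R * (sqnorm v * sqnorm s))"
    by (simp add: real_le_rsqrt)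
  then show "\<bar>form R v s\<bar> \<le> sqrt (energy R) * sqrt (sqnorm v) * sqrt (sqnorm s)"
    by (simp add: real_sqrt_mult)
qed

lemma form_bounded_mono: "form_bounded R \<sigma> \<Longrightarrow> \<sigma> \<le> \<sigma>' \<Longrightarrow> form_bounded R \<sigma>'"
  unfolding form_bounded_def
  by (meson dual_order.trans mult_right_mono real_sqrt_ge_zero sqnorm_nonneg)

lemma form_boundedD: "form_bounded R \<sigma> \<Longrightarrow> \<bar>form R v s\<bar> \<le> \<sigma> * sqrt (sqnorm v) * sqrt (sqnorm s)"
  unfolding form_bounded_def by blast

lemma not_form_bounded_unit:
  assumes "\<not> form_bounded R \<sigma>" "0 \<le> \<sigma>"
  obtains v s where "sqnorm v \<le> 1" "sqnorm s \<le> 1" "\<sigma> < form R v s"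
proof -
  obtain v s where vs: "\<sigma> * sqrt (sqnorm v) * sqrt (sqnorm s) < \<bar>form R v s\<bar>"
    using assms(1) unfolding form_bounded_def by (auto simp: not_le)
  have "sqnorm v \<noteq> 0"
  proof
    assume "sqnorm v = 0"
    then have "form R v s = 0" unfolding form_def using sqnorm_0_imp[of v] by (simp add: sum.neutral)
    then show False using vs assms(2) by (simp add: \<open>sqnorm v = 0\<close>)
  qed
  moreover have "sqnorm s \<noteq> 0"
  proof
    assume "sqnorm s = 0"
    then have "form R v s = 0" unfolding form_def using sqnorm_0_imp[of s] by (simp add: sum.neutral)
    then show False using vs assms(2) by (simp add: \<open>sqnorm s = 0\<close>)
  qed
  ultimately have pos: "0 < sqnorm v" "0 < sqnorm s"
    using sqnorm_nonneg[of v] sqnorm_nonneg[of s] by linarith+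
  define c where "c = sgn (form R v s) / sqrt (sqnorm v)"
  define d where "d = 1 / sqrt (sqnorm s)"
  have csq: "c\<^sup>2 * sqnorm v \<le> 1" "d\<^sup>2 * sqnorm s \<le> 1"
    using pos by (auto simp: c_def d_def power_divide sgn_if)
  have "\<bar>form R v s\<bar> = form R v s * sgn (form R v s)" by (simp add: abs_sgn)
  then have "c * d * form R v s = \<bar>form R v s\<bar> / (sqrt (sqnorm v) * sqrt (sqnorm s))"
    by (simp add: c_def d_def)
  moreover have "\<sigma> < \<bar>form R v s\<bar> / (sqrt (sqnorm v) * sqrt (sqnorm s))"
    using vs pos by (subst pos_less_divide_eq) (auto simp: algebra_simps)
  ultimately show thesis
    using that[of "\<lambda>a. c * v a" "\<lambda>a. d * s a"] csq by (simp add: sqnorm_scale form_scale)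
qed

lemma form_upd_left:
  assumes "a \<in> I"
  shows "form R z y - form R (z(a := 0)) y = p a * z a * (\<Sum>b\<in>I. p b * R a b * y b)"
proof -
  have "form R z y - form R (z(a := 0)) y
      = (\<Sum>a'\<in>I. if a' = a then p a * z a * (\<Sum>b\<in>I. p b * R a b * y b) else 0)"
    unfolding form_def sum_subtractf[symmetric]
    by (rule sum.cong) (auto simp: sum_distrib_left algebra_simps)
  then show ?thesis using assms finite_I by simp
qed

lemma sqnorm_upd:
  assumes "a \<in> I"
  shows "sqnorm z - sqnorm (z(a := 0)) = p a * (z a)\<^sup>2"
proof -
  have "sqnorm z - sqnorm (z(a := 0)) = (\<Sum>a'\<in>I. if a' = a then p a * (z a)\<^sup>2 else 0)"
    unfolding sqnorm_def sum_subtractf[symmetric] by (rule sum.cong) auto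
  then show ?thesis using assms finite_I by simp
qed

text \<open>The factor 5/4 instead of 1 in the objective: comparing with \<open>z(a := 0)\<close> then gives a strict
  decrease of the energy of row \<open>a\<close>.\<close>

lemma row_decrease:
  assumes "a \<in> I"
    and opt: "2 * g * form R (z(a := 0)) y - 5/4 * g\<^sup>2 * sqnorm (z(a := 0)) * sqnorm y
      \<le> 2 * g * form R z y - 5/4 * g\<^sup>2 * sqnorm z * sqnorm y"
  shows "sqnorm (\<lambda>b. R a b - g * z a * y b) + (g * z a)\<^sup>2 * sqnorm y / 4 \<le> sqnorm (R a)"
proof -
  define r where "r = (\<Sum>b\<in>I. p b * R a b * y b)"
  have "0 \<le> 2 * g * (form R z y - form R (z(a := 0)) y) - 5/4 * g\<^sup>2 * (sqnorm z - sqnorm (z(a := 0))) * sqnorm y"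
    using opt by (simp add: left_diff_distrib right_diff_distrib)
  also have "\<dots> = p a * (2 * g * z a * r - 5/4 * (g * z a)\<^sup>2 * sqnorm y)"
    unfolding form_upd_left[OF assms(1)] sqnorm_upd[OF assms(1)] r_def[symmetric]
    by (simp add: algebra_simps power2_eq_square)
  finally have *: "0 \<le> 2 * g * z a * r - 5/4 * (g * z a)\<^sup>2 * sqnorm y"
    using p_pos[OF assms(1)] by (simp add: zero_le_mult_iff)
  have "sqnorm (\<lambda>b. R a b - g * z a * y b) = sqnorm (R a) - 2 * g * z a * r + (g * z a)\<^sup>2 * sqnorm y"
    unfolding sqnorm_def r_def sum_distrib_left sum_subtractf[symmetric] sum.distrib[symmetric]
    by (rule sum.cong) (auto simp: power2_eq_square algebra_simps)
  with * show ?thesis by linarith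
qed

end

section \<open>Quantised vectors and the energy decrement\<close>

lemma truncate_to_sixteenths:
  obtains z :: int where "\<bar>real_of_int z / 16\<bar> \<le> \<bar>x\<bar>" "\<bar>x - real_of_int z / 16\<bar> \<le> 1/16"
proof
  \<comment> \<open>Rounding towards zero keeps absolute values from growing, so a rounded vector
    stays in the unit ball.\<close>
  define z where "z = (if 0 \<le> x then \<lfloor>16 * x\<rfloor> else \<lceil>16 * x\<rceil>)"
  have "\<bar>real_of_int z / 16\<bar> \<le> \<bar>x\<bar> \<and> \<bar>x - real_of_int z / 16\<bar> \<le> 1/16"
  proof (cases "0 \<le> x")
    case True
    then have "z = \<lfloor>16 * x\<rfloor>" "0 \<le> z" by (auto simp: z_def)
    then show ?thesis using True by linarith
  next
    case False
    then have "z = \<lceil>16 * x\<rceil>" "z \<le> 0" by (auto simp: z_def ceiling_le_zero)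
    then show ?thesis using False by linarith
  qed
  then show "\<bar>real_of_int z / 16\<bar> \<le> \<bar>x\<bar>" "\<bar>x - real_of_int z / 16\<bar> \<le> 1/16" by auto
qed

context weighted_set
begin

text \<open>The pointwise error 1/16 is also an L^2 error, because the total weight is at most 1. In
  units of 1/16 the unit ball has squared radius 16^2 = 256.\<close>

lemma truncate_vector:
  assumes "sqnorm v \<le> 1"
  obtains z :: "'a \<Rightarrow> int" where "\<And>a. a \<notin> I \<Longrightarrow> z a = 0" "sqnorm z \<le> 256"
    "sqrt (sqnorm (\<lambda>a. z a / 16)) \<le> 1" "sqrt (sqnorm (\<lambda>a. v a - z a / 16)) \<le> 1/16"
proof -
  have "\<forall>a. \<exists>z::int. \<bar>real_of_int z / 16\<bar> \<le> \<bar>v a\<bar> \<and> \<bar>v a - real_of_int z / 16\<bar> \<le> 1/16"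
    using truncate_to_sixteenths by metis
  then obtain z0 :: "'a \<Rightarrow> int" where z0: "\<And>a. \<bar>real_of_int (z0 a) / 16\<bar> \<le> \<bar>v a\<bar>"
      "\<And>a. \<bar>v a - real_of_int (z0 a) / 16\<bar> \<le> 1/16" by metis
  define z where "z a = (if a \<in> I then z0 a else 0)" for a
  have "sqnorm (\<lambda>a. z a / 16) \<le> sqnorm v"
    by (rule sqnorm_mono) (use z0 in \<open>auto simp: z_def\<close>)
  moreover have "sqnorm (\<lambda>a. z a / 16) = sqnorm z / 256"
    using sqnorm_scale[of "1/16" z] by (simp add: power2_eq_square)
  moreover have "sqnorm (\<lambda>a. v a - z a / 16) \<le> (1/16)\<^sup>2"
    by (rule sqnorm_le_const) (use z0 in \<open>auto simp: z_def\<close>)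
  then have "sqrt (sqnorm (\<lambda>a. v a - z a / 16)) \<le> sqrt ((1/16)\<^sup>2)" by (rule real_sqrt_le_mono)
  ultimately show thesis
    using that[of z] assms by (simp add: z_def)
qed

text \<open>Positive weights bound each coordinate, so the maximum taken in the energy decrement is
  attained.\<close>

lemma finite_integer_vectors: "finite {z :: 'a \<Rightarrow> int. (\<forall>a. a \<notin> I \<longrightarrow> z a = (0::int)) \<and> sqnorm z \<le> 256}"
proof -
  define K where "K = \<lceil>\<Sum>a\<in>I. 256 / p a\<rceil>"
  have "finite {z :: 'a \<Rightarrow> int. \<forall>a. (a \<in> I \<longrightarrow> z a \<in> {-K..K}) \<and> (a \<notin> I \<longrightarrow> z a = 0)}"
    by (rule finite_set_of_finite_funs) (auto simp: finite_I)
  moreover have "z a \<in> {-K..K}" if "sqnorm (\<lambda>a. real_of_int (z a)) \<le> 256" "a \<in> I" for z :: "'a \<Rightarrow> int" and a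
  proof -
    have "p a * (real_of_int (z a))\<^sup>2 \<le> sqnorm z"
      unfolding sqnorm_def using finite_I that(2) p_nonneg
      by (intro member_le_sum[of a I "\<lambda>a. p a * (real_of_int (z a))\<^sup>2"]) auto
    then have "(real_of_int (z a))\<^sup>2 \<le> 256 / p a"
      using that p_pos[of a] by (simp add: field_simps)
    also have "\<dots> \<le> (\<Sum>a\<in>I. 256 / p a)"
      using finite_I that(2) p_nonneg by (intro member_le_sum[of a I "\<lambda>a. 256 / p a"]) auto
    also have "\<dots> \<le> real_of_int K" unfolding K_def by (rule le_of_int_ceiling)
    finally have "(z a)\<^sup>2 \<le> K" by (metis of_int_le_iff of_int_power)
    moreover have "\<bar>z a\<bar> \<le> (z a)\<^sup>2"
    proof (cases "z a = 0")
      case False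
      then have "\<bar>z a\<bar> * 1 \<le> \<bar>z a\<bar> * \<bar>z a\<bar>" by (intro mult_left_mono) auto
      then show ?thesis by (simp add: power2_eq_square)
    qed simp
    ultimately show ?thesis by auto
  qed
  ultimately show ?thesis by (elim rev_finite_subset) auto
qed

text \<open>A rounded pair of nearly extremal vectors shows that the maximum of the objective is of
  order \<sigma>^2; maximality against deleting one coordinate then gives the decrease in each row
  and column separately.\<close>

lemma energy_decrement:
  assumes "0 < \<epsilon>" "\<not> form_bounded R \<epsilon>" "energy R \<le> 1"
  obtains g :: real and z y :: "'a \<Rightarrow> int" where "\<bar>g\<bar> \<le> 1" "1 \<le> sqnorm z" "1 \<le> sqnorm y"
    "\<And>a. a \<in> I \<Longrightarrow> sqnorm (\<lambda>b. R a b - g * z a * y b) + \<epsilon>\<^sup>2 / 2^18 * (real_of_int (z a))\<^sup>2 \<le> sqnorm (R a)"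
    "\<And>b. b \<in> I \<Longrightarrow> sqnorm (\<lambda>a. R a b - g * z a * y b) + \<epsilon>\<^sup>2 / 2^18 * (real_of_int (y b))\<^sup>2 \<le> sqnorm (\<lambda>a. R a b)"
proof -
  \<comment> \<open>Doubling finds a scale \<open>\<sigma>\<close> at which \<open>R\<close> is
    bounded by \<open>2 * \<sigma>\<close> but not by \<open>\<sigma>\<close>: failure at
    \<open>\<sigma>\<close> supplies a correlated pair, the bound at \<open>2 * \<sigma>\<close>
    controls the rounding errors.\<close>
  have "\<exists>j::nat. form_bounded R (2 ^ j * \<epsilon>)"
  proof -
    obtain j :: nat where "sqrt (energy R) / \<epsilon> < 2 ^ j" using real_arch_pow[of 2] by auto
    then have "sqrt (energy R) \<le> 2 ^ j * \<epsilon>" using assms(1) by (simp add: field_simps)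
    then show ?thesis using form_bounded_mono[OF form_bounded_energy] by blast
  qed
  then obtain j where j: "form_bounded R (2 ^ Suc j * \<epsilon>)" "\<not> form_bounded R (2 ^ j * \<epsilon>)"
    using exists_least_lemma[of "\<lambda>j. form_bounded R (2 ^ j * \<epsilon>)"] assms(2) by auto
  define \<sigma> where "\<sigma> = 2 ^ j * \<epsilon>"
  have bd: "form_bounded R (2 * \<sigma>)" and nbd: "\<not> form_bounded R \<sigma>"
    using j by (auto simp: \<sigma>_def algebra_simps)
  have \<sigma>: "\<epsilon> \<le> \<sigma>" "0 < \<sigma>" using assms(1) by (auto simp: \<sigma>_def)
  have "\<sigma> \<le> 1"
  proof (rule ccontr)
    assume "\<not> \<sigma> \<le> 1"
    then have "sqrt (energy R) \<le> \<sigma>" using assms(3) by (smt (verit) real_sqrt_le_1_iff)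
    then show False using nbd form_bounded_mono[OF form_bounded_energy] by blast
  qed
  \<comment> \<open>The factor 1/256 undoes the scaling of two vectors that are both measured in
    units of 1/16.\<close>
  define g where "g = \<sigma> / 256"
  define V where "V = {z :: 'a \<Rightarrow> int. (\<forall>a. a \<notin> I \<longrightarrow> z a = (0::int)) \<and> sqnorm z \<le> 256}"
  \<comment> \<open>Up to the factor 5/4, the drop of the energy when \<open>g * z a * y b\<close>
    is subtracted from \<open>R\<close>.\<close>
  define G where "G z y = 2 * g * form R z y - 5/4 * g\<^sup>2 * sqnorm z * sqnorm y" for z y :: "'a \<Rightarrow> real"
  have finV: "finite (V \<times> V)" unfolding V_def using finite_integer_vectors by auto
  obtain u t where ut: "sqnorm u \<le> 1" "sqnorm t \<le> 1" "\<sigma> < form R u t"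
    using not_form_bounded_unit[OF nbd] \<sigma> by (metis less_imp_le)
  obtain zu where zu: "zu \<in> V" "sqrt (sqnorm (\<lambda>a. zu a / 16)) \<le> 1" "sqrt (sqnorm (\<lambda>a. u a - zu a / 16)) \<le> 1/16"
    by (rule truncate_vector[OF ut(1)], rule that) (simp_all add: V_def)
  obtain zt where zt: "zt \<in> V" "sqrt (sqnorm (\<lambda>a. zt a / 16)) \<le> 1" "sqrt (sqnorm (\<lambda>a. t a - zt a / 16)) \<le> 1/16"
    by (rule truncate_vector[OF ut(2)], rule that) (simp_all add: V_def)
  \<comment> \<open>The two roundings cost \<open>2 * \<sigma> / 16\<close> each, so the form keeps
    3/4 of \<sigma>, and \<open>G\<close> is at least (3/2 - 5/4) \<sigma>^2.\<close>
  have G_zut: "\<sigma>\<^sup>2 / 4 \<le> G zu zt"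
  proof -
    let ?v = "\<lambda>a. real_of_int (zu a) / 16" and ?s = "\<lambda>a. real_of_int (zt a) / 16"
    have "form R u t - form R ?v ?s = form R (\<lambda>a. u a - ?v a) t + form R ?v (\<lambda>a. t a - ?s a)"
      by (simp add: form_diff_left form_diff_right)
    moreover have "form R (\<lambda>a. u a - ?v a) t \<le> 2 * \<sigma> * (1/16) * 1"
    proof -
      have "form R (\<lambda>a. u a - ?v a) t \<le> 2 * \<sigma> * sqrt (sqnorm (\<lambda>a. u a - ?v a)) * sqrt (sqnorm t)"
        using form_boundedD[OF bd] abs_le_D1 by blast
      also have "\<dots> \<le> 2 * \<sigma> * (1/16) * 1"
        by (intro mult_mono) (use zu ut \<sigma> in auto)
      finally show ?thesis .
    qed
    moreover have "form R ?v (\<lambda>a. t a - ?s a) \<le> 2 * \<sigma> * 1 * (1/16)"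
    proof -
      have "form R ?v (\<lambda>a. t a - ?s a) \<le> 2 * \<sigma> * sqrt (sqnorm ?v) * sqrt (sqnorm (\<lambda>a. t a - ?s a))"
        using form_boundedD[OF bd] abs_le_D1 by blast
      also have "\<dots> \<le> 2 * \<sigma> * 1 * (1/16)"
        by (intro mult_mono) (use zu zt ut \<sigma> in auto)
      finally show ?thesis .
    qed
    ultimately have "3/4 * \<sigma> \<le> form R ?v ?s" using ut(3) by simp
    also have "form R ?v ?s = form R zu zt / 256"
      using form_scale[of R "1/16" zu "1/16" zt] by simp
    finally have 1: "3/4 * \<sigma> \<le> form R zu zt / 256" .
    have 2: "2 * \<sigma> * (3/4 * \<sigma>) \<le> 2 * \<sigma> * (form R zu zt / 256)"
      by (rule mult_left_mono[OF 1]) (use \<sigma> in auto)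
    have "sqnorm zu * sqnorm zt \<le> 256 * 256"
      using zu(1) zt(1) by (intro mult_mono) (auto simp: V_def)
    then have "5/4 * g\<^sup>2 * (sqnorm zu * sqnorm zt) \<le> 5/4 * g\<^sup>2 * (256 * 256)"
      by (intro mult_left_mono) auto
    also have "\<dots> = 5/4 * \<sigma>\<^sup>2" by (simp add: g_def power2_eq_square)
    finally have 3: "5/4 * g\<^sup>2 * sqnorm zu * sqnorm zt \<le> 5/4 * \<sigma>\<^sup>2" by (simp add: mult.assoc)
    have 4: "2 * g * form R zu zt = 2 * \<sigma> * (form R zu zt / 256)" by (simp add: g_def)
    have "3/2 * \<sigma>\<^sup>2 \<le> 2 * g * form R zu zt"
      unfolding 4 by (rule order_trans[OF _ 2]) (simp add: power2_eq_square)
    from diff_mono[OF this 3] show ?thesis unfolding G_def by simp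
  qed
  obtain z y where zy: "z \<in> V" "y \<in> V" and max: "\<And>z' y'. z' \<in> V \<Longrightarrow> y' \<in> V \<Longrightarrow> G z' y' \<le> G z y"
  proof -
    define F where "F = (\<lambda>(z' :: 'a \<Rightarrow> int, y' :: 'a \<Rightarrow> int). G (\<lambda>a. of_int (z' a)) (\<lambda>a. of_int (y' a)))"
    have "Max (F ` (V \<times> V)) \<in> F ` (V \<times> V)" using finV zu(1) zt(1) by (intro Max_in) auto
    then obtain z y where zy: "z \<in> V" "y \<in> V" and Max: "Max (F ` (V \<times> V)) = F (z, y)" by auto
    have "G z' y' \<le> G z y" if "z' \<in> V" "y' \<in> V" for z' y' :: "'a \<Rightarrow> int"
    proof -
      have "F (z', y') \<le> Max (F ` (V \<times> V))"
        by (rule Max_ge) (use finV that in auto)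
      then show ?thesis unfolding Max by (simp add: F_def)
    qed
    with zy show thesis by (rule that)
  qed
  have q256: "sqnorm z \<le> 256" "sqnorm y \<le> 256" using zy by (auto simp: V_def)
  \<comment> \<open>A maximum of this size forces the product of the two norms to be at least 16;
    both are at most 16, hence both are at least 1.\<close>
  have "\<sigma>\<^sup>2 / 4 \<le> G z y" using G_zut max[OF zu(1) zt(1)] by linarith
  also have "\<dots> \<le> 2 * g * form R z y" unfolding G_def by (simp add: mult_nonneg_nonneg)
  also have "\<dots> \<le> 2 * g * (2 * \<sigma> * sqrt (sqnorm z) * sqrt (sqnorm y))"
    using form_boundedD[OF bd, of z y] \<sigma> by (intro mult_left_mono) (auto simp: g_def)
  also have "\<dots> = (\<sigma>\<^sup>2 / 64) * (sqrt (sqnorm z) * sqrt (sqnorm y))"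
    by (simp add: g_def power2_eq_square)
  finally have prod: "16 \<le> sqrt (sqnorm z) * sqrt (sqnorm y)"
  proof -
    assume "\<sigma>\<^sup>2 / 4 \<le> \<sigma>\<^sup>2 / 64 * (sqrt (sqnorm z) * sqrt (sqnorm y))"
    then have "\<sigma>\<^sup>2 * 16 \<le> \<sigma>\<^sup>2 * (sqrt (sqnorm z) * sqrt (sqnorm y))" by linarith
    then show ?thesis using \<sigma> by (subst (asm) mult_le_cancel_left_pos) auto
  qed
  have s16: "sqrt (sqnorm z) \<le> 16" "sqrt (sqnorm y) \<le> 16"
    using q256 by (auto intro: real_le_lsqrt)
  have "sqrt (sqnorm z) * sqrt (sqnorm y) \<le> sqrt (sqnorm z) * 16"
    using s16 by (intro mult_left_mono) auto
  then have "1 \<le> sqrt (sqnorm z)" using prod by linarith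
  then have z1: "1 \<le> sqnorm z" by simp
  have "sqrt (sqnorm z) * sqrt (sqnorm y) \<le> 16 * sqrt (sqnorm y)"
    using s16 by (intro mult_right_mono) auto
  then have "1 \<le> sqrt (sqnorm y)" using prod by linarith
  then have y1: "1 \<le> sqnorm y" by simp
  \<comment> \<open>Here 2^18 = 4 * 256^2, with 4 from \<open>row_decrease\<close> and 256 from
    \<open>g\<close>.\<close>
  have g2: "\<epsilon>\<^sup>2 / 2^18 * x\<^sup>2 \<le> (g * x)\<^sup>2 * q / 4" if "1 \<le> q" for x q :: real
  proof -
    have "\<epsilon>\<^sup>2 \<le> \<sigma>\<^sup>2" using \<sigma> assms(1) by (intro power_mono) auto
    then have "\<epsilon>\<^sup>2 / 2^18 * x\<^sup>2 \<le> \<sigma>\<^sup>2 / 2^18 * x\<^sup>2" by (intro mult_right_mono divide_right_mono) auto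
    also have "\<dots> = (g * x)\<^sup>2 * 1 / 4" by (simp add: g_def power2_eq_square)
    also have "\<dots> \<le> (g * x)\<^sup>2 * q / 4" using that by (intro divide_right_mono mult_left_mono) auto
    finally show ?thesis .
  qed
  have upd: "fun_upd z' a (0::int) \<in> V" if "z' \<in> V" for z' a
  proof -
    have "sqnorm (\<lambda>x. real_of_int (fun_upd z' a (0::int) x)) \<le> sqnorm z'" by (rule sqnorm_mono) auto
    then show ?thesis using that by (auto simp: V_def)
  qed
  have of_int_upd: "(\<lambda>x. real_of_int (fun_upd z' a (0::int) x)) = fun_upd (\<lambda>x. real_of_int (z' x)) a 0" for z' :: "'a \<Rightarrow> int" and a
    by auto
  show thesis
  proof (rule that[of g z y])
    show "\<bar>g\<bar> \<le> 1" using \<sigma> \<open>\<sigma> \<le> 1\<close> by (simp add: g_def)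
    show "1 \<le> sqnorm z" "1 \<le> sqnorm y" by fact+
    show "sqnorm (\<lambda>b. R a b - g * z a * y b) + \<epsilon>\<^sup>2 / 2^18 * (real_of_int (z a))\<^sup>2 \<le> sqnorm (R a)" if "a \<in> I" for a
    proof -
      have "G ((\<lambda>x. real_of_int (z x))(a := 0)) y \<le> G z y"
        using max[OF upd[OF zy(1), of a] zy(2)] by (simp only: of_int_upd)
      then have "sqnorm (\<lambda>b. R a b - g * z a * y b) + (g * z a)\<^sup>2 * sqnorm y / 4 \<le> sqnorm (R a)"
        unfolding G_def by (intro row_decrease[OF that]) auto
      with g2[OF y1, of "z a"] show ?thesis by linarith
    qed
    show "sqnorm (\<lambda>a. R a b - g * z a * y b) + \<epsilon>\<^sup>2 / 2^18 * (real_of_int (y b))\<^sup>2 \<le> sqnorm (\<lambda>a. R a b)" if "b \<in> I" for b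
    proof -
      have "G z ((\<lambda>x. real_of_int (y x))(b := 0)) \<le> G z y"
        using max[OF zy(1) upd[OF zy(2), of b]] by (simp only: of_int_upd)
      \<comment> \<open>Columns are rows of the transposed kernel, with \<open>y\<close> and
        \<open>z\<close> exchanged.\<close>
      then have *: "2 * g * form (\<lambda>a b. R b a) ((\<lambda>x. real_of_int (y x))(b := 0)) z
            - 5/4 * g\<^sup>2 * sqnorm ((\<lambda>x. real_of_int (y x))(b := 0)) * sqnorm z
          \<le> 2 * g * form (\<lambda>a b. R b a) y z - 5/4 * g\<^sup>2 * sqnorm y * sqnorm z"
        unfolding G_def form_transpose[of R] by (simp only: mult.commute mult.left_commute)
      have "sqnorm (\<lambda>a. R a b - g * y b * z a) + (g * y b)\<^sup>2 * sqnorm z / 4 \<le> sqnorm (\<lambda>a. R a b)"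
        by (rule row_decrease[OF that *])
      moreover have "(\<lambda>a. R a b - g * y b * z a) = (\<lambda>a. R a b - g * z a * y b)"
        by (simp add: fun_eq_iff)
      ultimately show ?thesis using g2[OF z1, of "y b"] by simp
    qed
  qed
qed

text \<open>As \<open>sqnorm z\<close> is at least 1, each step lowers the energy by at least
  \<open>\<epsilon>\<^sup>2 / 2^18\<close>, so \<open>n\<close> steps exhaust it. Telescoping the
  decrease of one fixed row or column bounds its squared coefficients over all steps.\<close>

lemma iterated_energy_decrement:
  assumes "0 < \<epsilon>" "energy R \<le> 1" "energy R \<le> real n * (\<epsilon>\<^sup>2 / 2^18)"
  shows "\<exists>m (g :: nat \<Rightarrow> real) (z :: nat \<Rightarrow> 'a \<Rightarrow> int) (y :: nat \<Rightarrow> 'a \<Rightarrow> int). m \<le> n \<and> (\<forall>i<m. \<bar>g i\<bar> \<le> 1) \<and>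
    form_bounded (\<lambda>a b. R a b - (\<Sum>i<m. g i * z i a * y i b)) \<epsilon> \<and>
    (\<forall>a\<in>I. \<epsilon>\<^sup>2 / 2^18 * (\<Sum>i<m. (real_of_int (z i a))\<^sup>2) \<le> sqnorm (\<lambda>b. R a b)) \<and>
    (\<forall>b\<in>I. \<epsilon>\<^sup>2 / 2^18 * (\<Sum>i<m. (real_of_int (y i b))\<^sup>2) \<le> sqnorm (\<lambda>a. R a b))"
  using assms(2,3)
proof (induction n arbitrary: R)
  case (0 R)
  then have "energy R = 0" using energy_nonneg[of R] by simp
  then have "form_bounded R \<epsilon>"
    using form_bounded_mono[OF form_bounded_energy[of R], of \<epsilon>] assms(1) by simp
  then show ?case by (intro exI[of _ 0]) auto
next
  case (Suc n R)
  show ?case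
  proof (cases "form_bounded R \<epsilon>")
    case True
    then show ?thesis by (intro exI[of _ 0]) auto
  next
    case False
    obtain g :: real and z y :: "'a \<Rightarrow> int" where g: "\<bar>g\<bar> \<le> 1" and z1: "1 \<le> sqnorm z"
      and row: "\<And>a. a \<in> I \<Longrightarrow> sqnorm (\<lambda>b. R a b - g * z a * y b) + \<epsilon>\<^sup>2 / 2^18 * (real_of_int (z a))\<^sup>2 \<le> sqnorm (R a)"
      and col: "\<And>b. b \<in> I \<Longrightarrow> sqnorm (\<lambda>a. R a b - g * z a * y b) + \<epsilon>\<^sup>2 / 2^18 * (real_of_int (y b))\<^sup>2 \<le> sqnorm (\<lambda>a. R a b)"
      by (rule energy_decrement[OF assms(1) False Suc.prems(1)], rule that) assumption+
    define R' where "R' a b = R a b - g * z a * y b" for a b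
    have "energy R' + \<epsilon>\<^sup>2 / 2^18 * sqnorm z
        = (\<Sum>a\<in>I. p a * (sqnorm (\<lambda>b. R a b - g * z a * y b) + \<epsilon>\<^sup>2 / 2^18 * (real_of_int (z a))\<^sup>2))"
      unfolding sqnorm_def[of "\<lambda>x. real_of_int (z x)"] R'_def
      by (simp add: sum_distrib_left sum.distrib algebra_simps)
    also have "\<dots> \<le> energy R" by (intro sum_mono mult_left_mono row p_nonneg)
    finally have en: "energy R' + \<epsilon>\<^sup>2 / 2^18 * sqnorm z \<le> energy R" .
    moreover have "\<epsilon>\<^sup>2 / 2^18 * 1 \<le> \<epsilon>\<^sup>2 / 2^18 * sqnorm z" by (intro mult_left_mono z1) auto
    ultimately have dec: "energy R' + \<epsilon>\<^sup>2 / 2^18 \<le> energy R" by linarith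
    have "energy R' \<le> 1" proof -
      have "0 \<le> \<epsilon>\<^sup>2 / 2^18" by simp
      then show ?thesis using dec Suc.prems(1) by linarith
    qed
    moreover have "energy R' \<le> real n * (\<epsilon>\<^sup>2 / 2^18)"
      using dec Suc.prems(2) by (simp add: algebra_simps add_divide_distrib)
    ultimately obtain m and g' :: "nat \<Rightarrow> real" and z' y' :: "nat \<Rightarrow> 'a \<Rightarrow> int" where IH: "m \<le> n" "\<And>i. i < m \<Longrightarrow> \<bar>g' i\<bar> \<le> 1"
      "form_bounded (\<lambda>a b. R' a b - (\<Sum>i<m. g' i * z' i a * y' i b)) \<epsilon>"
      "\<And>a. a \<in> I \<Longrightarrow> \<epsilon>\<^sup>2 / 2^18 * (\<Sum>i<m. (real_of_int (z' i a))\<^sup>2) \<le> sqnorm (\<lambda>b. R' a b)"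
      "\<And>b. b \<in> I \<Longrightarrow> \<epsilon>\<^sup>2 / 2^18 * (\<Sum>i<m. (real_of_int (y' i b))\<^sup>2) \<le> sqnorm (\<lambda>a. R' a b)"
      using Suc.IH[of R'] by blast
    let ?g = "case_nat g g'" and ?z = "case_nat z z'" and ?y = "case_nat y y'"
    have shift: "(\<Sum>i<Suc m. h i) = h 0 + (\<Sum>i<m. h (Suc i))" for h :: "nat \<Rightarrow> real"
      by (rule sum.lessThan_Suc_shift)
    have "Suc m \<le> Suc n" using IH(1) by simp
    moreover have "\<forall>i<Suc m. \<bar>?g i\<bar> \<le> 1" using g IH(2) by (auto split: nat.splits)
    moreover have "form_bounded (\<lambda>a b. R a b - (\<Sum>i<Suc m. ?g i * ?z i a * ?y i b)) \<epsilon>"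
      using IH(3) unfolding shift R'_def by (simp add: algebra_simps)
    moreover have "\<forall>a\<in>I. \<epsilon>\<^sup>2 / 2^18 * (\<Sum>i<Suc m. (real_of_int (?z i a))\<^sup>2) \<le> sqnorm (\<lambda>b. R a b)"
    proof
      fix a assume "a \<in> I"
      then have "\<epsilon>\<^sup>2 / 2^18 * (real_of_int (z a))\<^sup>2 + \<epsilon>\<^sup>2 / 2^18 * (\<Sum>i<m. (real_of_int (z' i a))\<^sup>2) \<le> sqnorm (R a)"
        using IH(4)[of a] row[of a] unfolding R'_def by linarith
      then show "\<epsilon>\<^sup>2 / 2^18 * (\<Sum>i<Suc m. (real_of_int (?z i a))\<^sup>2) \<le> sqnorm (\<lambda>b. R a b)"
        unfolding shift distrib_left by simp
    qed
    moreover have "\<forall>b\<in>I. \<epsilon>\<^sup>2 / 2^18 * (\<Sum>i<Suc m. (real_of_int (?y i b))\<^sup>2) \<le> sqnorm (\<lambda>a. R a b)"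
    proof
      fix b assume "b \<in> I"
      then have "\<epsilon>\<^sup>2 / 2^18 * (real_of_int (y b))\<^sup>2 + \<epsilon>\<^sup>2 / 2^18 * (\<Sum>i<m. (real_of_int (y' i b))\<^sup>2) \<le> sqnorm (\<lambda>a. R a b)"
        using IH(5)[of b] col[of b] unfolding R'_def by linarith
      then show "\<epsilon>\<^sup>2 / 2^18 * (\<Sum>i<Suc m. (real_of_int (?y i b))\<^sup>2) \<le> sqnorm (\<lambda>a. R a b)"
        unfolding shift distrib_left by simp
    qed
    ultimately show ?thesis by blast
  qed
qed

end

section \<open>Integer lists of bounded size and the regularity decomposition\<close>

lemma abs_mult_le_squares: "1 * (\<bar>x\<bar> * \<bar>y\<bar>) \<le> x\<^sup>2 + (y::real)\<^sup>2"
proof -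
  have "2 * \<bar>x\<bar> * \<bar>y\<bar> \<le> x\<^sup>2 + y\<^sup>2" using sum_squares_bound[of "\<bar>x\<bar>" "\<bar>y\<bar>"] by simp
  moreover have "0 \<le> \<bar>x\<bar> * \<bar>y\<bar>" by simp
  ultimately show ?thesis by linarith
qed

lemma sum_power2_diff: "(\<Sum>k\<le>M. 2 ^ (M - k)) \<le> 2 * (2::nat) ^ M"
proof (induction M)
  case (Suc M)
  then show ?case by (subst sum.atMost_Suc_shift) simp
qed simp

text \<open>Induction on the length: a first entry of absolute value k has two signs and leaves the
  budget M - k. The geometric sum over k contributes another 2, which makes the factor 4 per
  entry.\<close>

lemma card_int_lists:
  "finite {xs :: int list. length xs = m \<and> sum_list (map (\<lambda>z. nat \<bar>z\<bar>) xs) \<le> M} \<and>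
   card {xs :: int list. length xs = m \<and> sum_list (map (\<lambda>z. nat \<bar>z\<bar>) xs) \<le> M} \<le> 4 ^ m * 2 ^ M"
proof (induction m arbitrary: M)
  case 0
  have "{xs :: int list. length xs = 0 \<and> sum_list (map (\<lambda>z. nat \<bar>z\<bar>) xs) \<le> M} = {[]}" by auto
  then show ?case by simp
next
  case (Suc m)
  define X where "X m M = {xs :: int list. length xs = m \<and> sum_list (map (\<lambda>z. nat \<bar>z\<bar>) xs) \<le> M}" for m M
  have fin: "finite (X m M)" and card: "card (X m M) \<le> 4 ^ m * 2 ^ M" for M
    using Suc.IH[of M] by (auto simp: X_def)
  let ?U = "\<Union>k\<in>{..M}. (#) (int k) ` X m (M - k) \<union> (#) (- int k) ` X m (M - k)"
  have sub: "X (Suc m) M \<subseteq> ?U"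
  proof
    fix xs assume "xs \<in> X (Suc m) M"
    then obtain z ys where xs: "xs = z # ys" "length ys = m" "nat \<bar>z\<bar> + sum_list (map (\<lambda>z. nat \<bar>z\<bar>) ys) \<le> M"
      by (auto simp: X_def length_Suc_conv)
    then have "ys \<in> X m (M - nat \<bar>z\<bar>)" "nat \<bar>z\<bar> \<le> M" by (auto simp: X_def)
    moreover have "z = int (nat \<bar>z\<bar>) \<or> z = - int (nat \<bar>z\<bar>)" by auto
    ultimately show "xs \<in> ?U" unfolding xs(1) by blast
  qed
  have finU: "finite ?U" using fin by auto
  have "card (X (Suc m) M) \<le> card ?U" by (rule card_mono[OF finU sub])
  also have "\<dots> \<le> (\<Sum>k\<le>M. card ((#) (int k) ` X m (M - k) \<union> (#) (- int k) ` X m (M - k)))"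
    by (rule card_UN_le) simp
  also have "\<dots> \<le> (\<Sum>k\<le>M. 2 * (4 ^ m * 2 ^ (M - k)))"
  proof (rule sum_mono)
    fix k
    have "card ((#) (int k) ` X m (M - k) \<union> (#) (- int k) ` X m (M - k))
      \<le> card ((#) (int k) ` X m (M - k)) + card ((#) (- int k) ` X m (M - k))" by (rule card_Un_le)
    also have "\<dots> \<le> card (X m (M - k)) + card (X m (M - k))"
      by (intro add_mono card_image_le fin)
    finally show "card ((#) (int k) ` X m (M - k) \<union> (#) (- int k) ` X m (M - k)) \<le> 2 * (4 ^ m * 2 ^ (M - k))"
      using card[of "M - k"] by linarith
  qed
  also have "\<dots> = 2 * 4 ^ m * (\<Sum>k\<le>M. 2 ^ (M - k))" by (simp add: sum_distrib_left algebra_simps)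
  also have "\<dots> \<le> 2 * 4 ^ m * (2 * 2 ^ M)" by (intro mult_left_mono sum_power2_diff) auto
  finally have "card (X (Suc m) M) \<le> 4 ^ Suc m * 2 ^ M" by simp
  then show ?case using finite_subset[OF sub finU] by (simp add: X_def)
qed

text \<open>With T = 2^18 / \<epsilon>^2, the m <= 2T steps give lists of length 2m and l^1 size at
  most 2T. Their number is at most 2^(4m + 2T) <= exp(10 T).\<close>

definition regularity_const :: real where "regularity_const = 10 * 2^18"

context weighted_set
begin

text \<open>A weak regularity lemma with the residual measured in operator norm. The cell of a label
  is the list of its integer coefficients in all rank-one terms, so what is subtracted from
  \<open>Q\<close> depends only on cells.\<close>

theorem operator_norm_regularity:
  assumes Q: "\<And>a b. a \<in> I \<Longrightarrow> b \<in> I \<Longrightarrow> \<bar>Q a b\<bar> \<le> 1" and "0 < \<epsilon>"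
  obtains R and c :: "'a \<Rightarrow> int list" where
    "real (card (c ` I)) \<le> exp (regularity_const / \<epsilon>\<^sup>2)"
    "\<And>a b a' b'. \<lbrakk>a \<in> I; b \<in> I; a' \<in> I; b' \<in> I; c a = c a'; c b = c b'\<rbrakk> \<Longrightarrow> Q a b - R a b = Q a' b' - R a' b'"
    "form_bounded R \<epsilon>"
    "\<And>a b. a \<in> I \<Longrightarrow> b \<in> I \<Longrightarrow> \<bar>R a b\<bar> \<le> 1 + regularity_const / \<epsilon>\<^sup>2"
proof -
  have row: "sqnorm (\<lambda>b. Q a b) \<le> 1" if "a \<in> I" for a
    using sqnorm_le_const[of "Q a" 1] Q that by simp
  have col: "sqnorm (\<lambda>a. Q a b) \<le> 1" if "b \<in> I" for b
    using sqnorm_le_const[of "\<lambda>a. Q a b" 1] Q that by simp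
  have "energy Q \<le> (\<Sum>a\<in>I. p a * 1)" by (intro sum_mono mult_left_mono row p_nonneg)
  then have en: "energy Q \<le> 1" using sum_p_le by simp
  show thesis
  proof (cases "1 \<le> \<epsilon>")
    case True
    \<comment> \<open>For \<epsilon> >= 1 nothing has to be subtracted: \<open>R = Q\<close>, with
      the empty list as the only cell.\<close>
    have "(\<lambda>_::'a. []::int list) ` I \<subseteq> {[]}" by auto
    then have "card ((\<lambda>_::'a. []::int list) ` I) \<le> 1" using card_mono[of "{[]::int list}"] by fastforce
    moreover have "(1::real) \<le> exp (regularity_const / \<epsilon>\<^sup>2)"
      by (simp add: regularity_const_def)
    ultimately have "real (card ((\<lambda>_::'a. []::int list) ` I)) \<le> exp (regularity_const / \<epsilon>\<^sup>2)" by linarith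
    moreover have "form_bounded Q \<epsilon>"
      by (rule form_bounded_mono[OF form_bounded_energy]) (use en True in \<open>smt (verit) real_sqrt_le_1_iff\<close>)
    moreover have "\<bar>Q a b\<bar> \<le> 1 + regularity_const / \<epsilon>\<^sup>2" if "a \<in> I" "b \<in> I" for a b
    proof -
      have "0 \<le> regularity_const / \<epsilon>\<^sup>2" by (simp add: regularity_const_def)
      then show ?thesis using Q[OF that] by linarith
    qed
    ultimately show thesis by (intro that[of "\<lambda>_. []" Q]) auto
  next
    case False
    define T where "T = 2^18 / \<epsilon>\<^sup>2"
    have "\<epsilon>\<^sup>2 < 1" using False assms(2) by (simp add: power_less_one_iff)
    then have T1: "1 \<le> T" using assms(2) unfolding T_def by (simp add: field_simps)
    have TK: "regularity_const / \<epsilon>\<^sup>2 = 10 * T" by (simp add: T_def regularity_const_def)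
    define n where "n = nat \<lceil>T\<rceil>"
    have n: "T \<le> real n" "real n \<le> 2 * T" using T1 by (auto simp: n_def) linarith
    have "1 \<le> real n * (\<epsilon>\<^sup>2 / 2^18)" using n(1) assms(2) by (simp add: T_def field_simps)
    then have "energy Q \<le> real n * (\<epsilon>\<^sup>2 / 2^18)" using en by linarith
    then obtain m and g :: "nat \<Rightarrow> real" and z y :: "nat \<Rightarrow> 'a \<Rightarrow> int" where m: "m \<le> n" and g: "\<And>i. i < m \<Longrightarrow> \<bar>g i\<bar> \<le> 1"
      and fb: "form_bounded (\<lambda>a b. Q a b - (\<Sum>i<m. g i * z i a * y i b)) \<epsilon>"
      and z: "\<And>a. a \<in> I \<Longrightarrow> \<epsilon>\<^sup>2 / 2^18 * (\<Sum>i<m. (real_of_int (z i a))\<^sup>2) \<le> sqnorm (\<lambda>b. Q a b)"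
      and y: "\<And>b. b \<in> I \<Longrightarrow> \<epsilon>\<^sup>2 / 2^18 * (\<Sum>i<m. (real_of_int (y i b))\<^sup>2) \<le> sqnorm (\<lambda>a. Q a b)"
      using iterated_energy_decrement[OF assms(2) en, of n] by blast
    have zT: "(\<Sum>i<m. (real_of_int (z i a))\<^sup>2) \<le> T" if "a \<in> I" for a
      using order_trans[OF z[OF that] row[OF that]] assms(2) by (simp add: T_def field_simps)
    have yT: "(\<Sum>i<m. (real_of_int (y i a))\<^sup>2) \<le> T" if "a \<in> I" for a
      using order_trans[OF y[OF that] col[OF that]] assms(2) by (simp add: T_def field_simps)
    define R where "R a b = Q a b - (\<Sum>i<m. g i * z i a * y i b)" for a b
    \<comment> \<open>The rank-one terms need not be symmetric: \<open>z\<close> gives the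
      coefficients of the label as a row index, \<open>y\<close> those as a column index.\<close>
    define c where "c a = map (\<lambda>i. z i a) [0..<m] @ map (\<lambda>i. y i a) [0..<m]" for a
    define S where "S = nat \<lfloor>2 * T\<rfloor>"
    have "c ` I \<subseteq> {xs. length xs = 2 * m \<and> sum_list (map (\<lambda>z. nat \<bar>z\<bar>) xs) \<le> S}"
    proof safe
      fix a assume a: "a \<in> I"
      show "length (c a) = 2 * m" by (simp add: c_def)
      \<comment> \<open>Integrality enters here: it turns the bound on sums of squares into a bound
        on the l^1 size.\<close>
      have abs_sq: "real (nat \<bar>x\<bar>) \<le> (real_of_int x)\<^sup>2" for x :: int
      proof (cases "x = 0")
        case False
        then have "\<bar>x\<bar> * 1 \<le> \<bar>x\<bar> * \<bar>x\<bar>" by (intro mult_left_mono) auto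
        then have "\<bar>x\<bar> \<le> x\<^sup>2" by (simp add: power2_eq_square)
        then have "real_of_int \<bar>x\<bar> \<le> real_of_int (x\<^sup>2)" by (simp only: of_int_le_iff)
        then show ?thesis by simp
      qed simp
      have "sum_list (map (\<lambda>z. nat \<bar>z\<bar>) (c a)) = (\<Sum>i<m. nat \<bar>z i a\<bar>) + (\<Sum>i<m. nat \<bar>y i a\<bar>)"
        by (simp add: c_def comp_def interv_sum_list_conv_sum_set_nat atLeast0LessThan)
      then have "real (sum_list (map (\<lambda>z. nat \<bar>z\<bar>) (c a)))
          = (\<Sum>i<m. real (nat \<bar>z i a\<bar>)) + (\<Sum>i<m. real (nat \<bar>y i a\<bar>))" by simp
      also have "\<dots> \<le> (\<Sum>i<m. (real_of_int (z i a))\<^sup>2) + (\<Sum>i<m. (real_of_int (y i a))\<^sup>2)"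
        by (intro add_mono sum_mono abs_sq)
      also have "\<dots> \<le> 2 * T" using zT[OF a] yT[OF a] by simp
      finally show "sum_list (map (\<lambda>z. nat \<bar>z\<bar>) (c a)) \<le> S" unfolding S_def by (simp add: le_nat_floor)
    qed
    then have "card (c ` I) \<le> 4 ^ (2 * m) * 2 ^ S"
      using card_int_lists[of "2 * m" S] card_mono order_trans by blast
    then have "real (card (c ` I)) \<le> real (4 ^ (2 * m) * 2 ^ S)" by (simp only: of_nat_le_iff)
    also have "\<dots> = 2 ^ (4 * m + S)" by (simp add: power_add power_mult)
    also have "\<dots> \<le> exp 1 ^ (4 * m + S)"
      using exp_ge_add_one_self[of 1] by (intro power_mono) auto
    also have "\<dots> = exp (4 * real m + real S)" by (simp add: exp_of_nat_mult[symmetric])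
    also have "\<dots> \<le> exp (10 * T)"
    proof -
      have "real m \<le> 2 * T" using m n(2) by linarith
      moreover have "real S \<le> 2 * T" using T1 by (simp add: S_def)
      ultimately show ?thesis by simp
    qed
    finally have 1: "real (card (c ` I)) \<le> exp (regularity_const / \<epsilon>\<^sup>2)" by (simp only: TK)
    have 2: "Q a b - R a b = Q a' b' - R a' b'" if "c a = c a'" "c b = c b'" for a b a' b'
    proof -
      have "z i a = z i a'" "y i b = y i b'" if "i < m" for i
        using that \<open>c a = c a'\<close> \<open>c b = c b'\<close> by (auto simp: c_def)
      then show ?thesis by (simp add: R_def)
    qed
    have 3: "form_bounded R \<epsilon>" using fb unfolding R_def[abs_def] .
    have 4: "\<bar>R a b\<bar> \<le> 1 + regularity_const / \<epsilon>\<^sup>2" if "a \<in> I" "b \<in> I" for a b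
    proof -
      have "\<bar>\<Sum>i<m. g i * z i a * y i b\<bar> \<le> (\<Sum>i<m. \<bar>g i * z i a * y i b\<bar>)" by (rule sum_abs)
      also have "\<dots> \<le> (\<Sum>i<m. (real_of_int (z i a))\<^sup>2 + (real_of_int (y i b))\<^sup>2)"
      proof (rule sum_mono)
        fix i assume "i \<in> {..<m}"
        then have "\<bar>g i * z i a * y i b\<bar> \<le> 1 * (\<bar>real_of_int (z i a)\<bar> * \<bar>real_of_int (y i b)\<bar>)"
          unfolding abs_mult mult.assoc using g by (intro mult_right_mono) auto
        also have "\<dots> \<le> (real_of_int (z i a))\<^sup>2 + (real_of_int (y i b))\<^sup>2"
          by (rule abs_mult_le_squares)
        finally show "\<bar>g i * z i a * y i b\<bar> \<le> (real_of_int (z i a))\<^sup>2 + (real_of_int (y i b))\<^sup>2" .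
      qed
      also have "\<dots> \<le> 2 * T" using zT[OF that(1)] yT[OF that(2)] by (simp add: sum.distrib)
      finally show ?thesis using Q[OF that] T1 unfolding R_def TK by linarith
    qed
    show thesis by (rule that[OF 1 2 3 4])
  qed
qed

end

section \<open>Matched labellings of a grid\<close>

text \<open>One permutation serves both scales. The score of a pair counts an equal label and an
  equal cell; a violation of either conclusion could be repaired by exchanging the values of
  \<open>\<pi>\<close> at \<open>i\<close> and \<open>j\<close> with a strict gain. The scales do
  not compete because equal labels lie in equal cells.\<close>

lemma optimal_matching:
  fixes \<alpha> \<beta> :: "'i \<Rightarrow> 'a" and c :: "'a \<Rightarrow> 'b"
  assumes "finite J"
  obtains \<pi> where "\<pi> permutes J"
    "\<And>i j. \<lbrakk>i \<in> J; j \<in> J; \<beta> (\<pi> i) \<noteq> \<alpha> i; \<beta> (\<pi> j) = \<alpha> i\<rbrakk> \<Longrightarrow> \<alpha> j = \<alpha> i"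
    "\<And>i j. \<lbrakk>i \<in> J; j \<in> J; c (\<beta> (\<pi> i)) \<noteq> c (\<alpha> i); c (\<beta> (\<pi> j)) = c (\<alpha> i)\<rbrakk> \<Longrightarrow> c (\<alpha> j) = c (\<alpha> i)"
proof -
  define f where "f a b = (if a = b then 1 else 0) + (if c a = c b then 1 else 0 :: nat)" for a b
  define score where "score \<pi> = (\<Sum>i\<in>J. f (\<alpha> i) (\<beta> (\<pi> i)))" for \<pi>
  have fin: "finite {\<pi>. \<pi> permutes J}" by (rule finite_permutations[OF assms])
  have "Max (score ` {\<pi>. \<pi> permutes J}) \<in> score ` {\<pi>. \<pi> permutes J}"
    using fin by (intro Max_in) (auto intro: permutes_id)
  then obtain \<pi> where \<pi>: "\<pi> permutes J" "Max (score ` {\<pi>. \<pi> permutes J}) = score \<pi>" by auto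
  have max: "score \<pi>' \<le> score \<pi>" if "\<pi>' permutes J" for \<pi>'
    unfolding \<pi>(2)[symmetric] using fin that by (intro Max_ge) auto
  have swap: "f (\<alpha> i) (\<beta> (\<pi> j)) + f (\<alpha> j) (\<beta> (\<pi> i)) \<le> f (\<alpha> i) (\<beta> (\<pi> i)) + f (\<alpha> j) (\<beta> (\<pi> j))"
    if ij: "i \<in> J" "j \<in> J" "i \<noteq> j" for i j
  proof -
    have split: "(\<Sum>k\<in>J. g k) = g i + g j + (\<Sum>k\<in>J - {i, j}. g k)" for g :: "'i \<Rightarrow> nat"
    proof -
      have "(\<Sum>k\<in>J. g k) = g i + (\<Sum>k\<in>J - {i}. g k)" by (rule sum.remove) (use assms ij in auto)
      also have "(\<Sum>k\<in>J - {i}. g k) = g j + (\<Sum>k\<in>J - {i} - {j}. g k)"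
        by (rule sum.remove) (use assms ij in auto)
      also have "J - {i} - {j} = J - {i, j}" by auto
      finally show ?thesis by simp
    qed
    let ?\<pi> = "\<pi> \<circ> Transposition.transpose i j"
    have "score ?\<pi> \<le> score \<pi>"
      by (intro max permutes_compose \<pi>(1) permutes_swap_id ij)
    moreover have "(\<Sum>k\<in>J - {i, j}. f (\<alpha> k) (\<beta> (?\<pi> k))) = (\<Sum>k\<in>J - {i, j}. f (\<alpha> k) (\<beta> (\<pi> k)))"
      by (rule sum.cong) (auto simp: Transposition.transpose_def)
    ultimately show ?thesis unfolding score_def split by simp
  qed
  show thesis
  proof (rule that[OF \<pi>(1)])
    fix i j assume *: "i \<in> J" "j \<in> J" "\<beta> (\<pi> i) \<noteq> \<alpha> i" "\<beta> (\<pi> j) = \<alpha> i"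
    then have "i \<noteq> j" by auto
    from swap[OF *(1,2) this] * show "\<alpha> j = \<alpha> i" by (auto simp: f_def split: if_splits)
  next
    fix i j assume *: "i \<in> J" "j \<in> J" "c (\<beta> (\<pi> i)) \<noteq> c (\<alpha> i)" "c (\<beta> (\<pi> j)) = c (\<alpha> i)"
    then have "i \<noteq> j" by auto
    from swap[OF *(1,2) this] * show "c (\<alpha> j) = c (\<alpha> i)" by (auto simp: f_def split: if_splits)
  qed
qed

definition freq :: "'i set \<Rightarrow> ('i \<Rightarrow> 'a) \<Rightarrow> 'a \<Rightarrow> real" where
  "freq J \<alpha> a = card {i \<in> J. \<alpha> i = a} / card J"

lemma freq_nonneg [simp]: "0 \<le> freq J \<alpha> a"
  by (simp add: freq_def)

text \<open>The hypothesis excludes unmatched copies of one label on both sides. So one of the two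
  counts is 0, and the other is exactly the difference of the frequencies, scaled by
  \<open>card J\<close>.\<close>

lemma mismatch_le:
  fixes \<alpha> \<beta> :: "'i \<Rightarrow> 'a"
  assumes "finite J" and "\<And>i j. \<lbrakk>i \<in> J; j \<in> J; \<beta> i \<noteq> \<alpha> i; \<beta> j = \<alpha> i\<rbrakk> \<Longrightarrow> \<alpha> j = \<alpha> i"
  shows "card {i \<in> J. \<alpha> i = a \<and> \<beta> i \<noteq> a} \<le> card J * \<bar>freq J \<alpha> a - freq J \<beta> a\<bar>"
    and "card {i \<in> J. \<beta> i = a \<and> \<alpha> i \<noteq> a} \<le> card J * \<bar>freq J \<alpha> a - freq J \<beta> a\<bar>"
proof -
  let ?A = "{i \<in> J. \<alpha> i = a \<and> \<beta> i \<noteq> a}" and ?B = "{i \<in> J. \<beta> i = a \<and> \<alpha> i \<noteq> a}"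
    and ?C = "{i \<in> J. \<alpha> i = a \<and> \<beta> i = a}"
  have A: "card {i \<in> J. \<alpha> i = a} = card ?A + card ?C"
  proof -
    have "{i \<in> J. \<alpha> i = a} = ?A \<union> ?C" by auto
    then show ?thesis using assms(1) card_Un_disjoint[of ?A ?C] by auto
  qed
  have B: "card {i \<in> J. \<beta> i = a} = card ?B + card ?C"
  proof -
    have "{i \<in> J. \<beta> i = a} = ?B \<union> ?C" by auto
    then show ?thesis using assms(1) card_Un_disjoint[of ?B ?C] by auto
  qed
  have "card ?A = 0 \<or> card ?B = 0"
  proof (rule ccontr)
    assume "\<not> (card ?A = 0 \<or> card ?B = 0)"
    then have "?A \<noteq> {}" "?B \<noteq> {}" by (auto simp del: Collect_empty_eq)
    then obtain i j where "i \<in> ?A" "j \<in> ?B" by blast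
    then show False using assms(2)[of i j] by simp
  qed
  then have "real (card ?A) \<le> \<bar>real (card {i \<in> J. \<alpha> i = a}) - real (card {i \<in> J. \<beta> i = a})\<bar>"
    "real (card ?B) \<le> \<bar>real (card {i \<in> J. \<alpha> i = a}) - real (card {i \<in> J. \<beta> i = a})\<bar>"
    unfolding A B by auto
  moreover have "\<bar>real (card {i \<in> J. \<alpha> i = a}) - real (card {i \<in> J. \<beta> i = a})\<bar>
      = card J * \<bar>freq J \<alpha> a - freq J \<beta> a\<bar>"
  proof (cases "card J = 0")
    case True
    then have "J = {}" using assms(1) by simp
    then show ?thesis by simp
  next
    case False
    then have "card J * (freq J \<alpha> a - freq J \<beta> a) = real (card {i \<in> J. \<alpha> i = a}) - real (card {i \<in> J. \<beta> i = a})"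
      by (simp add: freq_def right_diff_distrib)
    then show ?thesis by (metis abs_mult abs_of_nat)
  qed
  ultimately show "card ?A \<le> card J * \<bar>freq J \<alpha> a - freq J \<beta> a\<bar>" "card ?B \<le> card J * \<bar>freq J \<alpha> a - freq J \<beta> a\<bar>"
    by auto
qed

text \<open>The l^1 norm of the image of the signed measure \<open>\<nu>\<close> on the set of
  cells.\<close>

definition coarse :: "'a set \<Rightarrow> ('a \<Rightarrow> 'b) \<Rightarrow> ('a \<Rightarrow> real) \<Rightarrow> real" where
  "coarse I c \<nu> = (\<Sum>A\<in>c ` I. \<bar>\<Sum>a\<in>{a \<in> I. c a = A}. \<nu> a\<bar>)"

lemma freq_comp:
  assumes "finite J" "finite I" "\<alpha> ` J \<subseteq> I"
  shows "freq J (\<lambda>i. c (\<alpha> i)) A = (\<Sum>a\<in>{a \<in> I. c a = A}. freq J \<alpha> a)"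
proof -
  have "{i \<in> J. c (\<alpha> i) = A} = (\<Union>a\<in>{a \<in> I. c a = A}. {i \<in> J. \<alpha> i = a})" using assms(3) by auto
  then have "card {i \<in> J. c (\<alpha> i) = A} = (\<Sum>a\<in>{a \<in> I. c a = A}. card {i \<in> J. \<alpha> i = a})"
    by (simp only:) (rule card_UN_disjoint, use assms in auto)
  then show ?thesis by (simp add: freq_def sum_divide_distrib)
qed

lemma coarse_mismatch_le:
  fixes \<alpha> \<beta> :: "'i \<Rightarrow> 'a"
  assumes "finite J" "finite I" "\<alpha> ` J \<subseteq> I" "\<beta> ` J \<subseteq> I"
    and "\<And>i j. \<lbrakk>i \<in> J; j \<in> J; c (\<beta> i) \<noteq> c (\<alpha> i); c (\<beta> j) = c (\<alpha> i)\<rbrakk> \<Longrightarrow> c (\<alpha> j) = c (\<alpha> i)"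
  shows "card {i \<in> J. c (\<alpha> i) \<noteq> c (\<beta> i)} \<le> card J * coarse I c (\<lambda>a. freq J \<alpha> a - freq J \<beta> a)"
proof -
  have "{i \<in> J. c (\<alpha> i) \<noteq> c (\<beta> i)} = (\<Union>A\<in>c ` I. {i \<in> J. c (\<alpha> i) = A \<and> c (\<beta> i) \<noteq> A})"
  proof (intro set_eqI iffI)
    fix i assume "i \<in> {i \<in> J. c (\<alpha> i) \<noteq> c (\<beta> i)}"
    then show "i \<in> (\<Union>A\<in>c ` I. {i \<in> J. c (\<alpha> i) = A \<and> c (\<beta> i) \<noteq> A})"
      using assms(3) by (intro UN_I[of "c (\<alpha> i)"]) auto
  qed auto
  then have "real (card {i \<in> J. c (\<alpha> i) \<noteq> c (\<beta> i)}) \<le> real (\<Sum>A\<in>c ` I. card {i \<in> J. c (\<alpha> i) = A \<and> c (\<beta> i) \<noteq> A})"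
    using card_UN_le[of "c ` I" "\<lambda>A. {i \<in> J. c (\<alpha> i) = A \<and> c (\<beta> i) \<noteq> A}"] assms(2)
    by (simp only: of_nat_le_iff finite_imageI)
  also have "\<dots> \<le> (\<Sum>A\<in>c ` I. card J * \<bar>freq J (\<lambda>i. c (\<alpha> i)) A - freq J (\<lambda>i. c (\<beta> i)) A\<bar>)"
    unfolding of_nat_sum
    by (rule sum_mono, rule mismatch_le(1)[of J "\<lambda>i. c (\<beta> i)" "\<lambda>i. c (\<alpha> i)", OF assms(1)], rule assms(5))
  also have "\<dots> = card J * coarse I c (\<lambda>a. freq J \<alpha> a - freq J \<beta> a)"
    unfolding coarse_def freq_comp[OF assms(1,2,3)] freq_comp[OF assms(1,2,4)]
    by (simp add: sum_distrib_left sum_subtractf)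
  finally show ?thesis .
qed

lemma sum_by_label:
  fixes R :: "'a \<Rightarrow> 'a \<Rightarrow> real"
  assumes "finite J" "finite I" "\<alpha> ` J \<subseteq> I"
  shows "(\<Sum>i\<in>J. \<Sum>j\<in>J. s i * t j * R (\<alpha> i) (\<alpha> j))
    = (\<Sum>a\<in>I. \<Sum>b\<in>I. (\<Sum>i\<in>{i\<in>J. \<alpha> i = a}. s i) * (\<Sum>j\<in>{j\<in>J. \<alpha> j = b}. t j) * R a b)"
proof -
  have grp: "(\<Sum>i\<in>J. g i) = (\<Sum>a\<in>I. \<Sum>i\<in>{i\<in>J. \<alpha> i = a}. g i)" for g :: "_ \<Rightarrow> real"
    by (rule sum.group[symmetric, OF assms])
  have "(\<Sum>i\<in>J. \<Sum>j\<in>J. s i * t j * R (\<alpha> i) (\<alpha> j))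
      = (\<Sum>a\<in>I. \<Sum>i\<in>{i\<in>J. \<alpha> i = a}. \<Sum>b\<in>I. \<Sum>j\<in>{j\<in>J. \<alpha> j = b}. s i * t j * R (\<alpha> i) (\<alpha> j))"
    by (subst grp) (intro sum.cong refl grp)
  also have "\<dots> = (\<Sum>a\<in>I. \<Sum>b\<in>I. \<Sum>i\<in>{i\<in>J. \<alpha> i = a}. \<Sum>j\<in>{j\<in>J. \<alpha> j = b}. s i * t j * R (\<alpha> i) (\<alpha> j))"
    by (intro sum.cong refl sum.swap)
  also have "\<dots> = (\<Sum>a\<in>I. \<Sum>b\<in>I. (\<Sum>i\<in>{i\<in>J. \<alpha> i = a}. s i) * (\<Sum>j\<in>{j\<in>J. \<alpha> j = b}. t j) * R a b)"
  proof (intro sum.cong refl)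
    fix a b
    have "(\<Sum>i\<in>{i\<in>J. \<alpha> i = a}. s i) * (\<Sum>j\<in>{j\<in>J. \<alpha> j = b}. t j) * R a b
        = (\<Sum>i\<in>{i\<in>J. \<alpha> i = a}. \<Sum>j\<in>{j\<in>J. \<alpha> j = b}. s i * t j * R a b)"
      by (subst sum_product) (simp only: sum_distrib_right)
    also have "\<dots> = (\<Sum>i\<in>{i\<in>J. \<alpha> i = a}. \<Sum>j\<in>{j\<in>J. \<alpha> j = b}. s i * t j * R (\<alpha> i) (\<alpha> j))"
      by (intro sum.cong refl) auto
    finally show "(\<Sum>i\<in>{i\<in>J. \<alpha> i = a}. \<Sum>j\<in>{j\<in>J. \<alpha> j = b}. s i * t j * R (\<alpha> i) (\<alpha> j))
        = (\<Sum>i\<in>{i\<in>J. \<alpha> i = a}. s i) * (\<Sum>j\<in>{j\<in>J. \<alpha> j = b}. t j) * R a b" by simp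
  qed
  finally show ?thesis .
qed

lemma abs_double_sum_le:
  fixes s t :: "'i \<Rightarrow> real" and D :: "'i \<Rightarrow> 'i \<Rightarrow> real"
  assumes "finite J" "\<And>i. i \<in> J \<Longrightarrow> 0 \<le> s i \<and> s i \<le> 1" "\<And>i. i \<in> J \<Longrightarrow> 0 \<le> t i \<and> t i \<le> 1"
    "\<And>i j. i \<in> J \<Longrightarrow> j \<in> J \<Longrightarrow> \<bar>D i j\<bar> \<le> (1::real)"
    and subset: "B \<subseteq> J"
  shows "\<bar>\<Sum>i\<in>J. \<Sum>j\<in>J. s i * t j * D i j\<bar>
    \<le> 2 * card J * card B + \<bar>\<Sum>i\<in>J. \<Sum>j\<in>J. (if i \<in> B then 0 else s i) * (if j \<in> B then 0 else t j) * D i j\<bar>"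
proof -
  have finB: "finite B" using subset assms(1) finite_subset by blast
  have "\<bar>(\<Sum>i\<in>J. \<Sum>j\<in>J. s i * t j * D i j) - (\<Sum>i\<in>J. \<Sum>j\<in>J. (if i \<in> B then 0 else s i) * (if j \<in> B then 0 else t j) * D i j)\<bar>
      \<le> (\<Sum>i\<in>J. \<Sum>j\<in>J. \<bar>s i * t j * D i j - (if i \<in> B then 0 else s i) * (if j \<in> B then 0 else t j) * D i j\<bar>)"
    unfolding sum_subtractf[symmetric] by (intro order_trans[OF sum_abs] sum_mono sum_abs)
  also have "\<dots> \<le> (\<Sum>i\<in>J. \<Sum>j\<in>J. (if i \<in> B then 1 else 0) + (if j \<in> B then 1 else 0))"
  proof (intro sum_mono)
    fix i j assume ij: "i \<in> J" "j \<in> J"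
    have "\<bar>s i * t j * D i j\<bar> \<le> 1 * 1 * 1"
      unfolding abs_mult by (intro mult_mono) (use assms ij in auto)
    then show "\<bar>s i * t j * D i j - (if i \<in> B then 0 else s i) * (if j \<in> B then 0 else t j) * D i j\<bar>
        \<le> (if i \<in> B then 1 else 0) + (if j \<in> B then 1 else 0)" by auto
  qed
  also have "\<dots> = 2 * card J * card B"
  proof -
    have "(\<Sum>i\<in>J. if i \<in> B then 1 else 0) = real (card B)"
      using subset assms(1) finB by (simp add: sum.If_cases Int_absorb1)
    then show ?thesis by (simp add: sum.distrib sum_distrib_left[symmetric])
  qed
  finally show ?thesis by linarith
qed

context weighted_set
begin

text \<open>Dividing by \<open>p\<close> turns masses into densities, to which the operator norm on
  L^2(\<open>p\<close>) applies; the norms are monotone in the absolute values.\<close>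

lemma form_of_masses:
  assumes "form_bounded R \<epsilon>" "0 \<le> \<epsilon>"
    and x: "\<And>a. a \<in> I \<Longrightarrow> \<bar>x a\<bar> \<le> \<bar>u a\<bar>" and y: "\<And>a. a \<in> I \<Longrightarrow> \<bar>y a\<bar> \<le> \<bar>v a\<bar>"
  shows "\<bar>\<Sum>a\<in>I. \<Sum>b\<in>I. x a * y b * R a b\<bar>
    \<le> \<epsilon> * sqrt (sqnorm (\<lambda>a. u a / p a)) * sqrt (sqnorm (\<lambda>a. v a / p a))"
proof -
  have "(\<Sum>a\<in>I. \<Sum>b\<in>I. x a * y b * R a b) = form R (\<lambda>a. x a / p a) (\<lambda>b. y b / p b)"
  proof -
    have "p a \<noteq> 0" if "a \<in> I" for a using p_pos[OF that] by simp
    then show ?thesis unfolding form_def by (intro sum.cong refl) simp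
  qed
  also have "\<bar>\<dots>\<bar> \<le> \<epsilon> * sqrt (sqnorm (\<lambda>a. x a / p a)) * sqrt (sqnorm (\<lambda>a. y a / p a))"
    by (rule form_boundedD[OF assms(1)])
  also have "\<dots> \<le> \<epsilon> * sqrt (sqnorm (\<lambda>a. u a / p a)) * sqrt (sqnorm (\<lambda>a. v a / p a))"
    by (intro mult_mono real_sqrt_le_mono sqnorm_mono mult_nonneg_nonneg)
      (use assms(2) x y p_pos in \<open>auto simp: abs_divide divide_right_mono less_imp_le\<close>)
  finally show ?thesis .
qed

end

section \<open>Comparing the kernel along two matched labellings\<close>

locale regular_kernel = weighted_set I p for I :: "'a set" and p +
  fixes Q R :: "'a \<Rightarrow> 'a \<Rightarrow> real" and c :: "'a \<Rightarrow> 'b" and \<epsilon> :: real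
  assumes Q_sym: "a \<in> I \<Longrightarrow> b \<in> I \<Longrightarrow> Q a b = Q b a"
    and Q_range: "a \<in> I \<Longrightarrow> b \<in> I \<Longrightarrow> 0 \<le> Q a b \<and> Q a b \<le> 1"
    and cells: "\<lbrakk>a \<in> I; b \<in> I; a' \<in> I; b' \<in> I; c a = c a'; c b = c b'\<rbrakk> \<Longrightarrow> Q a b - R a b = Q a' b' - R a' b'"
    and R_bounded: "form_bounded R \<epsilon>"
    and eps_nonneg: "0 \<le> \<epsilon>"
begin

text \<open>The residual on mismatched labels: one argument of the form carries only the mismatch,
  hence the norm of \<open>u - v\<close>; the other is free and carries the full label mass, once
  for each labelling.\<close>

definition fine_bound :: "('a \<Rightarrow> real) \<Rightarrow> ('a \<Rightarrow> real) \<Rightarrow> real" where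
  "fine_bound u v = \<epsilon> * sqrt (sqnorm (\<lambda>a. (u a - v a) / p a)) *
     (sqrt (sqnorm (\<lambda>a. u a / p a)) + sqrt (sqnorm (\<lambda>a. v a / p a)))"

context
  fixes J :: "'i set" and \<alpha> \<beta> :: "'i \<Rightarrow> 'a"
  assumes finJ: "finite J" and \<alpha>I: "\<alpha> ` J \<subseteq> I" and \<beta>I: "\<beta> ` J \<subseteq> I"
    and fine: "\<And>i j. \<lbrakk>i \<in> J; j \<in> J; \<beta> i \<noteq> \<alpha> i; \<beta> j = \<alpha> i\<rbrakk> \<Longrightarrow> \<alpha> j = \<alpha> i"
    and crs: "\<And>i j. \<lbrakk>i \<in> J; j \<in> J; c (\<beta> i) \<noteq> c (\<alpha> i); c (\<beta> j) = c (\<alpha> i)\<rbrakk> \<Longrightarrow> c (\<alpha> j) = c (\<alpha> i)"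
begin

lemma label_mass_le:
  assumes "\<And>i. i \<in> J \<Longrightarrow> 0 \<le> s i \<and> s i \<le> (1::real)" "\<And>i. i \<in> J \<Longrightarrow> i \<notin> B \<Longrightarrow> s i = 0"
  shows "\<bar>\<Sum>i\<in>{i\<in>J. \<alpha>' i = a}. s i\<bar> \<le> card {i \<in> J. \<alpha>' i = a \<and> i \<in> B}"
proof -
  have "\<bar>\<Sum>i\<in>{i\<in>J. \<alpha>' i = a}. s i\<bar> \<le> (\<Sum>i\<in>{i\<in>J. \<alpha>' i = a}. if i \<in> B then 1 else 0)"
    by (intro order_trans[OF sum_abs] sum_mono) (use assms in auto)
  also have "\<dots> = card {i \<in> J. \<alpha>' i = a \<and> i \<in> B}"
    using finJ by (simp add: sum.If_cases Collect_conj_eq[symmetric] Int_def conj_assoc)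
  finally show ?thesis .
qed

text \<open>The mass that \<open>s\<close> puts on a label is at most the number of mismatched
  indices with that label, which the matching bounds by the difference of frequencies. The terms for
  \<open>\<alpha>\<close> and \<open>\<beta>\<close> are estimated separately by the triangle
  inequality.\<close>

lemma half_bound:
  assumes s: "\<And>i. i \<in> J \<Longrightarrow> 0 \<le> s i \<and> s i \<le> (1::real)" and t: "\<And>i. i \<in> J \<Longrightarrow> 0 \<le> t i \<and> t i \<le> (1::real)"
    and s0: "\<And>i. i \<in> J \<Longrightarrow> \<alpha> i = \<beta> i \<Longrightarrow> s i = 0"
  shows "\<bar>\<Sum>i\<in>J. \<Sum>j\<in>J. s i * t j * (R (\<alpha> i) (\<alpha> j) - R (\<beta> i) (\<beta> j))\<bar>
    \<le> (card J)\<^sup>2 * fine_bound (freq J \<alpha>) (freq J \<beta>)"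
proof -
  define N where "N = real (card J)"
  have N0: "0 \<le> N" by (simp add: N_def)
  have scale: "sqrt (sqnorm (\<lambda>a. N * u a / p a)) = N * sqrt (sqnorm (\<lambda>a. u a / p a))" for u
    using sqnorm_scale[of N "\<lambda>a. u a / p a"] N0 by (simp add: real_sqrt_mult)
  have full: "real (card {i \<in> J. \<gamma> i = a}) = N * freq J \<gamma> a" for \<gamma> :: "'i \<Rightarrow> 'a" and a
    using finJ by (cases "J = {}") (auto simp: freq_def N_def)
  have half: "\<bar>\<Sum>i\<in>J. \<Sum>j\<in>J. s i * t j * R (\<gamma> i) (\<gamma> j)\<bar>
      \<le> N\<^sup>2 * (\<epsilon> * sqrt (sqnorm (\<lambda>a. (freq J \<alpha> a - freq J \<beta> a) / p a)) * sqrt (sqnorm (\<lambda>a. freq J \<gamma> a / p a)))"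
    if \<gamma>: "\<gamma> ` J \<subseteq> I" "\<And>a. card {i \<in> J. \<gamma> i = a \<and> \<alpha> i \<noteq> \<beta> i} \<le> N * \<bar>freq J \<alpha> a - freq J \<beta> a\<bar>"
    for \<gamma> :: "'i \<Rightarrow> 'a"
  proof -
    have "\<bar>\<Sum>i\<in>J. \<Sum>j\<in>J. s i * t j * R (\<gamma> i) (\<gamma> j)\<bar>
        \<le> \<epsilon> * sqrt (sqnorm (\<lambda>a. N * (freq J \<alpha> a - freq J \<beta> a) / p a)) * sqrt (sqnorm (\<lambda>a. N * freq J \<gamma> a / p a))"
      unfolding sum_by_label[OF finJ finite_I \<gamma>(1)]
    proof (rule form_of_masses[OF R_bounded eps_nonneg])
      fix a
      have "\<bar>\<Sum>i\<in>{i\<in>J. \<gamma> i = a}. s i\<bar> \<le> card {i \<in> J. \<gamma> i = a \<and> i \<in> {i. \<alpha> i \<noteq> \<beta> i}}"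
        by (rule label_mass_le) (use s s0 in auto)
      then show "\<bar>\<Sum>i\<in>{i\<in>J. \<gamma> i = a}. s i\<bar> \<le> \<bar>N * (freq J \<alpha> a - freq J \<beta> a)\<bar>"
        using \<gamma>(2)[of a] by (simp add: abs_mult N_def)
      have "\<bar>\<Sum>i\<in>{i\<in>J. \<gamma> i = a}. t i\<bar> \<le> card {i \<in> J. \<gamma> i = a \<and> i \<in> UNIV}"
        by (rule label_mass_le) (use t in auto)
      then show "\<bar>\<Sum>i\<in>{i\<in>J. \<gamma> i = a}. t i\<bar> \<le> \<bar>N * freq J \<gamma> a\<bar>"
        using full[of \<gamma> a] N0 by (simp add: abs_mult)
    qed
    also have "\<dots> = N\<^sup>2 * (\<epsilon> * sqrt (sqnorm (\<lambda>a. (freq J \<alpha> a - freq J \<beta> a) / p a)) * sqrt (sqnorm (\<lambda>a. freq J \<gamma> a / p a)))"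
      unfolding scale by (simp add: power2_eq_square)
    finally show ?thesis .
  qed
  have a: "card {i \<in> J. \<alpha> i = a \<and> \<alpha> i \<noteq> \<beta> i} \<le> N * \<bar>freq J \<alpha> a - freq J \<beta> a\<bar>" for a
  proof -
    have "{i \<in> J. \<alpha> i = a \<and> \<alpha> i \<noteq> \<beta> i} = {i \<in> J. \<alpha> i = a \<and> \<beta> i \<noteq> a}" by auto
    then show ?thesis unfolding N_def using mismatch_le(1)[OF finJ fine] by (simp only:)
  qed
  have b: "card {i \<in> J. \<beta> i = a \<and> \<alpha> i \<noteq> \<beta> i} \<le> N * \<bar>freq J \<alpha> a - freq J \<beta> a\<bar>" for a
  proof -
    have "{i \<in> J. \<beta> i = a \<and> \<alpha> i \<noteq> \<beta> i} = {i \<in> J. \<beta> i = a \<and> \<alpha> i \<noteq> a}" by auto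
    then show ?thesis unfolding N_def using mismatch_le(2)[OF finJ fine] by (simp only:)
  qed
  have "(\<Sum>i\<in>J. \<Sum>j\<in>J. s i * t j * (R (\<alpha> i) (\<alpha> j) - R (\<beta> i) (\<beta> j)))
      = (\<Sum>i\<in>J. \<Sum>j\<in>J. s i * t j * R (\<alpha> i) (\<alpha> j)) - (\<Sum>i\<in>J. \<Sum>j\<in>J. s i * t j * R (\<beta> i) (\<beta> j))"
    by (simp add: sum_subtractf right_diff_distrib)
  then show ?thesis
    using half[OF \<alpha>I a] half[OF \<beta>I b] unfolding fine_bound_def N_def[symmetric] of_nat_power
    by (simp only: distrib_left)
qed

text \<open>Rows and columns with mismatched cells are removed at the price of
  \<open>coarse\<close>; on the others \<open>Q - R\<close> takes the same value for both labellings
  and cancels. A transposed form is supplied too, since \<open>R\<close> may be asymmetric while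
  \<open>half_bound\<close> wants the mismatched index first.\<close>

lemma coarse_reduction:
  assumes s: "\<And>i. i \<in> J \<Longrightarrow> 0 \<le> s i \<and> s i \<le> (1::real)" and t: "\<And>i. i \<in> J \<Longrightarrow> 0 \<le> t i \<and> t i \<le> (1::real)"
  obtains s' t' where "\<And>i. i \<in> J \<Longrightarrow> 0 \<le> s' i \<and> s' i \<le> (1::real)" "\<And>i. i \<in> J \<Longrightarrow> 0 \<le> t' i \<and> t' i \<le> (1::real)"
    "\<bar>\<Sum>i\<in>J. \<Sum>j\<in>J. s i * t j * (Q (\<alpha> i) (\<alpha> j) - Q (\<beta> i) (\<beta> j))\<bar>
      \<le> (card J)\<^sup>2 * (2 * coarse I c (\<lambda>a. freq J \<alpha> a - freq J \<beta> a))
        + \<bar>\<Sum>i\<in>J. \<Sum>j\<in>J. s' i * t' j * (Q (\<alpha> i) (\<alpha> j) - Q (\<beta> i) (\<beta> j))\<bar>"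
    "\<And>i j. i \<in> J \<Longrightarrow> j \<in> J \<Longrightarrow> s' i * t' j * (Q (\<alpha> i) (\<alpha> j) - Q (\<beta> i) (\<beta> j))
      = s' i * t' j * (R (\<alpha> i) (\<alpha> j) - R (\<beta> i) (\<beta> j))"
    "\<And>i j. i \<in> J \<Longrightarrow> j \<in> J \<Longrightarrow> s' i * t' j * (Q (\<alpha> i) (\<alpha> j) - Q (\<beta> i) (\<beta> j))
      = s' i * t' j * (R (\<alpha> j) (\<alpha> i) - R (\<beta> j) (\<beta> i))"
proof -
  define B where "B = {i \<in> J. c (\<alpha> i) \<noteq> c (\<beta> i)}"
  define s' where "s' i = (if i \<in> B then 0 else s i)" for i
  define t' where "t' i = (if i \<in> B then 0 else t i)" for i
  have in_I: "\<alpha> i \<in> I" "\<beta> i \<in> I" if "i \<in> J" for i using that \<alpha>I \<beta>I by auto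
  have "\<bar>\<Sum>i\<in>J. \<Sum>j\<in>J. s i * t j * (Q (\<alpha> i) (\<alpha> j) - Q (\<beta> i) (\<beta> j))\<bar> \<le> 2 * card J * card B
        + \<bar>\<Sum>i\<in>J. \<Sum>j\<in>J. s' i * t' j * (Q (\<alpha> i) (\<alpha> j) - Q (\<beta> i) (\<beta> j))\<bar>"
    unfolding s'_def t'_def
  proof (rule abs_double_sum_le[OF finJ s t])
    fix i j assume "i \<in> J" "j \<in> J"
    then have "0 \<le> Q (\<alpha> i) (\<alpha> j) \<and> Q (\<alpha> i) (\<alpha> j) \<le> 1" "0 \<le> Q (\<beta> i) (\<beta> j) \<and> Q (\<beta> i) (\<beta> j) \<le> 1"
      by (auto intro!: Q_range[THEN conjunct1] Q_range[THEN conjunct2] in_I)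
    then show "\<bar>Q (\<alpha> i) (\<alpha> j) - Q (\<beta> i) (\<beta> j)\<bar> \<le> 1" by auto
  qed (auto simp: B_def)
  moreover have "real (2 * card J * card B) \<le> (card J)\<^sup>2 * (2 * coarse I c (\<lambda>a. freq J \<alpha> a - freq J \<beta> a))"
  proof -
    have "2 * real (card J) * card B \<le> 2 * real (card J) * (card J * coarse I c (\<lambda>a. freq J \<alpha> a - freq J \<beta> a))"
      unfolding B_def by (intro mult_left_mono coarse_mismatch_le finJ finite_I \<alpha>I \<beta>I crs) auto
    then show ?thesis by (simp add: power2_eq_square mult.commute mult.left_commute)
  qed
  ultimately have main: "\<bar>\<Sum>i\<in>J. \<Sum>j\<in>J. s i * t j * (Q (\<alpha> i) (\<alpha> j) - Q (\<beta> i) (\<beta> j))\<bar>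
      \<le> (card J)\<^sup>2 * (2 * coarse I c (\<lambda>a. freq J \<alpha> a - freq J \<beta> a))
        + \<bar>\<Sum>i\<in>J. \<Sum>j\<in>J. s' i * t' j * (Q (\<alpha> i) (\<alpha> j) - Q (\<beta> i) (\<beta> j))\<bar>"
    by linarith
  have cell: "Q (\<alpha> i) (\<alpha> j) - Q (\<beta> i) (\<beta> j) = R (\<alpha> i) (\<alpha> j) - R (\<beta> i) (\<beta> j)"
    if "i \<in> J - B" "j \<in> J - B" for i j
    using cells[of "\<alpha> i" "\<alpha> j" "\<beta> i" "\<beta> j"] that in_I by (auto simp: B_def)
  have symm: "Q (\<alpha> i) (\<alpha> j) - Q (\<beta> i) (\<beta> j) = Q (\<alpha> j) (\<alpha> i) - Q (\<beta> j) (\<beta> i)" if "i \<in> J" "j \<in> J" for i j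
    using Q_sym[of "\<alpha> i" "\<alpha> j"] Q_sym[of "\<beta> i" "\<beta> j"] that in_I by simp
  show thesis
  proof (rule that[OF _ _ main])
    fix i j assume ij: "i \<in> J" "j \<in> J"
    show "s' i * t' j * (Q (\<alpha> i) (\<alpha> j) - Q (\<beta> i) (\<beta> j)) = s' i * t' j * (R (\<alpha> i) (\<alpha> j) - R (\<beta> i) (\<beta> j))"
      using cell[of i j] ij by (auto simp: s'_def t'_def)
    show "s' i * t' j * (Q (\<alpha> i) (\<alpha> j) - Q (\<beta> i) (\<beta> j)) = s' i * t' j * (R (\<alpha> j) (\<alpha> i) - R (\<beta> j) (\<beta> i))"
      using cell[of j i] symm[OF ij] ij by (auto simp: s'_def t'_def)
  qed (use s t in \<open>auto simp: s'_def t'_def\<close>)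
qed

text \<open>Pairs with both labels matched cancel. The remaining pairs are split into those with
  \<open>i\<close> mismatched and those where only \<open>j\<close> is; the second kind uses the
  transposed form and the symmetry of \<open>Q\<close>.\<close>

lemma grid_bound_fine:
  assumes s: "\<And>i. i \<in> J \<Longrightarrow> 0 \<le> s i \<and> s i \<le> (1::real)" and t: "\<And>i. i \<in> J \<Longrightarrow> 0 \<le> t i \<and> t i \<le> (1::real)"
  shows "\<bar>\<Sum>i\<in>J. \<Sum>j\<in>J. s i * t j * (Q (\<alpha> i) (\<alpha> j) - Q (\<beta> i) (\<beta> j))\<bar>
    \<le> (card J)\<^sup>2 * (2 * coarse I c (\<lambda>a. freq J \<alpha> a - freq J \<beta> a) + 2 * fine_bound (freq J \<alpha>) (freq J \<beta>))"
proof -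
  obtain s' t' where s': "\<And>i. i \<in> J \<Longrightarrow> 0 \<le> s' i \<and> s' i \<le> (1::real)" and t': "\<And>i. i \<in> J \<Longrightarrow> 0 \<le> t' i \<and> t' i \<le> (1::real)"
    and le: "\<bar>\<Sum>i\<in>J. \<Sum>j\<in>J. s i * t j * (Q (\<alpha> i) (\<alpha> j) - Q (\<beta> i) (\<beta> j))\<bar>
      \<le> (card J)\<^sup>2 * (2 * coarse I c (\<lambda>a. freq J \<alpha> a - freq J \<beta> a))
        + \<bar>\<Sum>i\<in>J. \<Sum>j\<in>J. s' i * t' j * (Q (\<alpha> i) (\<alpha> j) - Q (\<beta> i) (\<beta> j))\<bar>"
    and R1: "\<And>i j. i \<in> J \<Longrightarrow> j \<in> J \<Longrightarrow> s' i * t' j * (Q (\<alpha> i) (\<alpha> j) - Q (\<beta> i) (\<beta> j))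
      = s' i * t' j * (R (\<alpha> i) (\<alpha> j) - R (\<beta> i) (\<beta> j))"
    and R2: "\<And>i j. i \<in> J \<Longrightarrow> j \<in> J \<Longrightarrow> s' i * t' j * (Q (\<alpha> i) (\<alpha> j) - Q (\<beta> i) (\<beta> j))
      = s' i * t' j * (R (\<alpha> j) (\<alpha> i) - R (\<beta> j) (\<beta> i))"
    by (rule coarse_reduction[OF s t], assumption, assumption) (rule that; assumption)
  let ?D = "\<lambda>i j. Q (\<alpha> i) (\<alpha> j) - Q (\<beta> i) (\<beta> j)"
  define s1 where "s1 i = (if \<alpha> i = \<beta> i then 0 else s' i)" for i
  define s2 where "s2 i = (if \<alpha> i = \<beta> i then s' i else 0)" for i
  define t1 where "t1 i = (if \<alpha> i = \<beta> i then 0 else t' i)" for i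
  have e1: "s1 i * t' j * X = (if \<alpha> i = \<beta> i then 0 else s' i * t' j * X)" for i j X
    by (simp add: s1_def)
  have e2: "s2 i * t1 j * X = (if \<alpha> i = \<beta> i \<and> \<alpha> j \<noteq> \<beta> j then s' i * t' j * X else 0)" for i j X
    by (simp add: s2_def t1_def)
  have "(\<Sum>i\<in>J. \<Sum>j\<in>J. s' i * t' j * ?D i j)
      = (\<Sum>i\<in>J. \<Sum>j\<in>J. s1 i * t' j * ?D i j) + (\<Sum>i\<in>J. \<Sum>j\<in>J. s2 i * t1 j * ?D i j)"
    unfolding sum.distrib[symmetric] by (intro sum.cong refl) (auto simp: s1_def s2_def t1_def)
  also have "(\<Sum>i\<in>J. \<Sum>j\<in>J. s1 i * t' j * ?D i j)
      = (\<Sum>i\<in>J. \<Sum>j\<in>J. s1 i * t' j * (R (\<alpha> i) (\<alpha> j) - R (\<beta> i) (\<beta> j)))"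
    by (intro sum.cong refl) (simp only: e1 R1)
  also have "(\<Sum>i\<in>J. \<Sum>j\<in>J. s2 i * t1 j * ?D i j)
      = (\<Sum>i\<in>J. \<Sum>j\<in>J. s2 i * t1 j * (R (\<alpha> j) (\<alpha> i) - R (\<beta> j) (\<beta> i)))"
    by (intro sum.cong refl) (simp only: e2 R2)
  also have "\<dots> = (\<Sum>j\<in>J. \<Sum>i\<in>J. t1 j * s2 i * (R (\<alpha> j) (\<alpha> i) - R (\<beta> j) (\<beta> i)))"
    by (subst sum.swap) (simp add: mult.commute mult.left_commute)
  finally have eq: "(\<Sum>i\<in>J. \<Sum>j\<in>J. s' i * t' j * ?D i j)
      = (\<Sum>i\<in>J. \<Sum>j\<in>J. s1 i * t' j * (R (\<alpha> i) (\<alpha> j) - R (\<beta> i) (\<beta> j)))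
      + (\<Sum>j\<in>J. \<Sum>i\<in>J. t1 j * s2 i * (R (\<alpha> j) (\<alpha> i) - R (\<beta> j) (\<beta> i)))" .
  have "\<bar>\<Sum>i\<in>J. \<Sum>j\<in>J. s1 i * t' j * (R (\<alpha> i) (\<alpha> j) - R (\<beta> i) (\<beta> j))\<bar>
      \<le> (card J)\<^sup>2 * fine_bound (freq J \<alpha>) (freq J \<beta>)"
    by (rule half_bound) (use s' t' in \<open>auto simp: s1_def\<close>)
  moreover have "\<bar>\<Sum>j\<in>J. \<Sum>i\<in>J. t1 j * s2 i * (R (\<alpha> j) (\<alpha> i) - R (\<beta> j) (\<beta> i))\<bar>
      \<le> (card J)\<^sup>2 * fine_bound (freq J \<alpha>) (freq J \<beta>)"
    by (rule half_bound) (use s' t' in \<open>auto simp: s2_def t1_def\<close>)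
  ultimately have "\<bar>\<Sum>i\<in>J. \<Sum>j\<in>J. s' i * t' j * ?D i j\<bar> \<le> (card J)\<^sup>2 * (2 * fine_bound (freq J \<alpha>) (freq J \<beta>))"
    unfolding eq by linarith
  with le show ?thesis unfolding distrib_left by linarith
qed

text \<open>Meant for the regime of many labels, where frequencies need not be close to masses label
  by label. Nothing is gained from the difference, so the two residual terms are bounded one by one:
  the sampled side by \<open>F\<close>, the other by the operator norm.\<close>

lemma grid_bound_sampled:
  assumes s: "\<And>i. i \<in> J \<Longrightarrow> 0 \<le> s i \<and> s i \<le> (1::real)" and t: "\<And>i. i \<in> J \<Longrightarrow> 0 \<le> t i \<and> t i \<le> (1::real)"
    and F: "\<And>x y. \<lbrakk>\<And>a. a \<in> I \<Longrightarrow> \<bar>x a\<bar> \<le> freq J \<alpha> a; \<And>a. a \<in> I \<Longrightarrow> \<bar>y a\<bar> \<le> freq J \<alpha> a\<rbrakk>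
      \<Longrightarrow> \<bar>\<Sum>a\<in>I. \<Sum>b\<in>I. x a * y b * R a b\<bar> \<le> F"
  shows "\<bar>\<Sum>i\<in>J. \<Sum>j\<in>J. s i * t j * (Q (\<alpha> i) (\<alpha> j) - Q (\<beta> i) (\<beta> j))\<bar>
    \<le> (card J)\<^sup>2 * (2 * coarse I c (\<lambda>a. freq J \<alpha> a - freq J \<beta> a) + (F + \<epsilon> * sqnorm (\<lambda>a. freq J \<beta> a / p a)))"
proof -
  obtain s' t' where s': "\<And>i. i \<in> J \<Longrightarrow> 0 \<le> s' i \<and> s' i \<le> (1::real)" and t': "\<And>i. i \<in> J \<Longrightarrow> 0 \<le> t' i \<and> t' i \<le> (1::real)"
    and le: "\<bar>\<Sum>i\<in>J. \<Sum>j\<in>J. s i * t j * (Q (\<alpha> i) (\<alpha> j) - Q (\<beta> i) (\<beta> j))\<bar>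
      \<le> (card J)\<^sup>2 * (2 * coarse I c (\<lambda>a. freq J \<alpha> a - freq J \<beta> a))
        + \<bar>\<Sum>i\<in>J. \<Sum>j\<in>J. s' i * t' j * (Q (\<alpha> i) (\<alpha> j) - Q (\<beta> i) (\<beta> j))\<bar>"
    and R1: "\<And>i j. i \<in> J \<Longrightarrow> j \<in> J \<Longrightarrow> s' i * t' j * (Q (\<alpha> i) (\<alpha> j) - Q (\<beta> i) (\<beta> j))
      = s' i * t' j * (R (\<alpha> i) (\<alpha> j) - R (\<beta> i) (\<beta> j))"
    by (rule coarse_reduction[OF s t], assumption, assumption) (rule that; assumption)
  define N where "N = real (card J)"
  have N0: "0 \<le> N" by (simp add: N_def)
  have scale: "sqrt (sqnorm (\<lambda>a. N * u a / p a)) = N * sqrt (sqnorm (\<lambda>a. u a / p a))" for u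
    using sqnorm_scale[of N "\<lambda>a. u a / p a"] N0 by (simp add: real_sqrt_mult)
  have full: "real (card {i \<in> J. \<gamma> i = a}) = N * freq J \<gamma> a" for \<gamma> :: "'i \<Rightarrow> 'a" and a
    using finJ by (cases "J = {}") (auto simp: freq_def N_def)
  have mass: "\<bar>\<Sum>i\<in>{i\<in>J. \<gamma> i = a}. r i\<bar> \<le> N * freq J \<gamma> a"
    if "\<And>i. i \<in> J \<Longrightarrow> 0 \<le> r i \<and> r i \<le> (1::real)" for \<gamma> :: "'i \<Rightarrow> 'a" and a r
    using label_mass_le[of r UNIV \<gamma> a] that full[of \<gamma> a] by simp
  have sA: "\<bar>\<Sum>i\<in>J. \<Sum>j\<in>J. s' i * t' j * R (\<alpha> i) (\<alpha> j)\<bar> \<le> N\<^sup>2 * F"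
  proof (cases "N = 0")
    case True
    then have "J = {}" using finJ by (simp add: N_def)
    then show ?thesis by (simp add: N_def)
  next
    case False
    then have Np: "0 < N" using N0 by simp
    define X where "X a = (\<Sum>i\<in>{i\<in>J. \<alpha> i = a}. s' i) / N" for a
    define Y where "Y a = (\<Sum>i\<in>{i\<in>J. \<alpha> i = a}. t' i) / N" for a
    have "(\<Sum>i\<in>J. \<Sum>j\<in>J. s' i * t' j * R (\<alpha> i) (\<alpha> j)) = (\<Sum>a\<in>I. \<Sum>b\<in>I. (N * X a) * (N * Y b) * R a b)"
      unfolding sum_by_label[OF finJ finite_I \<alpha>I] using False by (simp add: X_def Y_def)
    also have "\<dots> = N\<^sup>2 * (\<Sum>a\<in>I. \<Sum>b\<in>I. X a * Y b * R a b)"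
      by (simp add: sum_distrib_left power2_eq_square mult.assoc mult.left_commute)
    also have "\<bar>\<dots>\<bar> \<le> N\<^sup>2 * F"
      unfolding abs_mult
    proof (rule mult_mono)
      have "\<bar>X a\<bar> \<le> freq J \<alpha> a" "\<bar>Y a\<bar> \<le> freq J \<alpha> a" for a
        using mass[OF s', where \<gamma> = \<alpha> and a = a] mass[OF t', where \<gamma> = \<alpha> and a = a] Np
        by (simp_all add: X_def Y_def abs_divide divide_le_eq mult.commute)
      then show "\<bar>\<Sum>a\<in>I. \<Sum>b\<in>I. X a * Y b * R a b\<bar> \<le> F" by (intro F)
    qed auto
    finally show ?thesis .
  qed
  have "\<bar>\<Sum>i\<in>J. \<Sum>j\<in>J. s' i * t' j * R (\<beta> i) (\<beta> j)\<bar>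
      \<le> \<epsilon> * sqrt (sqnorm (\<lambda>a. N * freq J \<beta> a / p a)) * sqrt (sqnorm (\<lambda>a. N * freq J \<beta> a / p a))"
    unfolding sum_by_label[OF finJ finite_I \<beta>I]
    by (rule form_of_masses[OF R_bounded eps_nonneg]) (use mass[OF s', of _ \<beta>] mass[OF t', of _ \<beta>] N0 in \<open>auto simp: abs_mult\<close>)
  also have "\<dots> = N\<^sup>2 * (\<epsilon> * sqnorm (\<lambda>a. freq J \<beta> a / p a))"
    unfolding scale by (simp add: power2_eq_square)
  finally have sB: "\<bar>\<Sum>i\<in>J. \<Sum>j\<in>J. s' i * t' j * R (\<beta> i) (\<beta> j)\<bar> \<le> N\<^sup>2 * (\<epsilon> * sqnorm (\<lambda>a. freq J \<beta> a / p a))" .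
  have "(\<Sum>i\<in>J. \<Sum>j\<in>J. s' i * t' j * (Q (\<alpha> i) (\<alpha> j) - Q (\<beta> i) (\<beta> j)))
      = (\<Sum>i\<in>J. \<Sum>j\<in>J. s' i * t' j * R (\<alpha> i) (\<alpha> j)) - (\<Sum>i\<in>J. \<Sum>j\<in>J. s' i * t' j * R (\<beta> i) (\<beta> j))"
  proof -
    have "(\<Sum>i\<in>J. \<Sum>j\<in>J. s' i * t' j * (Q (\<alpha> i) (\<alpha> j) - Q (\<beta> i) (\<beta> j)))
        = (\<Sum>i\<in>J. \<Sum>j\<in>J. s' i * t' j * (R (\<alpha> i) (\<alpha> j) - R (\<beta> i) (\<beta> j)))"
      by (intro sum.cong refl R1)
    then show ?thesis by (simp add: sum_subtractf right_diff_distrib)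
  qed
  with sA sB le show ?thesis unfolding distrib_left N_def[symmetric] of_nat_power by linarith
qed

end

end

section \<open>Sampling the residual kernel\<close>

lemma double_sum_abs_le:
  fixes f :: "'a \<Rightarrow> 'b \<Rightarrow> real"
  shows "\<bar>\<Sum>a\<in>A. \<Sum>b\<in>B. f a b\<bar> \<le> (\<Sum>a\<in>A. \<Sum>b\<in>B. \<bar>f a b\<bar>)"
  by (intro order_trans[OF sum_abs] sum_mono sum_abs)

lemma double_weighted_Cauchy_Schwarz:
  fixes w f g :: "'a \<Rightarrow> 'a \<Rightarrow> real"
  assumes "\<And>x y. x \<in> A \<Longrightarrow> y \<in> A \<Longrightarrow> 0 \<le> w x y"
  shows "(\<Sum>x\<in>A. \<Sum>y\<in>A. w x y * f x y * g x y)\<^sup>2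
    \<le> (\<Sum>x\<in>A. \<Sum>y\<in>A. w x y * (f x y)\<^sup>2) * (\<Sum>x\<in>A. \<Sum>y\<in>A. w x y * (g x y)\<^sup>2)"
  using weighted_Cauchy_Schwarz[of "A \<times> A" "\<lambda>(x, y). w x y" "\<lambda>(x, y). f x y" "\<lambda>(x, y). g x y"] assms
  by (auto simp: sum.cartesian_product case_prod_unfold)

context weighted_set
begin

text \<open>Squared Hilbert-Schmidt norm of the error made in the Gram matrix of the columns when
  rows are weighted by \<open>\<mu>\<close> instead of \<open>p\<close>. The columns themselves
  carry the weights \<open>\<mu>\<close> here, whereas the outer weights in \<open>row_dev\<close>
  are \<open>p\<close>.\<close>

definition col_dev :: "('a \<Rightarrow> 'a \<Rightarrow> real) \<Rightarrow> ('a \<Rightarrow> real) \<Rightarrow> real" where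
  "col_dev R \<mu> = (\<Sum>b\<in>I. \<Sum>b'\<in>I. \<mu> b * \<mu> b' * (\<Sum>a\<in>I. (\<mu> a - p a) * (R a b * R a b'))\<^sup>2)"

definition row_dev :: "('a \<Rightarrow> 'a \<Rightarrow> real) \<Rightarrow> ('a \<Rightarrow> real) \<Rightarrow> real" where
  "row_dev R \<mu> = (\<Sum>a\<in>I. \<Sum>a'\<in>I. p a * p a' * (\<Sum>b\<in>I. (\<mu> b - p b) * (R a b * R a' b))\<^sup>2)"

lemma square_sum_expand:
  "(\<Sum>a\<in>I. w a * (\<Sum>b\<in>I. M a b * y b)\<^sup>2) = (\<Sum>b\<in>I. \<Sum>b'\<in>I. y b * y b' * (\<Sum>a\<in>I. w a * (M a b * M a b')))"
  for M :: "'a \<Rightarrow> 'a \<Rightarrow> real"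
proof -
  have "(\<Sum>a\<in>I. w a * (\<Sum>b\<in>I. M a b * y b)\<^sup>2) = (\<Sum>a\<in>I. \<Sum>b\<in>I. \<Sum>b'\<in>I. y b * y b' * (w a * (M a b * M a b')))"
    by (simp only: power2_eq_square sum_product, simp only: sum_distrib_left, intro sum.cong refl) (simp only: mult_ac)
  also have "\<dots> = (\<Sum>b\<in>I. \<Sum>a\<in>I. \<Sum>b'\<in>I. y b * y b' * (w a * (M a b * M a b')))"
    by (rule sum.swap)
  also have "\<dots> = (\<Sum>b\<in>I. \<Sum>b'\<in>I. \<Sum>a\<in>I. y b * y b' * (w a * (M a b * M a b')))"
    by (intro sum.cong refl sum.swap)
  finally show ?thesis by (simp only: sum_distrib_left)
qed

text \<open>The operator norm of a kernel restricted to a sample is controlled by passing to the two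
  Gram matrices, whose deviations from their means are measured in the Hilbert-Schmidt norm.\<close>

lemma sampled_form_bound:
  assumes R: "form_bounded R \<epsilon>" and "0 \<le> \<epsilon>"
    and \<mu>: "\<And>a. a \<in> I \<Longrightarrow> 0 \<le> \<mu> a" "sum \<mu> I \<le> 1"
    and x: "\<And>a. a \<in> I \<Longrightarrow> \<bar>x a\<bar> \<le> \<mu> a" and y: "\<And>a. a \<in> I \<Longrightarrow> \<bar>y a\<bar> \<le> \<mu> a"
  shows "\<bar>\<Sum>a\<in>I. \<Sum>b\<in>I. x a * y b * R a b\<bar> \<le> sqrt (\<epsilon>\<^sup>2 + sqrt (row_dev R \<mu>) + sqrt (col_dev R \<mu>))"
proof -
  have weighted_abs: "(\<Sum>a\<in>I. z a * f a)\<^sup>2 \<le> (\<Sum>a\<in>I. \<mu> a * (f a)\<^sup>2)"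
    if z: "\<And>a. a \<in> I \<Longrightarrow> \<bar>z a\<bar> \<le> \<mu> a" for z f
  proof -
    have "\<bar>\<Sum>a\<in>I. z a * f a\<bar> \<le> (\<Sum>a\<in>I. \<mu> a * \<bar>f a\<bar> * 1)"
      by (rule order_trans[OF sum_abs], rule sum_mono) (use z in \<open>auto simp: abs_mult intro: mult_right_mono\<close>)
    then have "(\<Sum>a\<in>I. z a * f a)\<^sup>2 \<le> (\<Sum>a\<in>I. \<mu> a * \<bar>f a\<bar> * 1)\<^sup>2"
      by (metis abs_ge_zero power2_abs power_mono)
    also have "\<dots> \<le> (\<Sum>a\<in>I. \<mu> a * \<bar>f a\<bar>\<^sup>2) * (\<Sum>a\<in>I. \<mu> a * 1\<^sup>2)"
      by (rule weighted_Cauchy_Schwarz) (use \<mu> in auto)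
    also have "\<dots> \<le> (\<Sum>a\<in>I. \<mu> a * \<bar>f a\<bar>\<^sup>2) * 1"
      by (intro mult_left_mono sum_nonneg) (use \<mu> in auto)
    finally show ?thesis by simp
  qed
  \<comment> \<open>\<open>h\<close> is \<open>R\<close> applied to the mass vector
    \<open>y\<close>, and \<open>g\<close> is the adjoint of \<open>R\<close> in
    L^2(\<open>p\<close>) applied to \<open>h\<close>. The \<mu>-norm of \<open>h\<close> is
    replaced by its p-norm at the cost of \<open>col_dev\<close>, then that of \<open>g\<close> at
    the cost of \<open>row_dev\<close>.\<close>
  define h where "h a = (\<Sum>b\<in>I. R a b * y b)" for a
  define g where "g b = (\<Sum>a\<in>I. R a b * (p a * h a))" for b
  define F where "F = (\<Sum>a\<in>I. \<Sum>b\<in>I. x a * y b * R a b)"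
  define Y where "Y = sqnorm h"
  have "F = (\<Sum>a\<in>I. x a * h a)"
    unfolding F_def h_def sum_distrib_left by (simp add: mult_ac)
  then have F2: "F\<^sup>2 \<le> (\<Sum>a\<in>I. \<mu> a * (h a)\<^sup>2)" using weighted_abs[OF x] by simp
  have "(\<Sum>a\<in>I. (\<mu> a - p a) * (h a)\<^sup>2) = (\<Sum>b\<in>I. \<Sum>b'\<in>I. y b * y b' * (\<Sum>a\<in>I. (\<mu> a - p a) * (R a b * R a b')))"
    unfolding h_def by (rule square_sum_expand)
  also have "\<dots> \<le> (\<Sum>b\<in>I. \<Sum>b'\<in>I. \<mu> b * \<mu> b' * \<bar>\<Sum>a\<in>I. (\<mu> a - p a) * (R a b * R a b')\<bar> * 1)"
  proof (rule order_trans[OF abs_ge_self], rule order_trans[OF double_sum_abs_le], intro sum_mono)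
    fix b b' assume "b \<in> I" "b' \<in> I"
    then have "\<bar>y b\<bar> * \<bar>y b'\<bar> \<le> \<mu> b * \<mu> b'" by (intro mult_mono y \<mu>) auto
    then show "\<bar>y b * y b' * (\<Sum>a\<in>I. (\<mu> a - p a) * (R a b * R a b'))\<bar>
        \<le> \<mu> b * \<mu> b' * \<bar>\<Sum>a\<in>I. (\<mu> a - p a) * (R a b * R a b')\<bar> * 1"
      by (simp add: abs_mult mult_right_mono)
  qed
  also have "\<dots> \<le> sqrt (col_dev R \<mu>)"
  proof (rule real_le_rsqrt)
    have "(\<Sum>b\<in>I. \<Sum>b'\<in>I. \<mu> b * \<mu> b' * \<bar>\<Sum>a\<in>I. (\<mu> a - p a) * (R a b * R a b')\<bar> * 1)\<^sup>2
      \<le> (\<Sum>b\<in>I. \<Sum>b'\<in>I. \<mu> b * \<mu> b' * \<bar>\<Sum>a\<in>I. (\<mu> a - p a) * (R a b * R a b')\<bar>\<^sup>2) * (\<Sum>b\<in>I. \<Sum>b'\<in>I. \<mu> b * \<mu> b' * 1\<^sup>2)"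
      by (rule double_weighted_Cauchy_Schwarz) (use \<mu> in auto)
    also have "\<dots> \<le> (\<Sum>b\<in>I. \<Sum>b'\<in>I. \<mu> b * \<mu> b' * \<bar>\<Sum>a\<in>I. (\<mu> a - p a) * (R a b * R a b')\<bar>\<^sup>2) * 1"
    proof (intro mult_left_mono sum_nonneg)
      have "(\<Sum>b\<in>I. \<Sum>b'\<in>I. \<mu> b * \<mu> b' * 1\<^sup>2) = sum \<mu> I * sum \<mu> I" by (simp add: sum_product)
      also have "\<dots> \<le> 1 * 1" by (intro mult_mono \<mu> sum_nonneg) auto
      finally show "(\<Sum>b\<in>I. \<Sum>b'\<in>I. \<mu> b * \<mu> b' * 1\<^sup>2) \<le> (1::real)" by simp
    qed (use \<mu> in auto)
    finally show "(\<Sum>b\<in>I. \<Sum>b'\<in>I. \<mu> b * \<mu> b' * \<bar>\<Sum>a\<in>I. (\<mu> a - p a) * (R a b * R a b')\<bar> * 1)\<^sup>2 \<le> col_dev R \<mu>"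
      unfolding col_dev_def by simp
  qed
  finally have 1: "(\<Sum>a\<in>I. \<mu> a * (h a)\<^sup>2) \<le> Y + sqrt (col_dev R \<mu>)"
    unfolding Y_def sqnorm_def by (simp add: left_diff_distrib sum_subtractf)
  \<comment> \<open>Duality: the squared p-norm of \<open>h\<close> is the pairing of
    \<open>y\<close> with \<open>g\<close>, and \<open>y\<close> is dominated by
    \<open>\<mu>\<close>.\<close>
  have "Y = (\<Sum>a\<in>I. \<Sum>b\<in>I. y b * (R a b * (p a * h a)))"
    unfolding Y_def sqnorm_def power2_eq_square
    by (simp add: h_def[of _] sum_distrib_left sum_distrib_right mult_ac)
  also have "\<dots> = (\<Sum>b\<in>I. y b * g b)"
    unfolding g_def sum_distrib_left by (rule sum.swap)
  finally have Y2: "Y\<^sup>2 \<le> (\<Sum>b\<in>I. \<mu> b * (g b)\<^sup>2)" using weighted_abs[OF y] by simp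
  have gY: "sqnorm g \<le> \<epsilon>\<^sup>2 * Y"
  proof -
    have "sqnorm g = (\<Sum>b\<in>I. \<Sum>a\<in>I. p b * (R a b * (p a * h a)) * g b)"
      unfolding sqnorm_def power2_eq_square
      by (simp add: g_def[of _] sum_distrib_left sum_distrib_right mult_ac)
    also have "\<dots> = (\<Sum>a\<in>I. \<Sum>b\<in>I. p b * (R a b * (p a * h a)) * g b)" by (rule sum.swap)
    also have "\<dots> = form R h g" unfolding form_def by (simp add: mult_ac)
    also have "\<dots> \<le> \<epsilon> * sqrt Y * sqrt (sqnorm g)" using form_boundedD[OF R, of h g] by (simp add: Y_def)
    finally have le: "sqrt (sqnorm g) * sqrt (sqnorm g) \<le> (\<epsilon> * sqrt Y) * sqrt (sqnorm g)" by simp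
    have "sqrt (sqnorm g) \<le> \<epsilon> * sqrt Y"
    proof (cases "sqnorm g = 0")
      case False
      then have "0 < sqrt (sqnorm g)" using sqnorm_nonneg[of g] by (simp add: less_le)
      with le show ?thesis by (rule mult_right_le_imp_le)
    qed (use \<open>0 \<le> \<epsilon>\<close> in \<open>simp add: Y_def\<close>)
    then have "(sqrt (sqnorm g))\<^sup>2 \<le> (\<epsilon> * sqrt Y)\<^sup>2" by (intro power_mono) auto
    then show ?thesis by (simp add: power_mult_distrib Y_def)
  qed
  have "(\<Sum>b\<in>I. (\<mu> b - p b) * (g b)\<^sup>2)
      = (\<Sum>a\<in>I. \<Sum>a'\<in>I. (p a * h a) * (p a' * h a') * (\<Sum>b\<in>I. (\<mu> b - p b) * (R a b * R a' b)))"
    unfolding g_def using square_sum_expand[of "\<lambda>b. \<mu> b - p b" "\<lambda>b a. R a b" "\<lambda>a. p a * h a"] by simp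
  also have "\<dots> = (\<Sum>a\<in>I. \<Sum>a'\<in>I. (p a * p a') * (h a * h a') * (\<Sum>b\<in>I. (\<mu> b - p b) * (R a b * R a' b)))"
    by (simp add: mult_ac)
  also have "\<dots> \<le> sqrt (Y\<^sup>2 * row_dev R \<mu>)"
  proof (rule real_le_rsqrt)
    have "Y\<^sup>2 = (\<Sum>a\<in>I. \<Sum>a'\<in>I. p a * p a' * (h a * h a')\<^sup>2)"
      unfolding Y_def sqnorm_def power2_eq_square[of "\<Sum>a\<in>I. _ a"] sum_product
      by (intro sum.cong refl) (simp add: power_mult_distrib mult_ac)
    then show "(\<Sum>a\<in>I. \<Sum>a'\<in>I. (p a * p a') * (h a * h a') * (\<Sum>b\<in>I. (\<mu> b - p b) * (R a b * R a' b)))\<^sup>2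
        \<le> Y\<^sup>2 * row_dev R \<mu>"
      unfolding row_dev_def by (simp only:) (rule double_weighted_Cauchy_Schwarz, simp add: p_nonneg)
  qed
  also have "\<dots> = Y * sqrt (row_dev R \<mu>)" by (simp add: real_sqrt_mult Y_def)
  finally have "(\<Sum>b\<in>I. \<mu> b * (g b)\<^sup>2) \<le> sqnorm g + Y * sqrt (row_dev R \<mu>)"
    unfolding sqnorm_def by (simp add: left_diff_distrib sum_subtractf)
  \<comment> \<open>The inequality bounds \<open>Y\<close> squared by a multiple of \<open>Y\<close>
    itself, because \<open>g\<close> has squared norm at most \<epsilon>^2 \<open>Y\<close>; one
    factor \<open>Y\<close> can be divided out.\<close>
  with Y2 gY have "Y * Y \<le> (\<epsilon>\<^sup>2 + sqrt (row_dev R \<mu>)) * Y"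
    by (simp add: power2_eq_square algebra_simps)
  moreover have "0 \<le> row_dev R \<mu>"
    unfolding row_dev_def by (intro sum_nonneg mult_nonneg_nonneg) (auto simp: p_nonneg)
  ultimately have "Y \<le> \<epsilon>\<^sup>2 + sqrt (row_dev R \<mu>)"
    using sqnorm_nonneg[of h] by (cases "Y = 0") (auto simp: Y_def[symmetric] less_le)
  with 1 F2 have "F\<^sup>2 \<le> \<epsilon>\<^sup>2 + sqrt (row_dev R \<mu>) + sqrt (col_dev R \<mu>)" by linarith
  then have "sqrt (F\<^sup>2) \<le> sqrt (\<epsilon>\<^sup>2 + sqrt (row_dev R \<mu>) + sqrt (col_dev R \<mu>))" by (rule real_sqrt_le_mono)
  then show ?thesis by (simp add: F_def)
qed

end

section \<open>Moments over independent labels\<close>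

locale label_sample = weighted_set I p for I :: "'a set" and p +
  fixes J :: "'i set"
  assumes sum_p: "sum p I = 1" and finite_J: "finite J" and J_nonempty: "J \<noteq> {}"
begin

definition expec :: "(('i \<Rightarrow> 'a) \<Rightarrow> real) \<Rightarrow> real" where
  "expec f = (\<Sum>x\<in>J \<rightarrow>\<^sub>E I. (\<Prod>j\<in>J. p (x j)) * f x)"

lemma card_J_pos: "0 < real (card J)"
  using finite_J J_nonempty by (simp add: card_gt_0_iff)

lemma weight_nonneg: "x \<in> J \<rightarrow>\<^sub>E I \<Longrightarrow> 0 \<le> (\<Prod>j\<in>J. p (x j))"
  by (intro prod_nonneg ballI p_nonneg) auto

lemma expec_cong: "(\<And>x. x \<in> J \<rightarrow>\<^sub>E I \<Longrightarrow> f x = g x) \<Longrightarrow> expec f = expec g"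
  unfolding expec_def by (rule sum.cong) auto

lemma expec_mono: "(\<And>x. x \<in> J \<rightarrow>\<^sub>E I \<Longrightarrow> f x \<le> g x) \<Longrightarrow> expec f \<le> expec g"
  unfolding expec_def by (intro sum_mono mult_left_mono weight_nonneg)

lemma expec_add: "expec (\<lambda>x. f x + g x) = expec f + expec g"
  unfolding expec_def by (simp add: distrib_left sum.distrib)

lemma expec_cmult: "expec (\<lambda>x. c * f x) = c * expec f"
  unfolding expec_def by (simp add: sum_distrib_left mult.left_commute)

lemma expec_sum: "expec (\<lambda>x. \<Sum>a\<in>A. f a x) = (\<Sum>a\<in>A. expec (f a))"
  unfolding expec_def by (simp only: sum_distrib_left) (rule sum.swap)

lemma total_weight: "(\<Sum>x\<in>J \<rightarrow>\<^sub>E I. \<Prod>j\<in>J. p (x j)) = 1"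
  using prod_sum_PiE[of J "\<lambda>_. I" "\<lambda>_. p"] finite_J finite_I by (simp add: sum_p)

lemma expec_const [simp]: "expec (\<lambda>_. c) = c"
  unfolding expec_def by (simp add: sum_distrib_right[symmetric] total_weight)

lemma abs_expec_le:
  assumes "\<And>x. x \<in> J \<rightarrow>\<^sub>E I \<Longrightarrow> \<bar>f x\<bar> \<le> B"
  shows "\<bar>expec f\<bar> \<le> B"
proof -
  have "expec f \<le> expec (\<lambda>_. B)" by (rule expec_mono) (use assms in \<open>auto simp: abs_le_iff\<close>)
  moreover have "expec (\<lambda>_. - B) \<le> expec f"
    by (rule expec_mono) (use assms in \<open>auto simp: abs_le_iff minus_le_iff\<close>)
  ultimately have "expec f \<le> expec (\<lambda>_. B)" "expec (\<lambda>_. - B) \<le> expec f" .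
  then show ?thesis by simp
qed

text \<open>Redrawing one coordinate from \<open>p\<close> does not change the expectation. This is
  the form in which independence enters the second moments below.\<close>

lemma expec_resample:
  assumes "i \<in> J"
  shows "expec f = expec (\<lambda>x. \<Sum>a\<in>I. p a * f (x(i := a)))"
proof -
  define J' where "J' = J - {i}"
  have J: "J = insert i J'" "i \<notin> J'" "finite J'" using assms finite_J by (auto simp: J'_def)
  define W where "W y = (\<Prod>j\<in>J'. p (y j))" for y
  have eq: "expec g = (\<Sum>a\<in>I. \<Sum>y\<in>J' \<rightarrow>\<^sub>E I. p a * W y * g (y(i := a)))" for g
  proof -
    have "expec g = (\<Sum>z\<in>I \<times> (J' \<rightarrow>\<^sub>E I). (\<lambda>x. (\<Prod>j\<in>J. p (x j)) * g x) ((\<lambda>(a, y). y(i := a)) z))"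
      unfolding expec_def
      by (subst J(1), subst PiE_insert_eq, subst sum.reindex) (use inj_combinator[OF J(2), of "\<lambda>_. I"] in \<open>simp_all add: J(1)\<close>)
    also have "\<dots> = (\<Sum>z\<in>I \<times> (J' \<rightarrow>\<^sub>E I). p (fst z) * W (snd z) * g ((snd z)(i := fst z)))"
    proof (rule sum.cong[OF refl])
      fix z :: "'a \<times> ('i \<Rightarrow> 'a)"
      have "(\<Prod>j\<in>J. p (((snd z)(i := fst z)) j)) = p (fst z) * (\<Prod>j\<in>J'. p (((snd z)(i := fst z)) j))"
        unfolding J(1) by (subst prod.insert) (use J in auto)
      also have "(\<Prod>j\<in>J'. p (((snd z)(i := fst z)) j)) = W (snd z)"
        unfolding W_def by (rule prod.cong) (use J(2) in auto)
      finally show "(\<lambda>x. (\<Prod>j\<in>J. p (x j)) * g x) ((\<lambda>(a, y). y(i := a)) z)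
          = p (fst z) * W (snd z) * g ((snd z)(i := fst z))" by (simp add: case_prod_unfold)
    qed
    finally show ?thesis by (simp add: sum.cartesian_product case_prod_unfold)
  qed
  have "expec (\<lambda>x. \<Sum>a\<in>I. p a * f (x(i := a)))
      = (\<Sum>b\<in>I. \<Sum>y\<in>J' \<rightarrow>\<^sub>E I. p b * W y * (\<Sum>a\<in>I. p a * f (y(i := a))))"
    unfolding eq by simp
  also have "\<dots> = (\<Sum>b\<in>I. p b * (\<Sum>y\<in>J' \<rightarrow>\<^sub>E I. W y * (\<Sum>a\<in>I. p a * f (y(i := a)))))"
    by (intro sum.cong refl) (simp only: sum_distrib_left mult.assoc)
  also have "\<dots> = (\<Sum>y\<in>J' \<rightarrow>\<^sub>E I. W y * (\<Sum>a\<in>I. p a * f (y(i := a))))"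
    by (simp only: sum_distrib_right[symmetric] sum_p)
  also have "\<dots> = (\<Sum>y\<in>J' \<rightarrow>\<^sub>E I. \<Sum>a\<in>I. p a * W y * f (y(i := a)))"
    by (intro sum.cong refl) (simp only: sum_distrib_left mult_ac)
  also have "\<dots> = expec f" unfolding eq by (rule sum.swap)
  finally show ?thesis by simp
qed

lemma expec_eq_0:
  assumes "i \<in> J" "\<And>x. x \<in> J \<rightarrow>\<^sub>E I \<Longrightarrow> (\<Sum>a\<in>I. p a * f (x(i := a))) = 0"
  shows "expec f = 0"
proof -
  have "expec f = expec (\<lambda>_. 0)"
    unfolding expec_resample[OF assms(1), of f] by (rule expec_cong) (use assms(2) in auto)
  then show ?thesis by simp
qed

text \<open>Jensen's inequality by way of t <= t^2 / (2 sqrt V) + sqrt V / 2, with equality at t =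
  sqrt V.\<close>

lemma expec_le_sqrt:
  assumes "expec (\<lambda>x. (f x)\<^sup>2) \<le> V" "0 < V"
  shows "expec f \<le> sqrt V"
proof -
  have "expec f \<le> expec (\<lambda>x. 1 / (2 * sqrt V) * (f x)\<^sup>2 + sqrt V / 2)"
  proof (rule expec_mono)
    fix x
    have "0 \<le> (f x - sqrt V)\<^sup>2" by simp
    then have "2 * f x * sqrt V \<le> (f x)\<^sup>2 + (sqrt V)\<^sup>2" by (simp add: power2_diff)
    then show "f x \<le> 1 / (2 * sqrt V) * (f x)\<^sup>2 + sqrt V / 2"
      using assms(2) by (simp add: field_simps power2_eq_square)
  qed
  also have "\<dots> = 1 / (2 * sqrt V) * expec (\<lambda>x. (f x)\<^sup>2) + sqrt V / 2"
    by (simp only: expec_add expec_cmult expec_const)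
  also have "\<dots> \<le> 1 / (2 * sqrt V) * V + sqrt V / 2"
    using assms by (intro add_mono mult_left_mono) auto
  also have "\<dots> = sqrt V" using assms(2) by (simp add: field_simps)
  finally show ?thesis .
qed

lemma freq_sum:
  assumes "x \<in> J \<rightarrow>\<^sub>E I"
  shows "(\<Sum>a\<in>I. freq J x a * g a) = (\<Sum>j\<in>J. g (x j)) / card J"
proof -
  have "(\<Sum>j\<in>J. g (x j)) = (\<Sum>a\<in>I. \<Sum>j\<in>{j\<in>J. x j = a}. g (x j))"
    by (rule sum.group[symmetric, OF finite_J finite_I]) (use assms in auto)
  also have "\<dots> = (\<Sum>a\<in>I. card {j \<in> J. x j = a} * g a)" by simp
  finally show ?thesis by (simp add: freq_def sum_divide_distrib)
qed

lemma freq_total: "x \<in> J \<rightarrow>\<^sub>E I \<Longrightarrow> sum (freq J x) I = 1"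
  using freq_sum[of x "\<lambda>_. 1"] card_J_pos by simp

lemma deviation_eq:
  assumes "x \<in> J \<rightarrow>\<^sub>E I"
  shows "(\<Sum>a\<in>I. (freq J x a - p a) * g a) = (\<Sum>j\<in>J. g (x j) - (\<Sum>a\<in>I. p a * g a)) / card J"
  using card_J_pos
  by (simp add: left_diff_distrib sum_subtractf freq_sum[OF assms] diff_divide_distrib)

lemma expec_sum_sq:
  assumes "(\<Sum>a\<in>I. p a * h a) = 0"
  shows "expec (\<lambda>x. (\<Sum>j\<in>J. h (x j))\<^sup>2) = card J * sqnorm h"
proof -
  have "expec (\<lambda>x. h (x i) * h (x j)) = (if i = j then sqnorm h else 0)" if "i \<in> J" "j \<in> J" for i j
  proof (cases "i = j")
    case True
    then show ?thesis
      by (subst expec_resample[OF \<open>i \<in> J\<close>]) (simp add: sqnorm_def power2_eq_square)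
  next
    case False
    then show ?thesis
      by (simp, intro expec_eq_0[OF \<open>i \<in> J\<close>])
        (use assms in \<open>simp add: mult.assoc[symmetric] sum_distrib_right[symmetric]\<close>)
  qed
  then have "(\<Sum>i\<in>J. \<Sum>j\<in>J. expec (\<lambda>x. h (x i) * h (x j))) = (\<Sum>i\<in>J. \<Sum>j\<in>J. if i = j then sqnorm h else 0)"
    by (intro sum.cong refl)
  then show ?thesis
    unfolding power2_eq_square sum_product expec_sum using finite_J by simp
qed

text \<open>After centring, the cross terms vanish and only the variance of \<open>g\<close>
  remains, which is at most its second moment.\<close>

lemma expec_deviation_sq: "expec (\<lambda>x. (\<Sum>a\<in>I. (freq J x a - p a) * g a)\<^sup>2) \<le> sqnorm g / card J"
proof -
  define m where "m = (\<Sum>a\<in>I. p a * g a)"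
  define h where "h a = g a - m" for a
  have h0: "(\<Sum>a\<in>I. p a * h a) = 0"
    by (simp add: h_def right_diff_distrib sum_subtractf m_def[symmetric] sum_distrib_right[symmetric] sum_p)
  have "sqnorm g = sqnorm h + 2 * m * (\<Sum>a\<in>I. p a * h a) + m\<^sup>2 * sum p I"
    unfolding sqnorm_def sum_distrib_left sum.distrib[symmetric]
    by (intro sum.cong refl) (simp add: h_def power2_eq_square algebra_simps)
  then have hg: "sqnorm h \<le> sqnorm g" by (simp add: h0 sum_p)
  have "expec (\<lambda>x. (\<Sum>a\<in>I. (freq J x a - p a) * g a)\<^sup>2) = expec (\<lambda>x. (1 / (card J)\<^sup>2) * (\<Sum>j\<in>J. h (x j))\<^sup>2)"
    by (intro expec_cong) (simp add: deviation_eq h_def m_def power_divide)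
  also have "\<dots> = sqnorm h / card J"
    unfolding expec_cmult expec_sum_sq[OF h0] using card_J_pos by (simp add: power2_eq_square)
  also have "\<dots> \<le> sqnorm g / card J" using hg by (intro divide_right_mono) auto
  finally show ?thesis .
qed

text \<open>Cauchy-Schwarz over the cells. The second moment for a cell is at most its mass over
  \<open>card J\<close>, and the cell masses add up to 1.\<close>

lemma expec_coarse: "expec (\<lambda>x. coarse I c (\<lambda>a. freq J x a - p a)) \<le> sqrt (card (c ` I) / card J)"
proof -
  have I0: "I \<noteq> {}" using sum_p by auto
  then have pos: "0 < real (card (c ` I))" using finite_I by (simp add: card_gt_0_iff)
  define d where "d A x = (\<Sum>a\<in>I. (freq J x a - p a) * (if c a = A then 1 else 0))" for A x
  have coarse: "coarse I c (\<lambda>a. freq J x a - p a) = (\<Sum>A\<in>c ` I. \<bar>d A x\<bar>)" for x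
  proof -
    have "(\<Sum>a\<in>{a \<in> I. c a = A}. freq J x a - p a) = d A x" for A
      unfolding d_def using finite_I by (simp add: if_distrib sum.inter_filter cong: if_cong)
    then show ?thesis by (simp add: coarse_def)
  qed
  have "expec (\<lambda>x. (coarse I c (\<lambda>a. freq J x a - p a))\<^sup>2) \<le> expec (\<lambda>x. card (c ` I) * (\<Sum>A\<in>c ` I. (d A x)\<^sup>2))"
  proof (rule expec_mono)
    fix x
    show "(coarse I c (\<lambda>a. freq J x a - p a))\<^sup>2 \<le> card (c ` I) * (\<Sum>A\<in>c ` I. (d A x)\<^sup>2)"
      using weighted_Cauchy_Schwarz[of "c ` I" "\<lambda>_. 1" "\<lambda>A. \<bar>d A x\<bar>" "\<lambda>_. 1"]
      by (simp add: coarse mult.commute)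
  qed
  also have "\<dots> = card (c ` I) * (\<Sum>A\<in>c ` I. expec (\<lambda>x. (d A x)\<^sup>2))"
    by (simp only: expec_cmult expec_sum)
  also have "\<dots> \<le> card (c ` I) * (\<Sum>A\<in>c ` I. sqnorm (\<lambda>a. if c a = A then 1 else 0) / card J)"
    unfolding d_def by (intro mult_left_mono sum_mono expec_deviation_sq) auto
  also have "(\<Sum>A\<in>c ` I. sqnorm (\<lambda>a. if c a = A then 1 else 0)) = 1"
  proof -
    have "(\<Sum>A\<in>c ` I. sqnorm (\<lambda>a. if c a = A then 1 else 0)) = (\<Sum>A\<in>c ` I. \<Sum>a\<in>{a \<in> I. c a = A}. p a)"
    proof (rule sum.cong[OF refl])
      fix A
      have "sqnorm (\<lambda>a. if c a = A then 1 else 0) = (\<Sum>a\<in>I. if c a = A then p a else 0)"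
        unfolding sqnorm_def by (intro sum.cong refl) auto
      then show "sqnorm (\<lambda>a. if c a = A then 1 else 0) = (\<Sum>a\<in>{a \<in> I. c a = A}. p a)"
        using finite_I by (simp add: sum.inter_filter)
    qed
    also have "\<dots> = sum p I" by (rule sum.group) (use finite_I in auto)
    finally show ?thesis by (simp add: sum_p)
  qed
  then have "(\<Sum>A\<in>c ` I. sqnorm (\<lambda>a. if c a = A then 1 else 0) / card J) = 1 / card J"
    by (simp add: sum_divide_distrib[symmetric])
  finally have "expec (\<lambda>x. (coarse I c (\<lambda>a. freq J x a - p a))\<^sup>2) \<le> card (c ` I) / card J" by simp
  then show ?thesis by (rule expec_le_sqrt) (use pos card_J_pos in simp)
qed

text \<open>The outer weights are deterministic, so every entry is the squared deviation of one
  empirical mean.\<close>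

lemma expec_row_dev:
  assumes L: "\<And>a b. a \<in> I \<Longrightarrow> b \<in> I \<Longrightarrow> \<bar>R a b\<bar> \<le> L"
  shows "expec (\<lambda>x. row_dev R (freq J x)) \<le> L^4 / card J"
proof -
  have "expec (\<lambda>x. row_dev R (freq J x))
      = (\<Sum>a\<in>I. \<Sum>a'\<in>I. p a * p a' * expec (\<lambda>x. (\<Sum>b\<in>I. (freq J x b - p b) * (R a b * R a' b))\<^sup>2))"
    unfolding row_dev_def by (simp only: expec_sum expec_cmult)
  also have "\<dots> \<le> (\<Sum>a\<in>I. \<Sum>a'\<in>I. p a * p a' * (L^4 / card J))"
  proof (intro sum_mono mult_left_mono)
    fix a a' assume a: "a \<in> I" "a' \<in> I"
    have "sqnorm (\<lambda>b. R a b * R a' b) \<le> (L\<^sup>2)\<^sup>2"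
    proof (rule sqnorm_le_const)
      fix b assume "b \<in> I"
      then have "\<bar>R a b\<bar> * \<bar>R a' b\<bar> \<le> L * L" by (intro mult_mono L a) (use L[OF a] in auto)
      then show "\<bar>R a b * R a' b\<bar> \<le> L\<^sup>2" by (simp add: abs_mult power2_eq_square)
    qed
    then have "sqnorm (\<lambda>b. R a b * R a' b) / card J \<le> L^4 / card J"
      by (intro divide_right_mono) (auto simp flip: power_mult)
    with expec_deviation_sq[of "\<lambda>b. R a b * R a' b"]
    show "expec (\<lambda>x. (\<Sum>b\<in>I. (freq J x b - p b) * (R a b * R a' b))\<^sup>2) \<le> L^4 / card J" by linarith
  qed (auto simp: p_nonneg)
  also have "\<dots> = (\<Sum>a\<in>I. p a * (\<Sum>a'\<in>I. p a' * (L^4 / card J)))"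
    by (simp only: sum_distrib_left mult.assoc)
  also have "\<dots> = L^4 / card J"
    by (simp only: sum_distrib_right[symmetric] sum_p)
  finally show ?thesis .
qed

text \<open>The columns are drawn from the same sample as the rows, so the deviations are not those
  of fixed functions. The square is expanded over quadruples of sample indices instead.\<close>

lemma expec_col_dev:
  assumes L: "\<And>a b. a \<in> I \<Longrightarrow> b \<in> I \<Longrightarrow> \<bar>R a b\<bar> \<le> L"
  shows "expec (\<lambda>x. col_dev R (freq J x)) \<le> 12 * L^4 / card J"
proof -
  define n where "n = real (card J)"
  have n: "0 < n" using card_J_pos by (simp add: n_def)
  define m where "m b b' = (\<Sum>a\<in>I. p a * (R a b * R a b'))" for b b'
  define h where "h a b b' = R a b * R a b' - m b b'" for a b b'
  have RL: "\<bar>R a b * R a b'\<bar> \<le> L\<^sup>2" if "a \<in> I" "b \<in> I" "b' \<in> I" for a b b'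
  proof -
    have "\<bar>R a b\<bar> * \<bar>R a b'\<bar> \<le> L * L" by (intro mult_mono L that) (use L[OF that(1,2)] in auto)
    then show ?thesis by (simp add: abs_mult power2_eq_square)
  qed
  have m: "\<bar>m b b'\<bar> \<le> L\<^sup>2" if "b \<in> I" "b' \<in> I" for b b'
  proof -
    have "\<bar>m b b'\<bar> \<le> (\<Sum>a\<in>I. p a * L\<^sup>2)"
      unfolding m_def
      by (rule order_trans[OF sum_abs], rule sum_mono)
        (use RL that p_nonneg in \<open>auto simp: abs_mult[of "p _"] intro: mult_left_mono\<close>)
    then show ?thesis by (simp add: sum_distrib_right[symmetric] sum_p)
  qed
  have hL: "\<bar>h a b b'\<bar> \<le> 2 * L\<^sup>2" if "a \<in> I" "b \<in> I" "b' \<in> I" for a b b'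
    using RL[OF that] m[OF that(2,3)] unfolding h_def by linarith
  have h0: "(\<Sum>a\<in>I. p a * h a b b') = 0" for b b'
    by (simp add: h_def right_diff_distrib sum_subtractf m_def[symmetric] sum_distrib_right[symmetric] sum_p)
  define T where "T x = (\<lambda>(j, j', i, i'). h (x i) (x j) (x j') * h (x i') (x j) (x j'))" for x :: "'i \<Rightarrow> 'a"
  let ?Q = "J \<times> J \<times> J \<times> J"
  have col: "col_dev R (freq J x) = (\<Sum>q\<in>?Q. T x q) / n^4" if x: "x \<in> J \<rightarrow>\<^sub>E I" for x
  proof -
    have "col_dev R (freq J x)
        = (\<Sum>b\<in>I. freq J x b * (\<Sum>b'\<in>I. freq J x b' * ((\<Sum>i\<in>J. h (x i) b b') / n)\<^sup>2))"
      unfolding col_dev_def deviation_eq[OF x] h_def m_def n_def by (simp only: sum_distrib_left mult.assoc)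
    also have "\<dots> = (\<Sum>j\<in>J. (\<Sum>j'\<in>J. ((\<Sum>i\<in>J. h (x i) (x j) (x j')) / n)\<^sup>2) / n) / n"
      by (simp only: freq_sum[OF x] n_def)
    also have "\<dots> = (\<Sum>j\<in>J. \<Sum>j'\<in>J. (\<Sum>i\<in>J. h (x i) (x j) (x j'))\<^sup>2) / n^4"
    proof -
      have "(\<Sum>j\<in>J. (\<Sum>j'\<in>J. (S j j' / n)\<^sup>2) / n) / n = (\<Sum>j\<in>J. \<Sum>j'\<in>J. (S j j')\<^sup>2) / n^4" for S :: "'i \<Rightarrow> 'i \<Rightarrow> real"
        by (simp add: sum_divide_distrib power_divide power2_eq_square power4_eq_xxxx)
      then show ?thesis .
    qed
    also have "(\<Sum>j\<in>J. \<Sum>j'\<in>J. (\<Sum>i\<in>J. h (x i) (x j) (x j'))\<^sup>2) = (\<Sum>q\<in>?Q. T x q)"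
      unfolding T_def power2_eq_square sum_product by (simp add: sum.cartesian_product)
    finally show ?thesis .
  qed
  \<comment> \<open>If \<open>i\<close> differs from \<open>i'\<close>, \<open>j\<close> and
    \<open>j'\<close>, redrawing the label at \<open>i\<close> averages the term to 0. The surviving
    quadruples number at most \<open>3 * card J ^ 3\<close>, each with a term of size at most (2
    L^2)^2.\<close>
  define B where "B = {(j, j', i, i'). j \<in> J \<and> j' \<in> J \<and> i \<in> J \<and> i' \<in> J \<and> (i = i' \<or> i = j \<or> i = j')}"
  have B_sub: "B \<subseteq> ?Q" by (auto simp: B_def)
  have T0: "expec (\<lambda>x. T x q) = 0" if "q \<in> ?Q - B" for q
  proof -
    obtain j j' i i' where q: "q = (j, j', i, i')" by (cases q) auto
    with that have ij: "i \<in> J" "i \<noteq> i'" "i \<noteq> j" "i \<noteq> j'" by (auto simp: B_def)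
    show ?thesis
    proof (rule expec_eq_0[OF ij(1)])
      fix x
      have "(\<Sum>a\<in>I. p a * T (x(i := a)) q) = (\<Sum>a\<in>I. p a * h a (x j) (x j') * h (x i') (x j) (x j'))"
        using ij by (intro sum.cong refl) (auto simp: T_def q)
      also have "\<dots> = 0" by (simp only: sum_distrib_right[symmetric] h0 mult_zero_left)
      finally show "(\<Sum>a\<in>I. p a * T (x(i := a)) q) = 0" .
    qed
  qed
  have TL: "expec (\<lambda>x. T x q) \<le> 4 * L^4" if "q \<in> ?Q" for q
  proof -
    have "\<bar>expec (\<lambda>x. T x q)\<bar> \<le> 4 * L^4"
    proof (rule abs_expec_le)
      fix x assume x: "x \<in> J \<rightarrow>\<^sub>E I"
      obtain j j' i i' where q: "q = (j, j', i, i')" by (cases q) auto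
      with that x have "x j \<in> I" "x j' \<in> I" "x i \<in> I" "x i' \<in> I" by auto
      then have "\<bar>h (x i) (x j) (x j')\<bar> * \<bar>h (x i') (x j) (x j')\<bar> \<le> (2 * L\<^sup>2) * (2 * L\<^sup>2)"
        by (intro mult_mono hL) auto
      then show "\<bar>T x q\<bar> \<le> 4 * L^4" by (simp add: T_def q abs_mult power2_eq_square power4_eq_xxxx)
    qed
    then show ?thesis by linarith
  qed
  have cB: "card B \<le> 3 * card J ^ 3"
  proof -
    have "B \<subseteq> (\<lambda>(j, j', i). (j, j', i, i)) ` (J \<times> J \<times> J) \<union> (\<lambda>(j, j', i'). (j, j', j, i')) ` (J \<times> J \<times> J)
        \<union> (\<lambda>(j, j', i'). (j, j', j', i')) ` (J \<times> J \<times> J)" (is "_ \<subseteq> ?f \<union> ?g \<union> ?h")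
      by (force simp: B_def image_iff)
    then have "card B \<le> card (?f \<union> ?g \<union> ?h)" using finite_J by (intro card_mono) auto
    also have "\<dots> \<le> card ?f + card ?g + card ?h" by (meson add_le_mono1 card_Un_le order_trans)
    also have "\<dots> \<le> card (J \<times> J \<times> J) + card (J \<times> J \<times> J) + card (J \<times> J \<times> J)"
      using finite_J by (intro add_mono card_image_le) auto
    finally show ?thesis by (simp add: card_cartesian_product power3_eq_cube mult.assoc)
  qed
  have "expec (\<lambda>x. col_dev R (freq J x)) = expec (\<lambda>x. 1 / n^4 * (\<Sum>q\<in>?Q. T x q))"
    by (rule expec_cong) (simp add: col)
  also have "\<dots> = 1 / n^4 * (\<Sum>q\<in>?Q. expec (\<lambda>x. T x q))" by (simp only: expec_cmult expec_sum)
  also have "(\<Sum>q\<in>?Q. expec (\<lambda>x. T x q)) = (\<Sum>q\<in>B. expec (\<lambda>x. T x q))"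
    by (rule sum.mono_neutral_right) (use finite_J B_sub T0 in auto)
  also have "1 / n^4 * \<dots> \<le> 1 / n^4 * (\<Sum>q\<in>B. 4 * L^4)"
    by (intro mult_left_mono sum_mono TL) (use B_sub n in auto)
  also have "\<dots> = 1 / n^4 * (4 * L^4) * card B" by simp
  also have "\<dots> \<le> 1 / n^4 * (4 * L^4) * (3 * n^3)"
  proof (rule mult_left_mono)
    show "real (card B) \<le> 3 * n^3" using cB unfolding n_def by (metis of_nat_le_iff of_nat_mult of_nat_numeral of_nat_power)
  qed auto
  also have "\<dots> = 12 * L^4 / n" using n by (simp add: field_simps power3_eq_cube power4_eq_xxxx)
  finally show ?thesis by (simp add: n_def)
qed

end

section \<open>Logarithmic inequalities and the two rates\<close>

lemma ln_le_sqrt: "0 < x \<Longrightarrow> ln x \<le> sqrt (x::real)"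
proof -
  assume x: "0 < x"
  have "ln (sqrt (sqrt x)) \<le> sqrt (sqrt x) - 1" using x by (intro ln_le_minus_one) auto
  then have 1: "ln x \<le> 4 * (sqrt (sqrt x) - 1)" using x by (simp add: ln_sqrt)
  have "0 \<le> (sqrt (sqrt x) - 2)\<^sup>2" by simp
  then have "4 * (sqrt (sqrt x) - 1) \<le> (sqrt (sqrt x))\<^sup>2" by (simp add: power2_eq_square algebra_simps)
  with 1 show ?thesis using x by simp
qed

lemma ln_le_root6: "1 \<le> (x::real) \<Longrightarrow> ln x \<le> 6 * x powr (1/6)"
proof -
  assume x: "1 \<le> (x::real)"
  have "ln (x powr (1/6)) \<le> x powr (1/6) - 1" using x by (intro ln_le_minus_one) auto
  then show ?thesis using x by (simp add: ln_powr)
qed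

context label_sample
begin

text \<open>The weights mix \<open>p\<close> with the uniform law on labels. From
  \<open>p a \<le> 2 * w a\<close> the norm of \<open>p\<close> is bounded; from
  \<open>1 / w a \<le> 2 * card I\<close> the variances \<open>p a / card J\<close> sum to at most
  \<open>2 * card I / card J\<close>.\<close>

lemma expec_fine:
  fixes k :: nat and \<epsilon> :: real
  assumes "0 \<le> \<epsilon>" and cI: "card I \<le> k" "k \<le> card J"
    and w: "w = (\<lambda>a. (p a + 1 / card I) / 2)"
    and nrm: "nrm = (\<lambda>u. \<Sum>a\<in>I. w a * (u a / w a)\<^sup>2)"
  shows "expec (\<lambda>x. \<epsilon> * sqrt (nrm (\<lambda>a. freq J x a - p a)) * (sqrt (nrm (freq J x)) + sqrt (nrm p)))
    \<le> 7 * \<epsilon> * sqrt (k / card J)"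
proof -
  have I0: "I \<noteq> {}" using sum_p by auto
  define m where "m = real (card I)"
  have m: "0 < m" using I0 finite_I by (simp add: m_def card_gt_0_iff)
  have km: "m \<le> real k" using cI by (simp add: m_def)
  have w_pos: "0 < w a" and w_p: "p a \<le> 2 * w a" and w_m: "1 / m \<le> 2 * w a" if "a \<in> I" for a
    using p_pos[OF that] m by (auto simp: w m_def[symmetric] intro!: add_pos_pos)
  have nrm_eq: "nrm u = (\<Sum>a\<in>I. (u a)\<^sup>2 / w a)" for u
    unfolding nrm by (intro sum.cong refl) (use w_pos in \<open>simp add: power_divide power2_eq_square less_imp_neq[symmetric]\<close>)
  have nrm0: "0 \<le> nrm u" for u
    unfolding nrm_eq using w_pos by (intro sum_nonneg divide_nonneg_nonneg) (auto simp: less_imp_le)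
  have nrm_p: "nrm p \<le> 2"
  proof -
    have "nrm p \<le> (\<Sum>a\<in>I. 2 * p a)"
      unfolding nrm_eq
    proof (rule sum_mono)
      fix a assume a: "a \<in> I"
      have "p a * p a \<le> p a * (2 * w a)" using w_p[OF a] p_nonneg[OF a] by (intro mult_left_mono)
      then show "(p a)\<^sup>2 / w a \<le> 2 * p a"
        using w_pos[OF a] by (simp add: divide_le_eq power2_eq_square)
    qed
    then show ?thesis by (simp add: sum_distrib_left[symmetric] sum_p)
  qed
  have nrm_freq: "nrm (freq J x) \<le> 2 * nrm (\<lambda>a. freq J x a - p a) + 2 * nrm p" for x
    unfolding nrm_eq sum_distrib_left sum.distrib[symmetric]
  proof (rule sum_mono)
    fix a assume a: "a \<in> I"
    have "0 \<le> (freq J x a - 2 * p a)\<^sup>2" by simp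
    then have "(freq J x a)\<^sup>2 \<le> 2 * (freq J x a - p a)\<^sup>2 + 2 * (p a)\<^sup>2"
      by (simp add: power2_eq_square algebra_simps)
    then have "(freq J x a)\<^sup>2 / w a \<le> (2 * (freq J x a - p a)\<^sup>2 + 2 * (p a)\<^sup>2) / w a"
      using w_pos[OF a] by (intro divide_right_mono) auto
    then show "(freq J x a)\<^sup>2 / w a \<le> 2 * ((freq J x a - p a)\<^sup>2 / w a) + 2 * ((p a)\<^sup>2 / w a)"
      by (simp add: add_divide_distrib)
  qed
  define \<theta> where "\<theta> = sqrt (k / card J)"
  have k0: "0 < real k" using m km by linarith
  have \<theta>: "0 < \<theta>" "\<theta> \<le> 1" "\<theta>\<^sup>2 = k / card J"
    using k0 cI card_J_pos by (auto simp: \<theta>_def)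
  have dev: "expec (\<lambda>x. nrm (\<lambda>a. freq J x a - p a)) \<le> 2 * \<theta>\<^sup>2"
  proof -
    have "expec (\<lambda>x. nrm (\<lambda>a. freq J x a - p a)) = (\<Sum>a\<in>I. 1 / w a * expec (\<lambda>x. (freq J x a - p a)\<^sup>2))"
    proof -
      have "nrm (\<lambda>a. freq J x a - p a) = (\<Sum>a\<in>I. 1 / w a * (freq J x a - p a)\<^sup>2)" for x
        by (simp add: nrm_eq)
      then show ?thesis by (simp only: expec_sum expec_cmult)
    qed
    also have "\<dots> \<le> (\<Sum>a\<in>I. (2 * m) * (p a / card J))"
    proof (rule sum_mono)
      fix a assume a: "a \<in> I"
      have "(\<Sum>b\<in>I. (freq J x b - p b) * (if b = a then 1 else 0)) = freq J x a - p a" for x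
        using a finite_I by (simp add: if_distrib cong: if_cong)
      moreover have "sqnorm (\<lambda>b. if b = a then 1 else 0) = p a"
      proof -
        have "sqnorm (\<lambda>b. if b = a then 1 else 0) = (\<Sum>b\<in>I. if b = a then p a else 0)"
          unfolding sqnorm_def by (intro sum.cong refl) auto
        then show ?thesis using a finite_I by simp
      qed
      ultimately have dev_a: "expec (\<lambda>x. (freq J x a - p a)\<^sup>2) \<le> p a / card J"
        using expec_deviation_sq[of "\<lambda>b. if b = a then 1 else 0"] by simp
      have inv_w: "1 / w a \<le> 2 * m" using w_m[OF a] w_pos[OF a] m by (simp add: field_simps)
      show "1 / w a * expec (\<lambda>x. (freq J x a - p a)\<^sup>2) \<le> (2 * m) * (p a / card J)"
      proof (rule mult_mono)
        have "expec (\<lambda>_. 0) \<le> expec (\<lambda>x. (freq J x a - p a)\<^sup>2)" by (rule expec_mono) simp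
        then show "0 \<le> expec (\<lambda>x. (freq J x a - p a)\<^sup>2)" by simp
      qed (use m dev_a inv_w in auto)
    qed
    also have "\<dots> = 2 * m / card J"
      by (simp only: sum_distrib_left[symmetric] sum_divide_distrib[symmetric] sum_p) simp
    also have "\<dots> \<le> 2 * \<theta>\<^sup>2" using km card_J_pos unfolding \<theta>(3) by (simp add: divide_right_mono)
    finally show ?thesis .
  qed
  have "expec (\<lambda>x. \<epsilon> * sqrt (nrm (\<lambda>a. freq J x a - p a)) * (sqrt (nrm (freq J x)) + sqrt (nrm p)))
      \<le> expec (\<lambda>x. \<epsilon> * ((1 / \<theta> + \<theta>) * nrm (\<lambda>a. freq J x a - p a) + 3 * \<theta>))"
  proof (rule expec_mono)
    fix x
    define D where "D = nrm (\<lambda>a. freq J x a - p a)"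
    have D0: "0 \<le> D" by (simp add: D_def nrm0)
    \<comment> \<open>Balanced at \<open>\<theta>\<close>, since the deviation \<open>D\<close> has
      mean of order \<theta>^2 while the other norm is of order 1.\<close>
    have amgm: "sqrt D * sqrt e \<le> (D / \<theta> + \<theta> * e) / 2" if "0 \<le> e" for e
    proof -
      have "0 \<le> (sqrt D - \<theta> * sqrt e)\<^sup>2" by simp
      then have "2 * \<theta> * (sqrt D * sqrt e) \<le> D + \<theta>\<^sup>2 * e"
        using D0 that by (simp add: power2_diff power_mult_distrib mult_ac)
      then show ?thesis using \<theta>(1) by (simp add: field_simps power2_eq_square)
    qed
    have "sqrt D * (sqrt (nrm (freq J x)) + sqrt (nrm p)) \<le> D / \<theta> + (\<theta> * nrm (freq J x) + \<theta> * nrm p) / 2"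
      using amgm[OF nrm0, of "freq J x"] amgm[OF nrm0, of p] by (simp add: distrib_left add_divide_distrib)
    also have "\<dots> \<le> D / \<theta> + (\<theta> * (2 * D + 2 * 2) + \<theta> * 2) / 2"
    proof -
      have "\<theta> * nrm (freq J x) \<le> \<theta> * (2 * D + 2 * 2)" "\<theta> * nrm p \<le> \<theta> * 2"
        using nrm_freq[of x] nrm_p \<theta>(1) by (auto simp: D_def intro!: mult_left_mono)
      then show ?thesis by simp
    qed
    also have "\<dots> = (1 / \<theta> + \<theta>) * D + 3 * \<theta>" by (simp add: algebra_simps)
    finally have "\<epsilon> * (sqrt D * (sqrt (nrm (freq J x)) + sqrt (nrm p))) \<le> \<epsilon> * ((1 / \<theta> + \<theta>) * D + 3 * \<theta>)"
      using assms(1) by (rule mult_left_mono)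
    then show "\<epsilon> * sqrt (nrm (\<lambda>a. freq J x a - p a)) * (sqrt (nrm (freq J x)) + sqrt (nrm p))
        \<le> \<epsilon> * ((1 / \<theta> + \<theta>) * nrm (\<lambda>a. freq J x a - p a) + 3 * \<theta>)" by (simp add: D_def mult.assoc)
  qed
  also have "\<dots> = \<epsilon> * ((1 / \<theta> + \<theta>) * expec (\<lambda>x. nrm (\<lambda>a. freq J x a - p a)) + 3 * \<theta>)"
    by (simp only: expec_cmult expec_add expec_const)
  also have "\<dots> \<le> \<epsilon> * ((1 / \<theta> + \<theta>) * (2 * \<theta>\<^sup>2) + 3 * \<theta>)"
    using assms(1) \<theta>(1) by (intro mult_left_mono add_mono dev) auto
  also have "(1 / \<theta> + \<theta>) * (2 * \<theta>\<^sup>2) + 3 * \<theta> = 5 * \<theta> + 2 * \<theta> * \<theta>\<^sup>2"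
    using \<theta>(1) by (simp add: field_simps power2_eq_square)
  \<comment> \<open>\<open>\<theta>\<close> is at most 1 because
    \<open>k \<le> card J\<close>.\<close>
  also have "\<epsilon> * (5 * \<theta> + 2 * \<theta> * \<theta>\<^sup>2) \<le> \<epsilon> * (5 * \<theta> + 2 * \<theta> * 1)"
    using assms(1) \<theta>(1,2) by (intro mult_left_mono add_mono) (auto simp: power_le_one)
  finally show ?thesis by (simp add: \<theta>_def)
qed

text \<open>The choice of \<open>\<epsilon>\<close> makes the exponent in the cell count equal to
  \<open>ln k / 2\<close>, hence at most sqrt k cells. As sqrt k <= k / ln k, the coarse term is no
  larger than the fine one.\<close>

lemma many_samples_bound:
  fixes k :: nat
  assumes k: "2 \<le> k" "card I \<le> k" "k \<le> card J"
    and \<epsilon>: "\<epsilon> = sqrt (2 * regularity_const / ln k)"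
    and c: "real (card (c ` I)) \<le> exp (regularity_const / \<epsilon>\<^sup>2)"
    and w: "w = (\<lambda>a. (p a + 1 / card I) / 2)"
    and nrm: "nrm = (\<lambda>u. \<Sum>a\<in>I. w a * (u a / w a)\<^sup>2)"
  shows "expec (\<lambda>x. 2 * coarse I c (\<lambda>a. freq J x a - p a)
      + 2 * (\<epsilon> * sqrt (nrm (\<lambda>a. freq J x a - p a)) * (sqrt (nrm (freq J x)) + sqrt (nrm p))))
    \<le> (2 + 14 * sqrt (2 * regularity_const)) * sqrt (k / (card J * ln k))"
proof -
  define n where "n = real (card J)"
  have n: "0 < n" using card_J_pos by (simp add: n_def)
  have lnk: "0 < ln (real k)" using k by simp
  have K: "0 < regularity_const" by (simp add: regularity_const_def)
  have "\<epsilon>\<^sup>2 = 2 * regularity_const / ln k" using lnk K by (simp add: \<epsilon>)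
  then have "regularity_const / \<epsilon>\<^sup>2 = ln k / 2" using lnk K by simp
  then have "real (card (c ` I)) \<le> exp (ln k / 2)" using c by (simp only:)
  also have "\<dots> = sqrt k" using k by (simp add: ln_sqrt[symmetric])
  finally have "card (c ` I) \<le> sqrt k" .
  also have "\<dots> \<le> k / ln k"
  proof -
    have "sqrt k * ln k \<le> sqrt k * sqrt k" using k by (intro mult_left_mono ln_le_sqrt) auto
    then show ?thesis using lnk by (simp add: field_simps)
  qed
  finally have "card (c ` I) / n \<le> (k / ln k) / n" using n by (intro divide_right_mono) auto
  then have "sqrt (card (c ` I) / n) \<le> sqrt (k / (n * ln k))"
    by (intro real_sqrt_le_mono) (simp add: mult.commute)
  with expec_coarse[of c] have 1: "expec (\<lambda>x. coarse I c (\<lambda>a. freq J x a - p a)) \<le> sqrt (k / (n * ln k))"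
    unfolding n_def by (rule order_trans)
  have "\<epsilon> * sqrt (k / n) = sqrt (2 * regularity_const) * sqrt (k / (n * ln k))"
    by (simp add: \<epsilon> real_sqrt_mult real_sqrt_divide)
  then have 2: "expec (\<lambda>x. \<epsilon> * sqrt (nrm (\<lambda>a. freq J x a - p a)) * (sqrt (nrm (freq J x)) + sqrt (nrm p)))
      \<le> 7 * sqrt (2 * regularity_const) * sqrt (k / (n * ln k))"
    using expec_fine[OF _ k(2,3) w nrm, of \<epsilon>] K lnk by (simp add: n_def \<epsilon>)
  show ?thesis
    unfolding expec_add expec_cmult n_def[symmetric] distrib_right using 1 2 by linarith
qed

text \<open>The same choice with the number n of samples in place of \<open>k\<close> leaves at most
  sqrt n cells and entries of \<open>R\<close> of size at most 1 + ln n / 2. The Gram fluctuations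
  are then of order (ln n)^2 / sqrt n.\<close>

lemma few_samples_bound:
  assumes n2: "2 \<le> card J"
    and \<epsilon>: "\<epsilon> = sqrt (2 * regularity_const / ln (card J))"
    and c: "real (card (c ` I)) \<le> exp (regularity_const / \<epsilon>\<^sup>2)"
    and R: "\<And>a b. a \<in> I \<Longrightarrow> b \<in> I \<Longrightarrow> \<bar>R a b\<bar> \<le> 1 + regularity_const / \<epsilon>\<^sup>2"
  shows "expec (\<lambda>x. 2 * coarse I c (\<lambda>a. freq J x a - p a)
      + (sqrt (\<epsilon>\<^sup>2 + sqrt (row_dev R (freq J x)) + sqrt (col_dev R (freq J x))) + \<epsilon>))
    \<le> (2 + sqrt (2 * regularity_const + 480) + sqrt (2 * regularity_const)) * sqrt (1 / ln (card J))"
proof -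
  define n where "n = real (card J)"
  have n: "2 \<le> n" using n2 by (simp add: n_def)
  have lnn: "0 < ln n" using n by simp
  have K: "0 < regularity_const" by (simp add: regularity_const_def)
  have \<epsilon>2: "\<epsilon>\<^sup>2 = 2 * regularity_const / ln n" using lnn K by (simp add: \<epsilon> n_def)
  then have Ke: "regularity_const / \<epsilon>\<^sup>2 = ln n / 2" using lnn K by simp
  then have "real (card (c ` I)) \<le> exp (ln n / 2)" using c by (simp only:)
  also have "\<dots> = sqrt n" using n by (simp add: ln_sqrt[symmetric])
  finally have "card (c ` I) \<le> sqrt n" .
  also have "\<dots> \<le> n / ln n"
  proof -
    have "sqrt n * ln n \<le> sqrt n * sqrt n" using n by (intro mult_left_mono ln_le_sqrt) auto
    then show ?thesis using lnn n by (simp add: field_simps)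
  qed
  finally have "card (c ` I) / n \<le> (n / ln n) / n" using n by (intro divide_right_mono) auto
  then have "sqrt (card (c ` I) / n) \<le> sqrt (1 / ln n)"
    using n by (intro real_sqrt_le_mono) simp
  with expec_coarse[of c] have 1: "expec (\<lambda>x. coarse I c (\<lambda>a. freq J x a - p a)) \<le> sqrt (1 / ln n)"
    unfolding n_def by (rule order_trans)
  define L where "L = 1 + ln n / 2"
  have L0: "0 < L" using lnn by (simp add: L_def)
  have RL: "\<bar>R a b\<bar> \<le> L" if "a \<in> I" "b \<in> I" for a b using R[OF that] by (simp add: Ke L_def)
  have row: "expec (\<lambda>x. sqrt (row_dev R (freq J x))) \<le> L\<^sup>2 / sqrt n"
  proof -
    have "0 \<le> row_dev R (freq J x)" for x
      unfolding row_dev_def by (intro sum_nonneg mult_nonneg_nonneg) (auto simp: p_nonneg)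
    then have "expec (\<lambda>x. (sqrt (row_dev R (freq J x)))\<^sup>2) \<le> L^4 / n"
      using expec_row_dev[OF RL] by (simp add: n_def)
    then have "expec (\<lambda>x. sqrt (row_dev R (freq J x))) \<le> sqrt (L^4 / n)"
      by (rule expec_le_sqrt) (use L0 n in auto)
    also have "\<dots> = L\<^sup>2 / sqrt n"
      using real_sqrt_abs[of "L\<^sup>2"] by (simp add: real_sqrt_divide flip: power_mult)
    finally show ?thesis .
  qed
  have col: "expec (\<lambda>x. sqrt (col_dev R (freq J x))) \<le> 4 * (L\<^sup>2 / sqrt n)"
  proof -
    have "0 \<le> col_dev R (freq J x)" for x
      unfolding col_dev_def by (intro sum_nonneg mult_nonneg_nonneg) auto
    then have "expec (\<lambda>x. (sqrt (col_dev R (freq J x)))\<^sup>2) \<le> 12 * L^4 / n"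
      using expec_col_dev[OF RL] by (simp add: n_def)
    also have "\<dots> \<le> (4 * L\<^sup>2)\<^sup>2 / n"
      using n by (intro divide_right_mono) (auto simp: power_mult_distrib simp flip: power_mult)
    finally have "expec (\<lambda>x. sqrt (col_dev R (freq J x))) \<le> sqrt ((4 * L\<^sup>2)\<^sup>2 / n)"
      by (rule expec_le_sqrt) (use L0 n in auto)
    also have "\<dots> = 4 * (L\<^sup>2 / sqrt n)" by (simp only: real_sqrt_divide real_sqrt_abs) simp
    finally show ?thesis .
  qed
  \<comment> \<open>The sixth root z of n is used because \<open>L\<^sup>2 * ln n\<close> is cubic
    in ln n and z^3 = sqrt n. The 5 is 1 for rows plus 4 >= sqrt 12 for columns, and 480 = 5 * 4^2 *
    6.\<close>
  have num: "5 * (L\<^sup>2 / sqrt n) \<le> 480 / ln n"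
  proof -
    define z where "z = n powr (1/6)"
    have z: "1 \<le> z" using n by (simp add: z_def ge_one_powr_ge_zero)
    have ln_z: "ln n \<le> 6 * z" unfolding z_def using n by (intro ln_le_root6) auto
    have "z ^ 3 = n powr (1/2)" using n by (simp add: z_def powr_powr flip: powr_numeral)
    then have z3: "z ^ 3 = sqrt n" using n by (simp add: powr_half_sqrt)
    have "L \<le> 4 * z" using ln_z z by (simp add: L_def)
    then have "L\<^sup>2 * ln n \<le> (4 * z)\<^sup>2 * (6 * z)"
      using ln_z L0 lnn by (intro mult_mono power_mono) auto
    also have "\<dots> = 96 * sqrt n" by (simp add: z3[symmetric] power2_eq_square power3_eq_cube)
    finally show ?thesis using n lnn by (simp add: field_simps)
  qed
  have F: "expec (\<lambda>x. sqrt (\<epsilon>\<^sup>2 + sqrt (row_dev R (freq J x)) + sqrt (col_dev R (freq J x))))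
      \<le> sqrt ((2 * regularity_const + 480) / ln n)"
  proof (rule expec_le_sqrt)
    have rc: "0 \<le> row_dev R (freq J x)" "0 \<le> col_dev R (freq J x)" for x
      unfolding row_dev_def col_dev_def by (intro sum_nonneg mult_nonneg_nonneg; simp add: p_nonneg)+
    have "expec (\<lambda>x. (sqrt (\<epsilon>\<^sup>2 + sqrt (row_dev R (freq J x)) + sqrt (col_dev R (freq J x))))\<^sup>2)
        = \<epsilon>\<^sup>2 + expec (\<lambda>x. sqrt (row_dev R (freq J x))) + expec (\<lambda>x. sqrt (col_dev R (freq J x)))"
      using rc by (simp add: expec_add)
    also have "\<dots> \<le> 2 * regularity_const / ln n + 480 / ln n"
      using row col num \<epsilon>2 by linarith
    finally show "expec (\<lambda>x. (sqrt (\<epsilon>\<^sup>2 + sqrt (row_dev R (freq J x)) + sqrt (col_dev R (freq J x))))\<^sup>2)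
        \<le> (2 * regularity_const + 480) / ln n" by (simp add: add_divide_distrib)
  qed (use K lnn in auto)
  have e: "\<epsilon> = sqrt (2 * regularity_const) * sqrt (1 / ln n)"
    by (simp add: \<epsilon> n_def real_sqrt_divide)
  have s: "sqrt ((2 * regularity_const + 480) / ln n) = sqrt (2 * regularity_const + 480) * sqrt (1 / ln n)"
    by (simp add: real_sqrt_divide)
  show ?thesis
    unfolding expec_add expec_cmult expec_const n_def[symmetric] distrib_right
    using 1 F e s by linarith
qed

end

section \<open>Integrals over grids\<close>

lemma Times_in_sets_lebesgue:
  fixes A B :: "real set"
  assumes A: "A \<in> sets lebesgue" and B: "B \<in> sets lebesgue"
  shows "A \<times> B \<in> sets lebesgue"
    and "emeasure lebesgue (A \<times> B) = emeasure lebesgue A * emeasure lebesgue B"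
proof -
  obtain S N N' where A': "A = S \<union> N" "N \<subseteq> N'" "N' \<in> null_sets lborel" "S \<in> sets lborel"
    using sets_completionE[OF A] by metis
  obtain T M M' where B': "B = T \<union> M" "M \<subseteq> M'" "M' \<in> null_sets lborel" "T \<in> sets lborel"
    using sets_completionE[OF B] by metis
  \<comment> \<open>Lebesgue measure on pairs completes the Borel product, so \<open>A\<close> and
    \<open>B\<close> are replaced by their Borel parts \<open>S\<close> and \<open>T\<close>. The
    error lies in the cylinders over the Borel null sets \<open>N'\<close> and
    \<open>M'\<close>.\<close>
  define Z where "Z = (N' \<times> (UNIV::real set)) \<union> ((UNIV::real set) \<times> M')"
  have prod: "emeasure lborel (X \<times> Y) = emeasure lborel X * emeasure lborel Y"
    if "X \<in> sets lborel" "Y \<in> sets lborel" for X Y :: "real set"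
    unfolding lborel_prod[symmetric] using that by (simp add: lborel.emeasure_pair_measure_Times)
  have times_sets: "X \<times> Y \<in> sets lborel" if "X \<in> sets lborel" "Y \<in> sets lborel" for X Y :: "real set"
    unfolding lborel_prod[symmetric] using that by (rule pair_measureI)
  have "N' \<times> (UNIV::real set) \<in> null_sets lborel" "(UNIV::real set) \<times> M' \<in> null_sets lborel"
    using A'(3) B'(3) times_sets[of N' UNIV] times_sets[of UNIV M'] prod[of N' UNIV] prod[of UNIV M']
    by (simp_all add: null_sets_def)
  then have Z: "Z \<in> null_sets lborel" unfolding Z_def by (rule null_sets.Un)
  have N_null: "N \<in> null_sets lebesgue" "M \<in> null_sets lebesgue"
    using A' B' by (auto intro: null_sets_completion_subset null_sets_completionI)
  define W where "W = (A \<times> B) - (S \<times> T)"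
  have W: "W \<in> null_sets lebesgue"
    by (rule null_sets_completion_subset[OF _ null_sets_completionI[OF Z]]) (use A' B' in \<open>auto simp: W_def Z_def\<close>)
  have ST: "S \<times> T \<in> sets lebesgue" using times_sets[OF A'(4) B'(4)] by simp
  have AB: "A \<times> B = (S \<times> T) \<union> W" using A' B' by (auto simp: W_def)
  show "A \<times> B \<in> sets lebesgue" unfolding AB using ST W by auto
  have "emeasure lebesgue (A \<times> B) = emeasure lebesgue (S \<times> T)"
    unfolding AB using ST W by (rule emeasure_Un_null_set)
  also have "\<dots> = emeasure lborel S * emeasure lborel T"
    using times_sets[OF A'(4) B'(4)] prod[OF A'(4) B'(4)] by simp
  also have "emeasure lborel S = emeasure lebesgue A"
    using emeasure_Un_null_set[of S lebesgue N] A' N_null by simp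
  also have "emeasure lborel T = emeasure lebesgue B"
    using emeasure_Un_null_set[of T lebesgue M] B' N_null by simp
  finally show "emeasure lebesgue (A \<times> B) = emeasure lebesgue A * emeasure lebesgue B" .
qed

lemma lmeasurable_Times_real:
  fixes A B :: "real set"
  assumes "A \<in> lmeasurable" "B \<in> lmeasurable"
  shows "A \<times> B \<in> lmeasurable" "measure lebesgue (A \<times> B) = measure lebesgue A * measure lebesgue B"
  using assms Times_in_sets_lebesgue[of A B]
  by (auto simp: fmeasurable_def ennreal_mult_less_top measure_def enn2real_mult)

lemma lmeasurable_subset_unit:
  assumes "A \<in> sets lebesgue" "A \<subseteq> {0..1::real}"
  shows "A \<in> lmeasurable" "measure lebesgue A \<le> 1"
proof -
  show "A \<in> lmeasurable"
    by (rule fmeasurableI2[of "{0..1}"]) (use assms in auto)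
  show "measure lebesgue A \<le> 1"
    using measure_mono_fmeasurable[of A "{0..1}" lebesgue] assms by simp
qed

text \<open>If \<open>f\<close> is not integrable, its integral has the default value 0 and the
  estimate is immediate. This spares any proof that a rearranged graphon is measurable.\<close>

lemma set_integral_approx:
  fixes f g h :: "'a \<Rightarrow> real"
  assumes A: "A \<in> sets M" and g: "set_integrable M A g" and h: "integrable M h"
    and le: "\<And>z. z \<in> A \<Longrightarrow> \<bar>f z - g z\<bar> \<le> h z" and h0: "\<And>z. 0 \<le> h z"
  shows "\<bar>LINT z:A|M. f z\<bar> \<le> \<bar>LINT z:A|M. g z\<bar> + (\<integral>z. h z \<partial>M)"
proof (cases "set_integrable M A f")
  case True
  have hA: "0 \<le> (\<integral>z. h z \<partial>M)" by (rule Bochner_Integration.integral_nonneg) (rule h0)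
  have "(LINT z:A|M. f z) - (LINT z:A|M. g z) = (LINT z:A|M. f z - g z)"
    using True g by simp
  also have "\<bar>\<dots>\<bar> \<le> (\<integral>z. \<bar>indicator A z * (f z - g z)\<bar> \<partial>M)"
    unfolding set_lebesgue_integral_def using integral_abs_bound[of M "\<lambda>z. indicator A z *\<^sub>R (f z - g z)"] by simp
  also have "\<dots> \<le> (\<integral>z. h z \<partial>M)"
  proof (rule integral_mono)
    have "set_integrable M A (\<lambda>z. f z - g z)" using True g by simp
    then show "integrable M (\<lambda>z. \<bar>indicator A z * (f z - g z)\<bar>)"
      unfolding set_integrable_def by simp
    show "\<bar>indicator A z * (f z - g z)\<bar> \<le> h z" for z
      using le[of z] h0[of z] by (cases "z \<in> A") auto
  qed (rule h)
  finally show ?thesis by linarith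
next
  case False
  then have "(LINT z:A|M. f z) = 0"
    unfolding set_integrable_def set_lebesgue_integral_def by (rule not_integrable_integral_eq)
  moreover have "0 \<le> (\<integral>z. h z \<partial>M)" by (rule Bochner_Integration.integral_nonneg) (rule h0)
  ultimately show ?thesis by simp
qed

section \<open>Cells of the uniform grid\<close>

definition cell :: "nat \<Rightarrow> nat \<Rightarrow> real set" where
  "cell N i = {real (i - 1) / real N <.. real i / real N}"

definition idx :: "nat \<Rightarrow> real \<Rightarrow> nat" where
  "idx N t = nat \<lceil>real N * t\<rceil>"

text \<open>Cells are open on the left and closed on the right, as the ceiling in the empirical
  graphon dictates. Index 0 is excluded: \<open>idx\<close> gives it to all t <= 0, whereas
  \<open>cell N 0\<close> is empty.\<close>

lemma idx_eq_iff:
  assumes "0 < N" "1 \<le> i"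
  shows "idx N t = i \<longleftrightarrow> t \<in> cell N i"
proof -
  have "idx N t = i \<longleftrightarrow> \<lceil>real N * t\<rceil> = int i" using assms by (auto simp: idx_def)
  also have "\<dots> \<longleftrightarrow> real (i - 1) < real N * t \<and> real N * t \<le> real i"
    using assms by (auto simp: ceiling_eq_iff of_nat_diff)
  also have "\<dots> \<longleftrightarrow> t \<in> cell N i"
    using assms by (auto simp: cell_def field_simps)
  finally show ?thesis .
qed

lemma idx_in:
  assumes "0 < N" "t \<in> {0<..1}"
  shows "idx N t \<in> {1..N}" "t \<in> cell N (idx N t)"
proof -
  have t: "0 < real N * t" "real N * t \<le> real N * 1"
    using assms by (auto simp del: mult_1_right intro!: mult_left_mono)
  have "0 < \<lceil>real N * t\<rceil>" using t(1) by simp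
  moreover have "\<lceil>real N * t\<rceil> \<le> int N" using t(2) by (simp add: ceiling_le_iff)
  ultimately show 1: "idx N t \<in> {1..N}" unfolding idx_def by simp linarith
  show "t \<in> cell N (idx N t)" using idx_eq_iff[of N "idx N t" t] assms 1 by simp
qed

lemma cell_subset: "0 < N \<Longrightarrow> i \<in> {1..N} \<Longrightarrow> cell N i \<subseteq> {0<..1}"
proof
  fix t assume N: "0 < N" "i \<in> {1..N}" and "t \<in> cell N i"
  then have t: "real (i - 1) / real N < t" "t \<le> real i / real N" by (auto simp: cell_def)
  have "0 \<le> real (i - 1) / real N" by simp
  moreover have "real i / real N \<le> 1" using N by simp
  ultimately show "t \<in> {0<..1}" using t by (simp only: greaterThanAtMost_iff) linarith
qed

lemma cell_lmeasurable [simp]: "cell N i \<in> lmeasurable"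
  unfolding cell_def by (intro lmeasurable_interval bounded_set_imp_lmeasurable) auto

lemma measure_cell: "0 < N \<Longrightarrow> i \<in> {1..N} \<Longrightarrow> measure lebesgue (cell N i) = 1 / N"
  by (simp add: cell_def of_nat_diff field_simps)

lemma disjoint_cells: "0 < N \<Longrightarrow> 1 \<le> i \<Longrightarrow> 1 \<le> j \<Longrightarrow> i \<noteq> j \<Longrightarrow> cell N i \<inter> cell N j = {}"
  using idx_eq_iff[of N i] idx_eq_iff[of N j] by (simp add: disjoint_iff) metis

definition grid_fun :: "nat \<Rightarrow> (nat \<Rightarrow> nat \<Rightarrow> real) \<Rightarrow> real \<times> real \<Rightarrow> real" where
  "grid_fun N d z = (\<Sum>i\<in>{1..N}. \<Sum>j\<in>{1..N}. d i j * indicator (cell N i \<times> cell N j) z)"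

lemma grid_fun_eq:
  assumes "0 < N" "x \<in> {0<..1}" "y \<in> {0<..1}"
  shows "grid_fun N d (x, y) = d (idx N x) (idx N y)"
proof -
  have "grid_fun N d (x, y) = (\<Sum>i\<in>{1..N}. \<Sum>j\<in>{1..N}. if j = idx N y then (if i = idx N x then d i j else 0) else 0)"
    unfolding grid_fun_def
    by (intro sum.cong refl) (use idx_eq_iff[OF assms(1), of _ x] idx_eq_iff[OF assms(1), of _ y] in \<open>auto simp: indicator_def\<close>)
  also have "\<dots> = (\<Sum>i\<in>{1..N}. if i = idx N x then d i (idx N y) else 0)"
    using idx_in(1)[OF assms(1,3)] by (intro sum.cong refl) simp
  also have "\<dots> = d (idx N x) (idx N y)" using idx_in(1)[OF assms(1,2)] by simp
  finally show ?thesis .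
qed

text \<open>The fraction of a cell covered by \<open>S\<close> can be any number in [0, 1]. This is
  why the combinatorial bounds are stated for weights \<open>s\<close>, \<open>t\<close> and not for
  sets of indices.\<close>

lemma grid_fun_integral:
  fixes d :: "nat \<Rightarrow> nat \<Rightarrow> real"
  assumes N: "0 < N" and S: "S \<in> sets lebesgue" "S \<subseteq> {0..1::real}" and T: "T \<in> sets lebesgue" "T \<subseteq> {0..1::real}"
  shows "set_integrable lebesgue (S \<times> T) (grid_fun N d)"
    and "(\<And>s t. (\<And>i. i \<in> {1..N} \<Longrightarrow> 0 \<le> s i \<and> s i \<le> (1::real)) \<Longrightarrow> (\<And>i. i \<in> {1..N} \<Longrightarrow> 0 \<le> t i \<and> t i \<le> (1::real))
        \<Longrightarrow> \<bar>\<Sum>i\<in>{1..N}. \<Sum>j\<in>{1..N}. s i * t j * d i j\<bar> \<le> (real N)\<^sup>2 * G)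
      \<Longrightarrow> \<bar>LINT z:S \<times> T|lebesgue. grid_fun N d z\<bar> \<le> G"
proof -
  have lm: "S \<inter> cell N i \<in> lmeasurable" "T \<inter> cell N i \<in> lmeasurable" for i
    by (rule fmeasurable_Int_fmeasurable[OF lmeasurable_subset_unit(1)[OF S]], simp add: fmeasurableD)
      (rule fmeasurable_Int_fmeasurable[OF lmeasurable_subset_unit(1)[OF T]], simp add: fmeasurableD)
  have ind: "indicator (S \<times> T) z *\<^sub>R grid_fun N d z
      = (\<Sum>i\<in>{1..N}. \<Sum>j\<in>{1..N}. d i j * indicator ((S \<inter> cell N i) \<times> (T \<inter> cell N j)) z)" for z
    unfolding grid_fun_def real_scaleR_def sum_distrib_left
    by (intro sum.cong refl) (auto simp: indicator_def split: prod.splits)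
  have int: "integrable lebesgue (\<lambda>z. d i j * indicator ((S \<inter> cell N i) \<times> (T \<inter> cell N j)) z)" for i j
  proof (intro integrable_mult_right integrable_real_indicator)
    have "(S \<inter> cell N i) \<times> (T \<inter> cell N j) \<in> lmeasurable"
      by (rule lmeasurable_Times_real[OF lm(1) lm(2)])
    then show "(S \<inter> cell N i) \<times> (T \<inter> cell N j) \<in> sets lebesgue"
      "emeasure lebesgue ((S \<inter> cell N i) \<times> (T \<inter> cell N j)) < \<infinity>"
      unfolding fmeasurable_def by auto
  qed
  show "set_integrable lebesgue (S \<times> T) (grid_fun N d)"
    unfolding set_integrable_def ind by (intro Bochner_Integration.integrable_sum int)
  assume G: "\<And>s t. (\<And>i. i \<in> {1..N} \<Longrightarrow> 0 \<le> s i \<and> s i \<le> (1::real)) \<Longrightarrow> (\<And>i. i \<in> {1..N} \<Longrightarrow> 0 \<le> t i \<and> t i \<le> (1::real))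
        \<Longrightarrow> \<bar>\<Sum>i\<in>{1..N}. \<Sum>j\<in>{1..N}. s i * t j * d i j\<bar> \<le> (real N)\<^sup>2 * G"
  define s where "s i = real N * measure lebesgue (S \<inter> cell N i)" for i
  define t where "t i = real N * measure lebesgue (T \<inter> cell N i)" for i
  have unit: "0 \<le> real N * measure lebesgue (X \<inter> cell N i) \<and> real N * measure lebesgue (X \<inter> cell N i) \<le> 1"
    if "X \<inter> cell N i \<in> lmeasurable" "i \<in> {1..N}" for X i
  proof -
    have "measure lebesgue (X \<inter> cell N i) \<le> measure lebesgue (cell N i)"
      by (rule measure_mono_fmeasurable) (use that(1) in \<open>simp_all add: fmeasurableD\<close>)
    then show ?thesis using measure_cell[OF N that(2)] N by (simp add: field_simps)
  qed
  have "(LINT z:S \<times> T|lebesgue. grid_fun N d z)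
      = (\<Sum>i\<in>{1..N}. \<Sum>j\<in>{1..N}. d i j * (measure lebesgue (S \<inter> cell N i) * measure lebesgue (T \<inter> cell N j)))"
  proof -
    have one: "(LINT z|lebesgue. d i j * indicator ((S \<inter> cell N i) \<times> (T \<inter> cell N j)) z)
        = d i j * (measure lebesgue (S \<inter> cell N i) * measure lebesgue (T \<inter> cell N j))" for i j
      using lmeasurable_Times_real[OF lm(1)[of i] lm(2)[of j]] by simp
    show ?thesis
      unfolding set_lebesgue_integral_def ind
      by (subst Bochner_Integration.integral_sum, intro Bochner_Integration.integrable_sum int, intro sum.cong refl,
          subst Bochner_Integration.integral_sum, rule int, intro sum.cong refl one)
  qed
  also have "\<dots> = (\<Sum>i\<in>{1..N}. \<Sum>j\<in>{1..N}. s i * t j * d i j) / (real N)\<^sup>2"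
    unfolding sum_divide_distrib using N by (intro sum.cong refl) (simp add: s_def t_def power2_eq_square)
  finally have eq: "(LINT z:S \<times> T|lebesgue. grid_fun N d z) = (\<Sum>i\<in>{1..N}. \<Sum>j\<in>{1..N}. s i * t j * d i j) / (real N)\<^sup>2" .
  have "\<bar>\<Sum>i\<in>{1..N}. \<Sum>j\<in>{1..N}. s i * t j * d i j\<bar> \<le> (real N)\<^sup>2 * G"
    by (rule G) (auto simp: s_def t_def intro!: unit[THEN conjunct1] unit[THEN conjunct2] lm)
  then show "\<bar>LINT z:S \<times> T|lebesgue. grid_fun N d z\<bar> \<le> G"
    unfolding eq abs_divide using N by (simp add: divide_le_eq mult.commute)
qed

section \<open>Rearrangements that permute cells\<close>

definition grid_perm :: "nat \<Rightarrow> (nat \<Rightarrow> nat) \<Rightarrow> real \<Rightarrow> real" where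
  "grid_perm N \<pi> t = (if t \<in> {0<..1} then t + (real (\<pi> (idx N t)) - real (idx N t)) / real N else t)"

lemma cell_shift:
  assumes "0 < N" "1 \<le> i" "1 \<le> j"
  shows "t + (real j - real i) / real N \<in> cell N j \<longleftrightarrow> t \<in> cell N i"
proof -
  have "real (j - 1) / N = real (i - 1) / N + (real j - real i) / N"
    using assms by (simp add: of_nat_diff diff_divide_distrib)
  moreover have "real j / N = real i / N + (real j - real i) / N"
    by (simp add: diff_divide_distrib)
  ultimately show ?thesis unfolding cell_def greaterThanAtMost_iff by simp
qed

context
  fixes N :: nat and \<pi> :: "nat \<Rightarrow> nat"
  assumes N: "0 < N" and \<pi>: "\<pi> permutes {1..N}"
begin

lemma perm_in: "i \<in> {1..N} \<Longrightarrow> \<pi> i \<in> {1..N}"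
  using permutes_in_image[OF \<pi>] by blast

lemma grid_perm_cell:
  assumes "t \<in> {0<..1}"
  shows "grid_perm N \<pi> t \<in> cell N (\<pi> (idx N t))"
proof -
  have i: "idx N t \<in> {1..N}" "t \<in> cell N (idx N t)" by (rule idx_in[OF N assms])+
  have "t + (real (\<pi> (idx N t)) - real (idx N t)) / real N \<in> cell N (\<pi> (idx N t))"
    using cell_shift[OF N, of "idx N t" "\<pi> (idx N t)" t] i perm_in[OF i(1)] by simp
  then show ?thesis using assms by (simp add: grid_perm_def)
qed

lemma grid_perm_in: "t \<in> {0<..1} \<Longrightarrow> grid_perm N \<pi> t \<in> {0<..1}"
  using grid_perm_cell cell_subset[OF N] perm_in idx_in(1)[OF N] by blast

lemma idx_grid_perm: "t \<in> {0<..1} \<Longrightarrow> idx N (grid_perm N \<pi> t) = \<pi> (idx N t)"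
  using grid_perm_cell[of t] idx_eq_iff[OF N, of "\<pi> (idx N t)"] perm_in[OF idx_in(1)[OF N, of t]] by simp

lemma grid_perm_0: "t \<in> {0..1} \<Longrightarrow> t \<notin> {0<..1} \<Longrightarrow> grid_perm N \<pi> t = 0"
  by (auto simp: grid_perm_def)

lemma grid_perm_unit: "t \<in> {0..1} \<Longrightarrow> grid_perm N \<pi> t \<in> {0..1}"
  using grid_perm_in[of t] grid_perm_0[of t] by (cases "t \<in> {0<..1}") auto

end

lemma grid_perm_inverse:
  assumes "0 < N" "\<pi> permutes {1..N}" "\<sigma> permutes {1..N}" "\<And>i. \<sigma> (\<pi> i) = i"
  shows "grid_perm N \<sigma> (grid_perm N \<pi> t) = t"
proof (cases "t \<in> {0<..1}")
  case True
  have "grid_perm N \<sigma> (grid_perm N \<pi> t)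
      = grid_perm N \<pi> t + (real (\<sigma> (\<pi> (idx N t))) - real (\<pi> (idx N t))) / N"
    using grid_perm_in[OF assms(1,2) True] idx_grid_perm[OF assms(1,2) True]
    by (simp add: grid_perm_def[of N \<sigma>])
  also have "\<dots> = t" using True by (simp add: grid_perm_def assms(4) diff_divide_distrib)
  finally show ?thesis .
next
  case False
  then have "grid_perm N \<pi>' t = t" for \<pi>' unfolding grid_perm_def by (simp only: if_False)
  then show ?thesis by simp
qed

text \<open>The inverse permutation yields the inverse map. The point 0 lies in no cell and is
  fixed, which makes the map a bijection of the closed interval.\<close>

lemma grid_perm_bij:
  assumes "0 < N" "\<pi> permutes {1..N}"
  shows "bij_betw (grid_perm N \<pi>) {0..1} {0..1}"
proof (rule bij_betw_byWitness[where f' = "grid_perm N (inv \<pi>)"])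
  have inv: "inv \<pi> permutes {1..N}" by (rule permutes_inv[OF assms(2)])
  show "\<forall>t\<in>{0..1}. grid_perm N (inv \<pi>) (grid_perm N \<pi> t) = t"
    using grid_perm_inverse[OF assms(1) assms(2) inv] permutes_inverses[OF assms(2)] by blast
  show "\<forall>t\<in>{0..1}. grid_perm N \<pi> (grid_perm N (inv \<pi>) t) = t"
    using grid_perm_inverse[OF assms(1) inv assms(2)] permutes_inverses[OF assms(2)] by blast
  show "grid_perm N \<pi> ` {0..1} \<subseteq> {0..1}" using grid_perm_unit[OF assms] by blast
  show "grid_perm N (inv \<pi>) ` {0..1} \<subseteq> {0..1}" using grid_perm_unit[OF assms(1) inv] by blast
qed

lemma emeasure_lebesgue_translation:
  fixes S :: "real set"
  shows "emeasure lebesgue ((+) a ` S) = emeasure lebesgue S"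
  using emeasure_lebesgue_affine[of 1 a S] by (simp add: add.commute[of a] image_def)

text \<open>The map is a translation on each cell, so the preimage is a disjoint union of translates
  of the pieces of \<open>A\<close>, up to the point 0.\<close>

lemma grid_perm_preimage:
  assumes N: "0 < N" and \<pi>: "\<pi> permutes {1..N}" and A: "A \<in> sets lebesgue" "A \<subseteq> {0..1}"
  shows "{t \<in> {0..1}. grid_perm N \<pi> t \<in> A} \<in> sets lebesgue"
    and "emeasure lebesgue {t \<in> {0..1}. grid_perm N \<pi> t \<in> A} = emeasure lebesgue A"
proof -
  let ?\<tau> = "grid_perm N \<pi>"
  define c where "c i = (real (\<pi> i) - real i) / real N" for i
  define P where "P i = (+) (- c i) ` (A \<inter> cell N (\<pi> i))" for i
  have \<pi>1: "1 \<le> \<pi> i" "\<pi> i \<in> {1..N}" if "i \<in> {1..N}" for i using perm_in[OF N \<pi> that] by auto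
  have P_iff: "t \<in> P i \<longleftrightarrow> t \<in> cell N i \<and> ?\<tau> t \<in> A" if i: "i \<in> {1..N}" for i t
  proof -
    have "t \<in> P i \<longleftrightarrow> t + c i \<in> A \<inter> cell N (\<pi> i)"
      unfolding P_def by (force simp: image_iff)
    also have "\<dots> \<longleftrightarrow> t + c i \<in> A \<and> t \<in> cell N i"
      using cell_shift[OF N, of i "\<pi> i" t] i \<pi>1[OF i] by (auto simp: c_def)
    also have "\<dots> \<longleftrightarrow> t \<in> cell N i \<and> ?\<tau> t \<in> A"
    proof -
      have "?\<tau> t = t + c i" if "t \<in> cell N i"
      proof -
        have "t \<in> {0<..1}" using that cell_subset[OF N i] by blast
        moreover have "idx N t = i" using idx_eq_iff[OF N, of i t] i that by simp
        ultimately show ?thesis by (simp add: grid_perm_def c_def)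
      qed
      then show ?thesis by auto
    qed
    finally show ?thesis .
  qed
  have cells: "t \<in> {0<..1} \<longleftrightarrow> (\<exists>i\<in>{1..N}. t \<in> cell N i)" for t
    using idx_in[OF N] cell_subset[OF N] by blast
  have pre: "{t \<in> {0..1}. ?\<tau> t \<in> A} = (\<Union>i\<in>{1..N}. P i) \<union> (A \<inter> {0})"
  proof (intro set_eqI)
    fix t
    show "t \<in> {t \<in> {0..1}. ?\<tau> t \<in> A} \<longleftrightarrow> t \<in> (\<Union>i\<in>{1..N}. P i) \<union> (A \<inter> {0})"
    proof (cases "t \<in> {0<..1}")
      case True
      then show ?thesis using cells[of t] P_iff[of _ t] by auto
    next
      case False
      then have "t \<in> {0..1} \<longleftrightarrow> t = 0" by auto
      moreover have "?\<tau> 0 = 0" by (simp add: grid_perm_def)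
      ultimately show ?thesis using False cells[of t] P_iff[of _ t] by auto
    qed
  qed
  have A_eq: "A = (\<Union>i\<in>{1..N}. A \<inter> cell N i) \<union> (A \<inter> {0})"
  proof (intro set_eqI)
    fix t
    show "t \<in> A \<longleftrightarrow> t \<in> (\<Union>i\<in>{1..N}. A \<inter> cell N i) \<union> (A \<inter> {0})"
      using A(2) cells[of t] by (cases "t \<in> {0<..1}") auto
  qed
  have AC: "A \<inter> cell N i \<in> sets lebesgue" for i using A(1) cell_lmeasurable[of N i] fmeasurableD by blast
  have P: "P i \<in> sets lebesgue" for i unfolding P_def by (rule lebesgue_sets_translation[OF AC])
  have Z: "A \<inter> {0} \<in> null_sets lebesgue"
    by (rule null_sets_completion_subset[of _ "{0}"]) (auto intro: null_sets_completionI)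
  show "{t \<in> {0..1}. ?\<tau> t \<in> A} \<in> sets lebesgue" unfolding pre using P Z by auto
  have "emeasure lebesgue {t \<in> {0..1}. ?\<tau> t \<in> A} = emeasure lebesgue (\<Union>i\<in>{1..N}. P i)"
    unfolding pre using P Z by (intro emeasure_Un_null_set) auto
  also have "\<dots> = (\<Sum>i\<in>{1..N}. emeasure lebesgue (P i))"
  proof (rule sum_emeasure[symmetric])
    show "disjoint_family_on P {1..N}"
      unfolding disjoint_family_on_def
    proof (intro ballI impI)
      fix i j assume ij: "i \<in> {1..N}" "j \<in> {1..N}" "i \<noteq> j"
      then have "cell N i \<inter> cell N j = {}" by (intro disjoint_cells[OF N]) auto
      then show "P i \<inter> P j = {}" using P_iff[OF ij(1)] P_iff[OF ij(2)] by blast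
    qed
  qed (use P in auto)
  also have "\<dots> = (\<Sum>i\<in>{1..N}. emeasure lebesgue (A \<inter> cell N (\<pi> i)))"
    unfolding P_def by (simp only: emeasure_lebesgue_translation)
  also have "\<dots> = (\<Sum>i\<in>{1..N}. emeasure lebesgue (A \<inter> cell N i))"
    using sum.permute[OF \<pi>, of "\<lambda>i. emeasure lebesgue (A \<inter> cell N i)"] by (simp add: o_def)
  also have "\<dots> = emeasure lebesgue (\<Union>i\<in>{1..N}. A \<inter> cell N i)"
  proof (rule sum_emeasure)
    show "disjoint_family_on (\<lambda>i. A \<inter> cell N i) {1..N}"
      unfolding disjoint_family_on_def
    proof (intro ballI impI)
      fix i j assume ij: "i \<in> {1..N}" "j \<in> {1..N}" "i \<noteq> j"
      then have "cell N i \<inter> cell N j = {}" by (intro disjoint_cells[OF N]) auto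
      then show "A \<inter> cell N i \<inter> (A \<inter> cell N j) = {}" by blast
    qed
  qed (use AC in auto)
  also have "\<dots> = emeasure lebesgue A"
  proof -
    have "(\<Union>i\<in>{1..N}. A \<inter> cell N i) \<in> sets lebesgue" by (rule sets.finite_UN) (auto intro: AC)
    then show ?thesis by (subst (2) A_eq) (rule emeasure_Un_null_set[OF _ Z, symmetric])
  qed
  finally show "emeasure lebesgue {t \<in> {0..1}. ?\<tau> t \<in> A} = emeasure lebesgue A" .
qed

lemma grid_perm_measure_preserving:
  assumes N: "0 < N" and \<pi>: "\<pi> permutes {1..N}"
  shows "grid_perm N \<pi> \<in> measure_preserving_bijections"
proof -
  let ?L = "lebesgue_on {0..1::real}"
  have sets_L: "A \<in> sets ?L \<longleftrightarrow> A \<in> sets lebesgue \<and> A \<subseteq> {0..1}" for A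
    by (auto simp: sets_restrict_space_iff)
  have sp: "space ?L = {0..1}" by (simp add: space_restrict_space)
  have vim: "grid_perm N \<pi> -` A \<inter> space ?L = {t \<in> {0..1}. grid_perm N \<pi> t \<in> A}" for A
    by (auto simp: sp)
  have meas: "grid_perm N \<pi> \<in> measurable ?L ?L"
  proof (rule measurableI)
    fix t assume "t \<in> space ?L"
    then show "grid_perm N \<pi> t \<in> space ?L" unfolding sp by (rule grid_perm_unit[OF N \<pi>])
  next
    fix A assume "A \<in> sets ?L"
    then show "grid_perm N \<pi> -` A \<inter> space ?L \<in> sets ?L"
      unfolding vim sets_L using grid_perm_preimage(1)[OF N \<pi>, of A] by auto
  qed
  have "distr ?L ?L (grid_perm N \<pi>) = ?L"
  proof (rule measure_eqI)
    fix A assume "A \<in> sets (distr ?L ?L (grid_perm N \<pi>))"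
    then have A: "A \<in> sets ?L" "A \<in> sets lebesgue" "A \<subseteq> {0..1}" by (auto simp: sets_L)
    have em: "emeasure ?L X = emeasure lebesgue X" if "X \<subseteq> {0..1}" for X
      using that by (intro emeasure_restrict_space) auto
    have "emeasure (distr ?L ?L (grid_perm N \<pi>)) A = emeasure ?L {t \<in> {0..1}. grid_perm N \<pi> t \<in> A}"
      unfolding emeasure_distr[OF meas A(1)] vim ..
    also have "\<dots> = emeasure lebesgue {t \<in> {0..1}. grid_perm N \<pi> t \<in> A}" by (rule em) auto
    also have "\<dots> = emeasure ?L A" using grid_perm_preimage(2)[OF N \<pi> A(2,3)] em[OF A(3)] by simp
    finally show "emeasure (distr ?L ?L (grid_perm N \<pi>)) A = emeasure ?L A" .
  qed simp
  with meas grid_perm_bij[OF N \<pi>] show ?thesis by (simp add: measure_preserving_bijections_def)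
qed

text \<open>Compact subsets of the label classes are at positive distance from each other, so a fine
  enough grid meets at most one of them in each cell.\<close>

lemma grid_labelling:
  fixes \<phi> :: "real \<Rightarrow> 'a"
  assumes I: "finite I" and \<phi>: "\<phi> ` {0..1} \<subseteq> I"
    and meas: "\<And>a. a \<in> I \<Longrightarrow> {t \<in> {0..1}. \<phi> t = a} \<in> sets lebesgue"
    and n: "0 < n" and \<delta>: "0 < \<delta>"
  obtains r \<psi> B where "0 < r" "\<psi> ` {1..n * r} \<subseteq> I" "B \<in> sets lebesgue" "B \<subseteq> {0..1}" "measure lebesgue B \<le> \<delta>"
    "\<And>t. t \<in> {0<..1} - B \<Longrightarrow> \<phi> t = \<psi> (idx (n * r) t)"
proof -
  define P where "P a = {t \<in> {0..1}. \<phi> t = a}" for a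
  have I0: "I \<noteq> {}" using \<phi> by fastforce
  then have cI: "0 < card I" using I by (simp add: card_gt_0_iff)
  have "\<exists>K. compact K \<and> K \<subseteq> P a \<and> P a - K \<in> lmeasurable \<and> measure lebesgue (P a - K) \<le> \<delta> / card I" if a: "a \<in> I" for a
  proof -
    have "P a \<in> sets lebesgue" "0 < \<delta> / card I" using meas[OF a] \<delta> cI by (auto simp: P_def)
    then obtain K where K: "closed K" "K \<subseteq> P a" "P a - K \<in> lmeasurable" "emeasure lebesgue (P a - K) < ennreal (\<delta> / card I)"
      by (rule sets_lebesgue_inner_closed)
    have "bounded K" using K(2) by (rule bounded_subset[rotated]) (auto simp: P_def intro: bounded_subset[of "{0..1}"])
    then have "compact K" using K(1) by (simp add: compact_eq_bounded_closed)
    moreover have "measure lebesgue (P a - K) \<le> \<delta> / card I"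
      using K(4) \<delta> by (simp only: measure_def) (meson enn2real_leI divide_nonneg_nonneg less_imp_le of_nat_0_le_iff)
    ultimately show ?thesis using K by blast
  qed
  then obtain K where K: "\<And>a. a \<in> I \<Longrightarrow> compact (K a)" "\<And>a. a \<in> I \<Longrightarrow> K a \<subseteq> P a"
    "\<And>a. a \<in> I \<Longrightarrow> P a - K a \<in> lmeasurable" "\<And>a. a \<in> I \<Longrightarrow> measure lebesgue (P a - K a) \<le> \<delta> / card I" by metis
  define d where "d a b = (SOME d. 0 < d \<and> (\<forall>x\<in>K a. \<forall>y\<in>K b. d \<le> dist x y))" for a b
  have d_some: "0 < d a b \<and> (\<forall>x\<in>K a. \<forall>y\<in>K b. d a b \<le> dist x y)" if "a \<in> I" "b \<in> I" "a \<noteq> b" for a b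
  proof -
    have "\<exists>d>0. \<forall>x\<in>K a. \<forall>y\<in>K b. d \<le> dist x y"
    proof (rule separate_compact_closed)
      show "K a \<inter> K b = {}" using K(2)[OF that(1)] K(2)[OF that(2)] that(3) by (auto simp: P_def)
    qed (use that K(1) in \<open>auto intro: compact_imp_closed\<close>)
    then show ?thesis unfolding d_def by (rule someI_ex)
  qed
  then have d: "\<And>a b. a \<in> I \<Longrightarrow> b \<in> I \<Longrightarrow> a \<noteq> b \<Longrightarrow> 0 < d a b"
    "\<And>a b x y. \<lbrakk>a \<in> I; b \<in> I; a \<noteq> b; x \<in> K a; y \<in> K b\<rbrakk> \<Longrightarrow> d a b \<le> dist x y" by blast+
  \<comment> \<open>The entry 1 keeps the set nonempty when there is a single label.\<close>
  define \<eta> where "\<eta> = Min (insert 1 ((\<lambda>(a, b). d a b) ` {(a, b) \<in> I \<times> I. a \<noteq> b}))"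
  have fin: "finite (insert 1 ((\<lambda>(a, b). d a b) ` {(a, b) \<in> I \<times> I. a \<noteq> b}))"
  proof -
    have "finite {(a, b) \<in> I \<times> I. a \<noteq> b}" by (rule finite_subset[of _ "I \<times> I"]) (use I in auto)
    then show ?thesis by simp
  qed
  have "\<forall>e\<in>insert 1 ((\<lambda>(a, b). d a b) ` {(a, b) \<in> I \<times> I. a \<noteq> b}). 0 < e" using d(1) by auto
  then have \<eta>: "0 < \<eta>" unfolding \<eta>_def by (subst Min_gr_iff[OF fin]) auto
  have \<eta>_le: "\<eta> \<le> dist x y" if "a \<in> I" "b \<in> I" "a \<noteq> b" "x \<in> K a" "y \<in> K b" for a b x y
  proof -
    have "d a b \<in> (\<lambda>(a, b). d a b) ` {(a, b) \<in> I \<times> I. a \<noteq> b}"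
      using that(1-3) by (intro image_eqI[of _ _ "(a, b)"]) auto
    then have "\<eta> \<le> d a b" unfolding \<eta>_def by (intro Min_le[OF fin] insertI2)
    then show ?thesis using d(2)[OF that] by linarith
  qed
  obtain r :: nat where r: "1 / \<eta> < real r" using reals_Archimedean2 by blast
  have r0: "0 < r" using r \<eta> by (cases r) auto
  \<comment> \<open>A multiple of \<open>n\<close>, so that every step of the empirical graphon is a
    union of cells.\<close>
  define N where "N = n * r"
  have N: "0 < N" using n r0 by (simp add: N_def)
  have "1 * real r \<le> real n * real r" using n by (intro mult_right_mono) auto
  then have "real r \<le> real N" by (simp add: N_def)
  then have rN: "1 / real N < \<eta>" proof -
    have "1 < \<eta> * real r" using r \<eta> by (simp add: field_simps)
    also have "\<dots> \<le> \<eta> * real N" using \<open>real r \<le> real N\<close> \<eta> by (intro mult_left_mono) auto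
    finally show ?thesis using N by (simp add: field_simps)
  qed
  \<comment> \<open>The last branch is arbitrary: a cell of the unit interval that meets none of the
    compact sets lies in the exceptional set \<open>B\<close>.\<close>
  define \<psi> where "\<psi> i = (if \<exists>a\<in>I. K a \<inter> cell N i \<noteq> {} then SOME a. a \<in> I \<and> K a \<inter> cell N i \<noteq> {} else SOME a. a \<in> I)" for i
  have \<psi>_in: "\<psi> i \<in> I" for i
  proof (cases "\<exists>a\<in>I. K a \<inter> cell N i \<noteq> {}")
    case True
    then show ?thesis unfolding \<psi>_def using someI_ex[of "\<lambda>a. a \<in> I \<and> K a \<inter> cell N i \<noteq> {}"] by auto
  next
    case False
    then show ?thesis unfolding \<psi>_def using I0 some_in_eq[of I] by simp
  qed
  define B where "B = (\<Union>a\<in>I. P a - K a)"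
  show thesis
  proof (rule that[OF r0, of \<psi> B])
    show "\<psi> ` {1..n * r} \<subseteq> I" using \<psi>_in by auto
    show "B \<in> sets lebesgue" unfolding B_def using I K(3) by (intro sets.finite_UN) (auto dest: fmeasurableD)
    show "B \<subseteq> {0..1}" by (auto simp: B_def P_def)
    have "measure lebesgue B \<le> (\<Sum>a\<in>I. measure lebesgue (P a - K a))"
      unfolding B_def using I K(3) by (intro measure_UNION_le) (auto dest: fmeasurableD)
    also have "\<dots> \<le> (\<Sum>a\<in>I. \<delta> / card I)" by (intro sum_mono K(4))
    also have "\<dots> = \<delta>" using cI by simp
    finally show "measure lebesgue B \<le> \<delta>" .
    fix t assume t: "t \<in> {0<..1} - B"
    then have "\<phi> t \<in> I" using \<phi> by auto
    have tK: "t \<in> K (\<phi> t)"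
    proof (rule ccontr)
      assume "t \<notin> K (\<phi> t)"
      moreover have "t \<in> P (\<phi> t)" using t by (auto simp: P_def)
      ultimately show False using t \<open>\<phi> t \<in> I\<close> by (auto simp: B_def)
    qed
    have tc: "t \<in> cell N (idx N t)" using idx_in(2)[OF N] t by blast
    have ex: "\<exists>a\<in>I. K a \<inter> cell N (idx N t) \<noteq> {}" using tK tc \<open>\<phi> t \<in> I\<close> by blast
    then have "K (\<psi> (idx N t)) \<inter> cell N (idx N t) \<noteq> {}"
      unfolding \<psi>_def using someI_ex[of "\<lambda>a. a \<in> I \<and> K a \<inter> cell N (idx N t) \<noteq> {}"] by auto
    then obtain u where u: "u \<in> K (\<psi> (idx N t))" "u \<in> cell N (idx N t)" by blast
    have "\<bar>t - u\<bar> \<le> 1 / N"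
    proof -
      have "real (idx N t) / N - real (idx N t - 1) / N \<le> 1 / N"
        by (auto simp: diff_divide_distrib[symmetric] intro!: divide_right_mono)
      then show ?thesis using tc u(2) unfolding cell_def greaterThanAtMost_iff by linarith
    qed
    then have "dist t u < \<eta>" using rN by (simp add: dist_real_def)
    then show "\<phi> t = \<psi> (idx (n * r) t)"
      using \<eta>_le[OF \<open>\<phi> t \<in> I\<close> \<psi>_in _ tK u(1)] unfolding N_def[symmetric] by fastforce
  qed
qed

section \<open>Bounds for cut norms\<close>

lemma unit_square_integral_bound:
  fixes W :: "real \<Rightarrow> real \<Rightarrow> real"
  assumes W: "\<And>x y. x \<in> {0..1} \<Longrightarrow> y \<in> {0..1} \<Longrightarrow> \<bar>W x y\<bar> \<le> M"
    and S: "S \<in> sets lebesgue" "S \<subseteq> {0..1}" and T: "T \<in> sets lebesgue" "T \<subseteq> {0..1}"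
  shows "\<bar>LINT z:S \<times> T|lebesgue. W (fst z) (snd z)\<bar> \<le> M"
proof -
  have M: "0 \<le> M" using W[of 0 0] by auto
  have U: "{0..1::real} \<times> {0..1::real} \<in> lmeasurable" "measure lebesgue ({0..1::real} \<times> {0..1::real}) = 1"
    using lmeasurable_Times_real[of "{0..1}" "{0..1}"] by auto
  have "\<bar>LINT z:S \<times> T|lebesgue. W (fst z) (snd z)\<bar>
      \<le> \<bar>LINT z:S \<times> T|lebesgue. (0::real)\<bar> + (\<integral>z. M * indicator ({0..1::real} \<times> {0..1::real}) z \<partial>lebesgue)"
  proof (rule set_integral_approx)
    show "S \<times> T \<in> sets lebesgue" by (rule Times_in_sets_lebesgue[OF S(1) T(1)])
    show "set_integrable lebesgue (S \<times> T) (\<lambda>_. 0::real)" by (simp add: set_integrable_def)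
    show "integrable lebesgue (\<lambda>z. M * indicator ({0..1::real} \<times> {0..1::real}) z)"
      using U(1) unfolding fmeasurable_def by (intro integrable_mult_right integrable_real_indicator) auto
    fix z assume "z \<in> S \<times> T"
    then have "fst z \<in> {0..1}" "snd z \<in> {0..1}" "z \<in> {0..1::real} \<times> {0..1::real}" using S T by auto
    then show "\<bar>W (fst z) (snd z) - 0\<bar> \<le> M * indicator ({0..1::real} \<times> {0..1::real}) z" using W by simp
  qed (use M in auto)
  then show ?thesis using U by simp
qed

lemma cut_norm_le:
  assumes "\<And>S T. \<lbrakk>S \<in> sets lebesgue; S \<subseteq> {0..1}; T \<in> sets lebesgue; T \<subseteq> {0..1}\<rbrakk>
    \<Longrightarrow> \<bar>LINT z:S \<times> T|lebesgue. W (fst z) (snd z)\<bar> \<le> C"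
  shows "cut_norm W \<le> C"
  unfolding cut_norm_def
proof (rule cSUP_least)
  have "({}, {}) \<in> {S \<in> sets lebesgue. S \<subseteq> {0..1::real}} \<times> {T \<in> sets lebesgue. T \<subseteq> {0..1::real}}" by auto
  then show "{S \<in> sets lebesgue. S \<subseteq> {0..1::real}} \<times> {T \<in> sets lebesgue. T \<subseteq> {0..1::real}} \<noteq> {}" by blast
qed (use assms in auto)

text \<open>The pair of empty sets contributes 0; the bound \<open>M\<close> ensures that the real
  supremum is over a set bounded above.\<close>

lemma cut_norm_nonneg:
  assumes "\<And>x y. x \<in> {0..1} \<Longrightarrow> y \<in> {0..1} \<Longrightarrow> \<bar>W x y\<bar> \<le> M"
  shows "0 \<le> cut_norm W"
proof -
  have "(case ({}, {}) of (S, T) \<Rightarrow> \<bar>LINT z:S \<times> T|lebesgue. W (fst z) (snd z)\<bar>) \<le> cut_norm W"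
    unfolding cut_norm_def
  proof (rule cSUP_upper)
    show "bdd_above ((\<lambda>(S, T). \<bar>LINT z:S \<times> T|lebesgue. W (fst z) (snd z)\<bar>) `
        ({S \<in> sets lebesgue. S \<subseteq> {0..1}} \<times> {T \<in> sets lebesgue. T \<subseteq> {0..1}}))"
      by (rule bdd_aboveI[of _ M]) (use unit_square_integral_bound[OF assms] in auto)
  qed auto
  then show ?thesis by (simp add: set_lebesgue_integral_def)
qed

section \<open>Refining the grid of the sample\<close>

definition blk :: "nat \<Rightarrow> nat \<Rightarrow> nat" where "blk r i = (i - 1) div r + 1"

lemma idx_coarsen:
  assumes "0 < n" "0 < r" "t \<in> {0<..1}"
  shows "idx n t = blk r (idx (n * r) t)"
proof -
  define i where "i = idx (n * r) t"
  define b where "b = blk r i"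
  have i: "i \<in> {1..n * r}" "t \<in> cell (n * r) i" using idx_in[of "n * r" t] assms by (auto simp: i_def)
  have "(i - 1) div r * r \<le> i - 1" "i - 1 < ((i - 1) div r + 1) * r"
    using assms(2) by (auto simp: div_times_less_eq_dividend dividend_less_div_times)
  then have "(b - 1) * r \<le> i - 1" "i \<le> b * r" using i by (auto simp: b_def blk_def)
  then have "real ((b - 1) * r) \<le> real (i - 1)" "real i \<le> real (b * r)" by (simp_all only: of_nat_le_iff)
  then have "real (b - 1) / n \<le> real (i - 1) / real (n * r)" "real i / real (n * r) \<le> real b / n"
    using assms by (simp_all add: field_simps)
  then have "t \<in> cell n b" using i(2) unfolding cell_def greaterThanAtMost_iff by linarith
  then show ?thesis using idx_eq_iff[OF assms(1), of b t] by (simp add: b_def blk_def i_def)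
qed

lemma blk_in: "0 < r \<Longrightarrow> i \<in> {1..n * r} \<Longrightarrow> blk r i \<in> {1..n}"
  by (auto simp: blk_def div_less_iff_less_mult Suc_le_eq)

lemma freq_blk:
  assumes "0 < n" "0 < r"
  shows "freq {1..n * r} (\<lambda>i. lab (blk r i)) a = freq {1..n} lab a"
proof -
  have fibre: "card {i \<in> {1..n * r}. blk r i = b} = r" if b: "b \<in> {1..n}" for b
  proof -
    have "{i \<in> {1..n * r}. blk r i = b} = {(b - 1) * r + 1..(b - 1) * r + r}"
    proof (intro set_eqI iffI)
      fix i assume "i \<in> {i \<in> {1..n * r}. blk r i = b}"
      then have i: "1 \<le> i" "(i - 1) div r = b - 1" by (auto simp: blk_def)
      have "(b - 1) * r + (i - 1) mod r = i - 1" using div_mult_mod_eq[of "i - 1" r] unfolding i(2) .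
      moreover have "(i - 1) mod r < r" using assms(2) by simp
      ultimately show "i \<in> {(b - 1) * r + 1..(b - 1) * r + r}"
        using i(1) unfolding atLeastAtMost_iff by linarith
    next
      fix i assume i: "i \<in> {(b - 1) * r + 1..(b - 1) * r + r}"
      have "(b - 1) * r + r = b * r" using b by (simp add: algebra_simps mult_eq_if)
      moreover have "b * r \<le> n * r" using b by simp
      ultimately have "i \<le> n * r" using i unfolding atLeastAtMost_iff by linarith
      moreover have "(i - 1) div r = b - 1"
        using i assms(2) by (intro div_nat_eqI) (auto simp: mult.commute)
      ultimately show "i \<in> {i \<in> {1..n * r}. blk r i = b}" using i b by (auto simp: blk_def)
    qed
    then show ?thesis by simp
  qed
  have "{i \<in> {1..n * r}. lab (blk r i) = a} = (\<Union>b\<in>{b \<in> {1..n}. lab b = a}. {i \<in> {1..n * r}. blk r i = b})"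
    using blk_in[OF assms(2), of _ n] by blast
  then have "card {i \<in> {1..n * r}. lab (blk r i) = a} = (\<Sum>b\<in>{b \<in> {1..n}. lab b = a}. card {i \<in> {1..n * r}. blk r i = b})"
    by (simp only:) (rule card_UN_disjoint, auto)
  also have "\<dots> = (\<Sum>b\<in>{b \<in> {1..n}. lab b = a}. r)"
    by (intro sum.cong refl fibre) simp
  finally show ?thesis using assms by (simp add: freq_def)
qed

section \<open>From grid sums to the cut distance\<close>

locale sampled_graphon =
  fixes I :: "'a set" and \<phi> :: "real \<Rightarrow> 'a" and Q :: "'a \<Rightarrow> 'a \<Rightarrow> real" and W :: "real \<Rightarrow> real \<Rightarrow> real"
    and Z :: "real set" and \<rho> :: real and n :: nat and \<xi> :: "nat \<Rightarrow> real"
  assumes finite_labels: "finite I" and labels: "\<phi> ` {0..1} \<subseteq> I"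
    and classes: "\<And>a. a \<in> I \<Longrightarrow> {t \<in> {0..1}. \<phi> t = a} \<in> sets lebesgue"
    and Z: "Z \<in> null_sets lebesgue" "Z \<subseteq> {0..1}"
    and W_eq: "\<And>x y. x \<in> {0..1} - Z \<Longrightarrow> y \<in> {0..1} - Z \<Longrightarrow> W x y = Q (\<phi> x) (\<phi> y)"
    and W_range: "\<And>x y. x \<in> {0..1} \<Longrightarrow> y \<in> {0..1} \<Longrightarrow> 0 \<le> W x y \<and> W x y \<le> 1"
    and Q_range': "\<And>a b. a \<in> I \<Longrightarrow> b \<in> I \<Longrightarrow> 0 \<le> Q a b \<and> Q a b \<le> 1"
    and \<rho>: "0 \<le> \<rho>" and n: "0 < n" and \<xi>: "\<And>i. i \<in> {1..n} \<Longrightarrow> \<xi> i \<in> {0..1} - Z"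
begin

abbreviation distance :: real where
  "distance \<equiv> cut_distance (empirical_graphon n (random_matrix \<rho> W \<xi>)) (\<lambda>x y. \<rho> * W x y)"

abbreviation mass :: "'a \<Rightarrow> real" where
  "mass a \<equiv> measure lebesgue {t \<in> {0..1}. \<phi> t = a}"

lemma empirical_range:
  assumes "x \<in> {0..1}" "y \<in> {0..1}"
  shows "0 \<le> empirical_graphon n (random_matrix \<rho> W \<xi>) x y \<and> empirical_graphon n (random_matrix \<rho> W \<xi>) x y \<le> \<rho>"
proof (cases "x \<in> {0<..1} \<and> y \<in> {0<..1}")
  case True
  then have "idx n x \<in> {1..n}" "idx n y \<in> {1..n}" using idx_in(1)[OF n] by auto
  then have "0 \<le> W (\<xi> (idx n x)) (\<xi> (idx n y)) \<and> W (\<xi> (idx n x)) (\<xi> (idx n y)) \<le> 1"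
    using \<xi> by (intro W_range) auto
  then show ?thesis using True \<rho>
    by (auto simp: empirical_graphon_def random_matrix_def idx_def mult_left_le)
qed (use \<rho> in \<open>auto simp: empirical_graphon_def\<close>)

text \<open>A real infimum lies below a given value only once the values are bounded below.
  Boundedness of both kernels makes all the cut norms nonnegative.\<close>

lemma distance_le_cut_norm:
  assumes "\<tau> \<in> measure_preserving_bijections"
  shows "distance \<le> cut_norm (\<lambda>x y. empirical_graphon n (random_matrix \<rho> W \<xi>) x y - \<rho> * W (\<tau> x) (\<tau> y))"
  unfolding cut_distance_def
proof (rule cINF_lower[OF _ assms])
  show "bdd_below ((\<lambda>\<tau>. cut_norm (\<lambda>x y. empirical_graphon n (random_matrix \<rho> W \<xi>) x y - \<rho> * W (\<tau> x) (\<tau> y)))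
      ` measure_preserving_bijections)"
  proof (rule bdd_belowI2[of _ 0])
    fix \<tau> assume "\<tau> \<in> measure_preserving_bijections"
    then have \<tau>: "\<tau> x \<in> {0..1}" if "x \<in> {0..1}" for x
      using that by (auto simp: measure_preserving_bijections_def bij_betw_def)
    show "0 \<le> cut_norm (\<lambda>x y. empirical_graphon n (random_matrix \<rho> W \<xi>) x y - \<rho> * W (\<tau> x) (\<tau> y))"
    proof (rule cut_norm_nonneg[of _ \<rho>])
      fix x y :: real assume xy: "x \<in> {0..1}" "y \<in> {0..1}"
      have "0 \<le> \<rho> * W (\<tau> x) (\<tau> y)" "\<rho> * W (\<tau> x) (\<tau> y) \<le> \<rho> * 1"
        using W_range[OF \<tau>[OF xy(1)] \<tau>[OF xy(2)]] \<rho> by (auto intro: mult_left_mono mult_nonneg_nonneg simp del: mult_1_right)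
      then show "\<bar>empirical_graphon n (random_matrix \<rho> W \<xi>) x y - \<rho> * W (\<tau> x) (\<tau> y)\<bar> \<le> \<rho>"
        using empirical_range[OF xy] by linarith
    qed
  qed
qed

text \<open>\<open>1 / n\<close> is the area of the diagonal blocks, where the random matrix is 0
  but \<open>Q\<close> may be 1. \<open>4 * \<delta>\<close> comes from two strips of area at most
  \<open>\<delta>\<close>, on which the kernel difference and its grid version differ by at most
  \<open>2 * \<rho>\<close>.\<close>

lemma distance_grid_bound:
  assumes r: "0 < r" and \<psi>: "\<psi> ` {1..n * r} \<subseteq> I" and B: "B \<in> sets lebesgue" "B \<subseteq> {0..1}" "measure lebesgue B \<le> \<delta>"
    and \<phi>\<psi>: "\<And>t. t \<in> {0<..1} - B \<Longrightarrow> \<phi> t = \<psi> (idx (n * r) t)"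
    and \<pi>: "\<pi> permutes {1..n * r}"
    and G: "\<And>s t. \<lbrakk>\<And>i. i \<in> {1..n * r} \<Longrightarrow> 0 \<le> s i \<and> s i \<le> (1::real); \<And>i. i \<in> {1..n * r} \<Longrightarrow> 0 \<le> t i \<and> t i \<le> (1::real)\<rbrakk> \<Longrightarrow>
      \<bar>\<Sum>i\<in>{1..n * r}. \<Sum>j\<in>{1..n * r}. s i * t j *
        (Q (\<phi> (\<xi> (blk r i))) (\<phi> (\<xi> (blk r j))) - Q (\<psi> (\<pi> i)) (\<psi> (\<pi> j)))\<bar> \<le> (real (n * r))\<^sup>2 * G"
  shows "distance \<le> \<rho> * (1 / n + 4 * \<delta> + G)"
proof -
  define N where "N = n * r"
  have N: "0 < N" using n r by (simp add: N_def)
  have \<pi>N: "\<pi> permutes {1..N}" using \<pi> by (simp add: N_def)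
  define \<tau> where "\<tau> = grid_perm N \<pi>"
  define \<alpha> where "\<alpha> i = \<phi> (\<xi> (blk r i))" for i
  define \<beta> where "\<beta> i = \<psi> (\<pi> i)" for i
  define d where "d i j = \<rho> * (Q (\<alpha> i) (\<alpha> j) - Q (\<beta> i) (\<beta> j))" for i j
  define D where "D x y = empirical_graphon n (random_matrix \<rho> W \<xi>) x y - \<rho> * W (\<tau> x) (\<tau> y)" for x y
  \<comment> \<open>The points where the grid labelling or the representation of \<open>W\<close>
    may fail. The point 0 is added because it lies in no cell; apart from \<open>B\<close> these are
    null sets.\<close>
  define Bad0 where "Bad0 = B \<union> (Z \<union> {0})"
  define Bad where "Bad = {t \<in> {0..1}. \<tau> t \<in> Bad0}"
  have Z0: "Z \<union> {0} \<in> null_sets lebesgue" using Z by (auto intro: null_sets_completionI)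
  have Bad0: "Bad0 \<in> sets lebesgue" "Bad0 \<subseteq> {0..1}" unfolding Bad0_def using sets.Un[OF B(1) null_setsD2[OF Z0]] B(2) Z(2) by auto
  have "emeasure lebesgue Bad = emeasure lebesgue Bad0"
    unfolding Bad_def \<tau>_def by (rule grid_perm_preimage(2)[OF N \<pi>N Bad0])
  also have "\<dots> = emeasure lebesgue B" unfolding Bad0_def by (rule emeasure_Un_null_set[OF B(1) Z0])
  finally have mBad: "measure lebesgue Bad \<le> \<delta>" using B(3) by (simp only: measure_def)
  have Bad: "Bad \<in> lmeasurable"
    by (rule lmeasurable_subset_unit(1)) (use grid_perm_preimage(1)[OF N \<pi>N Bad0] in \<open>auto simp: Bad_def \<tau>_def\<close>)
  have \<tau>_unit: "\<tau> x \<in> {0..1}" if "x \<in> {0..1}" for x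
    unfolding \<tau>_def by (rule grid_perm_unit[OF N \<pi>N that])
  have zero_Bad: "x \<in> {0<..1}" if "x \<in> {0..1} - Bad" for x
  proof (rule ccontr)
    assume "x \<notin> {0<..1}"
    then have "x = 0" using that by auto
    then show False using that by (auto simp: Bad_def \<tau>_def Bad0_def grid_perm_def)
  qed
  have \<alpha>_in: "\<alpha> i \<in> I" if "i \<in> {1..N}" for i
    using labels \<xi>[OF blk_in[OF r, of i n]] that by (auto simp: \<alpha>_def N_def)
  have \<beta>_in: "\<beta> i \<in> I" if "i \<in> {1..N}" for i
    using \<psi> perm_in[OF N \<pi>N that] by (auto simp: \<beta>_def N_def)
  have d_le: "\<bar>d i j\<bar> \<le> \<rho>" if "i \<in> {1..N}" "j \<in> {1..N}" for i j
  proof -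
    have "\<bar>Q (\<alpha> i) (\<alpha> j) - Q (\<beta> i) (\<beta> j)\<bar> \<le> 1"
      using Q_range'[OF \<alpha>_in[OF that(1)] \<alpha>_in[OF that(2)]] Q_range'[OF \<beta>_in[OF that(1)] \<beta>_in[OF that(2)]] by linarith
    then show ?thesis using \<rho> by (simp add: d_def abs_mult mult_left_le)
  qed
  have E_le: "\<bar>grid_fun N d (x, y)\<bar> \<le> \<rho>" if "x \<in> {0..1}" "y \<in> {0..1}" for x y
  proof (cases "x \<in> {0<..1} \<and> y \<in> {0<..1}")
    case True
    then show ?thesis using grid_fun_eq[OF N, of x y d] d_le[OF idx_in(1)[OF N] idx_in(1)[OF N]] by simp
  next
    case False
    then have "(x, y) \<notin> cell N i \<times> cell N j" if "i \<in> {1..N}" "j \<in> {1..N}" for i j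
      using cell_subset[OF N that(1)] cell_subset[OF N that(2)] by blast
    then have "grid_fun N d (x, y) = 0" unfolding grid_fun_def by (intro sum.neutral ballI) simp
    then show ?thesis using \<rho> by simp
  qed
  define h where "h z = \<rho> * (\<Sum>b\<in>{1..n}. indicator (cell n b \<times> cell n b) z)
      + 2 * \<rho> * (indicator (Bad \<times> {0..1}) z + indicator ({0..1} \<times> Bad) z)" for z :: "real \<times> real"
  have U: "{0..1::real} \<in> lmeasurable" by simp
  have ints: "integrable lebesgue (indicator (X \<times> Y) :: _ \<Rightarrow> real)"
      "(\<integral>z. indicator (X \<times> Y) z \<partial>lebesgue) = measure lebesgue X * measure lebesgue Y"
    if "X \<in> lmeasurable" "Y \<in> lmeasurable" for X Y :: "real set"
    using lmeasurable_Times_real[OF that]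
    by (auto simp: fmeasurable_def intro!: integrable_real_indicator)
  have h_int: "integrable lebesgue h"
    unfolding h_def
    by (intro Bochner_Integration.integrable_add integrable_mult_right Bochner_Integration.integrable_sum ints cell_lmeasurable Bad U)
  have "(\<integral>z. h z \<partial>lebesgue) = \<rho> * (\<Sum>b\<in>{1..n}. measure lebesgue (cell n b) * measure lebesgue (cell n b))
      + 2 * \<rho> * (measure lebesgue Bad * measure lebesgue {0..1::real} + measure lebesgue {0..1::real} * measure lebesgue Bad)"
    unfolding h_def
    by (simp only: Bochner_Integration.integral_add Bochner_Integration.integral_mult_right Bochner_Integration.integral_sum
        Bochner_Integration.integrable_add integrable_mult_right Bochner_Integration.integrable_sum
        ints cell_lmeasurable Bad U integral_mult_right_zero)
  also have "(\<Sum>b\<in>{1..n}. measure lebesgue (cell n b) * measure lebesgue (cell n b)) = 1 / n"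
    using n by (simp add: measure_cell)
  finally have h_integral: "(\<integral>z. h z \<partial>lebesgue) \<le> \<rho> * (1 / n + 4 * \<delta>)"
    using mult_left_mono[OF mBad \<rho>] by (simp add: algebra_simps)
  have h0: "0 \<le> h z" for z
    unfolding h_def using \<rho> by (intro add_nonneg_nonneg mult_nonneg_nonneg sum_nonneg) auto
  have close: "\<bar>D x y - grid_fun N d (x, y)\<bar> \<le> h (x, y)" if xy: "x \<in> {0..1}" "y \<in> {0..1}" for x y
  proof (cases "x \<in> Bad \<or> y \<in> Bad")
    case True
    have "0 \<le> \<rho> * W (\<tau> x) (\<tau> y)" "\<rho> * W (\<tau> x) (\<tau> y) \<le> \<rho> * 1"
      using W_range[OF \<tau>_unit[OF xy(1)] \<tau>_unit[OF xy(2)]] \<rho>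
      by (auto intro: mult_left_mono mult_nonneg_nonneg simp del: mult_1_right)
    then have "\<bar>D x y - grid_fun N d (x, y)\<bar> \<le> 2 * \<rho> * 1"
      using empirical_range[OF xy] E_le[OF xy] unfolding D_def by linarith
    also have "\<dots> \<le> 2 * \<rho> * (indicator (Bad \<times> {0..1}) (x, y) + indicator ({0..1} \<times> Bad) (x, y))"
      using True xy \<rho> by (intro mult_left_mono) (auto simp: indicator_def)
    also have "\<dots> \<le> h (x, y)" unfolding h_def using \<rho> by (auto intro!: mult_nonneg_nonneg sum_nonneg)
    finally show ?thesis .
  next
    case False
    then have xy': "x \<in> {0<..1}" "y \<in> {0<..1}" using zero_Bad xy by auto
    have label: "\<tau> t \<in> {0..1} - Z \<and> \<phi> (\<tau> t) = \<beta> (idx N t)" if "t \<in> {0<..1}" "t \<notin> Bad" for t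
    proof -
      have "\<tau> t \<in> {0<..1}" unfolding \<tau>_def by (rule grid_perm_in[OF N \<pi>N that(1)])
      moreover have "\<tau> t \<notin> Bad0" using that by (auto simp: Bad_def)
      ultimately have "\<phi> (\<tau> t) = \<psi> (idx N (\<tau> t))" "\<tau> t \<in> {0..1} - Z"
        using \<phi>\<psi>[of "\<tau> t"] by (auto simp: Bad0_def N_def)
      then show ?thesis using idx_grid_perm[OF N \<pi>N that(1)] by (simp add: \<beta>_def \<tau>_def)
    qed
    have "W (\<tau> x) (\<tau> y) = Q (\<beta> (idx N x)) (\<beta> (idx N y))"
      using W_eq label[OF xy'(1)] label[OF xy'(2)] False by auto
    moreover have "grid_fun N d (x, y) = d (idx N x) (idx N y)" by (rule grid_fun_eq[OF N xy'])
    moreover have idx: "idx n x = blk r (idx N x)" "idx n y = blk r (idx N y)"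
      using idx_coarsen[OF n r] xy' by (auto simp: N_def)
    moreover have "W (\<xi> (idx n x)) (\<xi> (idx n y)) = Q (\<alpha> (idx N x)) (\<alpha> (idx N y))"
      unfolding \<alpha>_def idx[symmetric] by (intro W_eq \<xi> idx_in(1)[OF n] xy')
    moreover have "empirical_graphon n (random_matrix \<rho> W \<xi>) x y = random_matrix \<rho> W \<xi> (idx n x) (idx n y)"
      using xy' by (simp add: empirical_graphon_def idx_def)
    ultimately have "D x y - grid_fun N d (x, y)
        = (if idx n x = idx n y then - \<rho> * Q (\<alpha> (idx N x)) (\<alpha> (idx N y)) else 0)"
      by (simp add: D_def d_def random_matrix_def right_diff_distrib)
    also have "\<bar>\<dots>\<bar> \<le> (if idx n x = idx n y then \<rho> else 0)"
      using Q_range'[OF \<alpha>_in \<alpha>_in, OF idx_in(1)[OF N xy'(1)] idx_in(1)[OF N xy'(2)]] \<rho>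
      by (auto simp: abs_mult mult_left_le)
    also have "\<dots> \<le> \<rho> * (\<Sum>b\<in>{1..n}. indicator (cell n b \<times> cell n b) (x, y))"
    proof (cases "idx n x = idx n y")
      case True
      have "(1::real) = indicator (cell n (idx n x) \<times> cell n (idx n x)) (x, y)"
        using idx_in(2)[OF n xy'(1)] idx_in(2)[OF n xy'(2)] True by simp
      also have "\<dots> \<le> (\<Sum>b\<in>{1..n}. indicator (cell n b \<times> cell n b) (x, y))"
        using idx_in(1)[OF n xy'(1)] by (intro member_le_sum[where f = "\<lambda>b. indicator (cell n b \<times> cell n b) (x, y)"]) auto
      finally show ?thesis using True \<rho> by (simp add: mult_le_cancel_left1)
    qed (use \<rho> in \<open>auto intro!: mult_nonneg_nonneg sum_nonneg\<close>)
    also have "\<dots> \<le> h (x, y)" unfolding h_def using \<rho> by auto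
    finally show ?thesis .
  qed
  have "cut_norm D \<le> \<rho> * (1 / n + 4 * \<delta> + G)"
  proof (rule cut_norm_le)
    fix S T :: "real set"
    assume S: "S \<in> sets lebesgue" "S \<subseteq> {0..1}" and T: "T \<in> sets lebesgue" "T \<subseteq> {0..1}"
    have "\<bar>LINT z:S \<times> T|lebesgue. D (fst z) (snd z)\<bar>
        \<le> \<bar>LINT z:S \<times> T|lebesgue. grid_fun N d z\<bar> + (\<integral>z. h z \<partial>lebesgue)"
      proof (rule set_integral_approx[OF Times_in_sets_lebesgue(1)[OF S(1) T(1)] grid_fun_integral(1)[OF N S T] h_int])
      fix z assume "z \<in> S \<times> T"
      then have "fst z \<in> {0..1}" "snd z \<in> {0..1}" using S T by auto
      from close[OF this] show "\<bar>D (fst z) (snd z) - grid_fun N d z\<bar> \<le> h z" by simp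
    qed (rule h0)
    moreover have "\<bar>LINT z:S \<times> T|lebesgue. grid_fun N d z\<bar> \<le> \<rho> * G"
    proof (rule grid_fun_integral(2)[OF N S T])
      fix s t :: "nat \<Rightarrow> real"
      assume st: "\<And>i. i \<in> {1..N} \<Longrightarrow> 0 \<le> s i \<and> s i \<le> 1" "\<And>i. i \<in> {1..N} \<Longrightarrow> 0 \<le> t i \<and> t i \<le> 1"
      have "(\<Sum>i\<in>{1..N}. \<Sum>j\<in>{1..N}. s i * t j * d i j)
          = \<rho> * (\<Sum>i\<in>{1..N}. \<Sum>j\<in>{1..N}. s i * t j * (Q (\<alpha> i) (\<alpha> j) - Q (\<beta> i) (\<beta> j)))"
        unfolding sum_distrib_left d_def by (intro sum.cong refl) (simp only: mult_ac)
      also have "\<bar>\<dots>\<bar> \<le> \<rho> * ((real N)\<^sup>2 * G)"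
        unfolding abs_mult abs_of_nonneg[OF \<rho>]
        by (rule mult_left_mono[OF _ \<rho>]) (use G[of s t] st in \<open>simp add: N_def \<alpha>_def \<beta>_def\<close>)
      finally show "\<bar>\<Sum>i\<in>{1..N}. \<Sum>j\<in>{1..N}. s i * t j * d i j\<bar> \<le> (real N)\<^sup>2 * (\<rho> * G)"
        by (simp only: mult_ac)
    qed
    ultimately show "\<bar>LINT z:S \<times> T|lebesgue. D (fst z) (snd z)\<bar> \<le> \<rho> * (1 / n + 4 * \<delta> + G)"
      using h_integral by (simp only: distrib_left)
  qed
  with distance_le_cut_norm[OF grid_perm_measure_preserving[OF N \<pi>N]] show ?thesis
    unfolding D_def \<tau>_def by linarith
qed

text \<open>The union of the cells labelled \<open>a\<close> and the class of \<open>a\<close>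
  differ only inside \<open>B\<close> and at the point 0.\<close>

lemma freq_approx_mass:
  assumes N: "0 < N" and B: "B \<in> sets lebesgue" "B \<subseteq> {0..1}" "measure lebesgue B \<le> \<delta>"
    and \<phi>\<psi>: "\<And>t. t \<in> {0<..1} - B \<Longrightarrow> \<phi> t = \<psi> (idx N t)" and a: "a \<in> I"
  shows "\<bar>freq {1..N} \<psi> a - mass a\<bar> \<le> \<delta>"
proof -
  define P where "P = {t \<in> {0..1}. \<phi> t = a}"
  define C where "C = (\<Union>i\<in>{i \<in> {1..N}. \<psi> i = a}. cell N i)"
  have P: "P \<in> lmeasurable" unfolding P_def by (rule lmeasurable_subset_unit(1)[OF classes[OF a]]) auto
  have Bm: "B \<in> lmeasurable" by (rule lmeasurable_subset_unit(1)[OF B(1,2)])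
  have Cm: "C \<in> lmeasurable" unfolding C_def by (intro fmeasurable.finite_UN) auto
  have "measure lebesgue C = (\<Sum>i\<in>{i \<in> {1..N}. \<psi> i = a}. measure lebesgue (cell N i))"
    unfolding C_def
  proof (rule measure_finite_Union)
    show "disjoint_family_on (cell N) {i \<in> {1..N}. \<psi> i = a}"
      unfolding disjoint_family_on_def by (intro ballI impI disjoint_cells[OF N]) auto
    show "cell N ` {i \<in> {1..N}. \<psi> i = a} \<subseteq> sets lebesgue" using fmeasurableD[OF cell_lmeasurable] by auto
    show "emeasure lebesgue (cell N i) \<noteq> \<infinity>" for i using fmeasurableD2[OF cell_lmeasurable[of N i]] by simp
  qed auto
  also have "\<dots> = (\<Sum>i\<in>{i \<in> {1..N}. \<psi> i = a}. 1 / N)" by (intro sum.cong refl measure_cell[OF N]) auto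
  also have "\<dots> = freq {1..N} \<psi> a" by (simp add: freq_def)
  finally have mC: "measure lebesgue C = freq {1..N} \<psi> a" .
  have C_iff: "t \<in> C \<longleftrightarrow> \<psi> (idx N t) = a" if "t \<in> {0<..1}" for t
    using idx_in[OF N that] idx_eq_iff[OF N, of _ t] by (auto simp: C_def)
  have C_sub: "C \<subseteq> {0<..1}" using cell_subset[OF N] by (auto simp: C_def)
  have sub: "P \<subseteq> C \<union> (B \<union> {0})" "C \<subseteq> P \<union> B"
  proof -
    show "C \<subseteq> P \<union> B"
    proof
      fix t assume t: "t \<in> C"
      then have "t \<in> {0<..1}" using C_sub by blast
      then show "t \<in> P \<union> B" using C_iff[of t] t \<phi>\<psi>[of t] by (auto simp: P_def)
    qed
    show "P \<subseteq> C \<union> (B \<union> {0})"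
    proof
      fix t assume t: "t \<in> P"
      show "t \<in> C \<union> (B \<union> {0})"
      proof (cases "t \<in> {0<..1}")
        case True
        then show ?thesis using C_iff[of t] t \<phi>\<psi>[of t] by (auto simp: P_def)
      qed (use t in \<open>auto simp: P_def\<close>)
    qed
  qed
  have "{0::real} \<in> null_sets lebesgue" by (auto intro: null_sets_completionI)
  then have B0: "measure lebesgue (B \<union> {0}) = measure lebesgue B"
    by (rule measure_Un_null_set[OF B(1)])
  have B0m: "B \<union> {0} \<in> lmeasurable" by (rule fmeasurable.Un[OF Bm lmeasurable_compact]) simp
  have "measure lebesgue P \<le> measure lebesgue (C \<union> (B \<union> {0}))"
    by (rule measure_mono_fmeasurable[OF sub(1) fmeasurableD[OF P] fmeasurable.Un[OF Cm B0m]])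
  also have "\<dots> \<le> measure lebesgue C + measure lebesgue (B \<union> {0})"
    by (rule measure_Un_le[OF fmeasurableD[OF Cm] fmeasurableD[OF B0m]])
  finally have 1: "measure lebesgue P \<le> measure lebesgue C + \<delta>" using B0 B(3) by linarith
  have "measure lebesgue C \<le> measure lebesgue (P \<union> B)"
    by (rule measure_mono_fmeasurable[OF sub(2) fmeasurableD[OF Cm] fmeasurable.Un[OF P Bm]])
  also have "\<dots> \<le> measure lebesgue P + measure lebesgue B"
    by (rule measure_Un_le[OF fmeasurableD[OF P] B(1)])
  finally have 2: "measure lebesgue C \<le> measure lebesgue P + \<delta>" using B(3) by linarith
  show ?thesis using 1 2 unfolding mC P_def by linarith
qed

text \<open>Grid and permutation depend on \<open>\<delta>\<close>, and the label frequencies of the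
  grid only approximate the masses. The distance is a fixed number below all resulting bounds, so
  \<open>\<delta>\<close> can tend to 0 and continuity of \<open>G\<close> yields the bound at the
  masses.\<close>

theorem distance_le:
  assumes grid: "\<And>r \<psi>. \<lbrakk>0 < r; \<psi> ` {1..n * r} \<subseteq> I\<rbrakk> \<Longrightarrow> \<exists>\<pi>. \<pi> permutes {1..n * r} \<and>
      (\<forall>s t. (\<forall>i\<in>{1..n * r}. 0 \<le> s i \<and> s i \<le> (1::real)) \<longrightarrow> (\<forall>i\<in>{1..n * r}. 0 \<le> t i \<and> t i \<le> (1::real)) \<longrightarrow>
        \<bar>\<Sum>i\<in>{1..n * r}. \<Sum>j\<in>{1..n * r}. s i * t j *
          (Q (\<phi> (\<xi> (blk r i))) (\<phi> (\<xi> (blk r j))) - Q (\<psi> (\<pi> i)) (\<psi> (\<pi> j)))\<bar>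
          \<le> (real (n * r))\<^sup>2 * G (freq {1..n * r} \<psi>))"
    and G: "\<And>\<mu>. (\<And>a. a \<in> I \<Longrightarrow> (\<lambda>k. \<mu> k a) \<longlonglongrightarrow> mass a) \<Longrightarrow> (\<lambda>k::nat. G (\<mu> k)) \<longlonglongrightarrow> G mass"
  shows "distance \<le> \<rho> * (1 / n + G mass)"
proof -
  have ex: "\<exists>\<mu>. (\<forall>a\<in>I. \<bar>\<mu> a - mass a\<bar> \<le> \<delta>) \<and> distance \<le> \<rho> * (1 / n + 4 * \<delta> + G \<mu>)" if \<delta>: "0 < \<delta>" for \<delta>
  proof -
    obtain r \<psi> B where r: "0 < r" and \<psi>: "\<psi> ` {1..n * r} \<subseteq> I"
      and B: "B \<in> sets lebesgue" "B \<subseteq> {0..1}" "measure lebesgue B \<le> \<delta>"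
      and \<phi>\<psi>: "\<And>t. t \<in> {0<..1} - B \<Longrightarrow> \<phi> t = \<psi> (idx (n * r) t)"
      by (rule grid_labelling[OF finite_labels labels classes n \<delta>], assumption) (rule that; assumption)
    obtain \<pi> where \<pi>: "\<pi> permutes {1..n * r}"
      and G0: "\<forall>s t. (\<forall>i\<in>{1..n * r}. 0 \<le> s i \<and> s i \<le> (1::real)) \<longrightarrow> (\<forall>i\<in>{1..n * r}. 0 \<le> t i \<and> t i \<le> (1::real)) \<longrightarrow>
        \<bar>\<Sum>i\<in>{1..n * r}. \<Sum>j\<in>{1..n * r}. s i * t j *
          (Q (\<phi> (\<xi> (blk r i))) (\<phi> (\<xi> (blk r j))) - Q (\<psi> (\<pi> i)) (\<psi> (\<pi> j)))\<bar>
          \<le> (real (n * r))\<^sup>2 * G (freq {1..n * r} \<psi>)"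
      using grid[OF r \<psi>] by (elim exE conjE) (rule that)
    have G': "\<bar>\<Sum>i\<in>{1..n * r}. \<Sum>j\<in>{1..n * r}. s i * t j *
        (Q (\<phi> (\<xi> (blk r i))) (\<phi> (\<xi> (blk r j))) - Q (\<psi> (\<pi> i)) (\<psi> (\<pi> j)))\<bar> \<le> (real (n * r))\<^sup>2 * G (freq {1..n * r} \<psi>)"
      if "\<And>i. i \<in> {1..n * r} \<Longrightarrow> 0 \<le> s i \<and> s i \<le> (1::real)" "\<And>i. i \<in> {1..n * r} \<Longrightarrow> 0 \<le> t i \<and> t i \<le> (1::real)" for s t
      by (rule G0[THEN spec, THEN spec, THEN mp, THEN mp]) (intro ballI that, assumption)+
    have "distance \<le> \<rho> * (1 / n + 4 * \<delta> + G (freq {1..n * r} \<psi>))"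
      by (rule distance_grid_bound[OF r \<psi> B \<phi>\<psi> \<pi> G'])
    moreover have "\<forall>a\<in>I. \<bar>freq {1..n * r} \<psi> a - mass a\<bar> \<le> \<delta>"
      using freq_approx_mass[OF _ B \<phi>\<psi>] n r by simp
    ultimately show ?thesis by blast
  qed
  have "\<forall>k::nat. \<exists>\<mu>. (\<forall>a\<in>I. \<bar>\<mu> a - mass a\<bar> \<le> 1 / Suc k) \<and> distance \<le> \<rho> * (1 / n + 4 * (1 / Suc k) + G \<mu>)"
    by (intro allI, rule ex) simp
  then obtain \<mu> where \<mu>': "\<forall>k::nat. (\<forall>a\<in>I. \<bar>\<mu> k a - mass a\<bar> \<le> 1 / Suc k) \<and> distance \<le> \<rho> * (1 / n + 4 * (1 / Suc k) + G (\<mu> k))"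
    by (rule exE[OF choice])
  then have \<mu>: "\<forall>a\<in>I. \<bar>\<mu> k a - mass a\<bar> \<le> 1 / Suc k"
    and dist: "distance \<le> \<rho> * (1 / n + 4 * (1 / Suc k) + G (\<mu> k))" for k by blast+
  have inv0: "(\<lambda>k. 1 / real (Suc k)) \<longlonglongrightarrow> 0"
    using LIMSEQ_inverse_real_of_nat by (simp add: inverse_eq_divide)
  have "(\<lambda>k. \<mu> k a) \<longlonglongrightarrow> mass a" if "a \<in> I" for a
  proof (rule LIM_zero_cancel, rule tendsto_rabs_zero_cancel, rule tendsto_sandwich[OF _ _ tendsto_const inv0])
    show "\<forall>\<^sub>F k in sequentially. 0 \<le> \<bar>\<mu> k a - mass a\<bar>" by simp
    show "\<forall>\<^sub>F k in sequentially. \<bar>\<mu> k a - mass a\<bar> \<le> 1 / real (Suc k)" using \<mu> that by simp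
  qed
  then have lim: "(\<lambda>k. G (\<mu> k)) \<longlonglongrightarrow> G mass" by (rule G)
  have "(\<lambda>k. \<rho> * (1 / n + 4 * (1 / Suc k) + G (\<mu> k))) \<longlonglongrightarrow> \<rho> * (1 / n + 4 * 0 + G mass)"
    by (rule tendsto_mult[OF tendsto_const tendsto_add[OF tendsto_add[OF tendsto_const tendsto_mult[OF tendsto_const inv0]] lim]])
  then have "distance \<le> \<rho> * (1 / n + 4 * 0 + G mass)"
    by (rule LIMSEQ_le_const) (use dist in blast)
  then show ?thesis by simp
qed

end

section \<open>Measurable labellings\<close>

text \<open>Lebesgue measurability on the square controls only almost every section. A Borel version
  of \<open>W\<close> has Borel sections, and by Fubini almost all of them agree with those of
  \<open>W\<close> almost everywhere.\<close>

lemma graphon_sections: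
  assumes "W \<in> graphons"
  obtains N where "N \<in> null_sets lebesgue"
    "\<And>x c. x \<in> {0..1} - N \<Longrightarrow> {y \<in> {0..1}. W x y = c} \<in> sets lebesgue"
proof -
  define U where "U = {0..1::real} \<times> {0..1::real}"
  define F where "F z = (if z \<in> U then (case z of (x, y) \<Rightarrow> W x y) else 0)" for z
  have U: "U \<in> sets lebesgue" unfolding U_def by (rule Times_in_sets_lebesgue) auto
  have "(\<lambda>(x, y). W x y) \<in> borel_measurable (lebesgue_on U)"
    using assms by (simp add: graphons_def U_def)
  then have "F \<in> borel_measurable lebesgue"
    using borel_measurable_if[OF U, of "\<lambda>(x, y). W x y"] unfolding F_def by simp
  then obtain g where g: "g \<in> borel_measurable lborel" "AE z in lborel. F z = g z"
    using completion_ex_borel_measurable_real by blast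
  have "AE z in lborel \<Otimes>\<^sub>M lborel. F z = g z" using g(2) unfolding lborel_prod .
  then have "AE x in lborel. AE y in lborel. F (x, y) = g (x, y)" by (rule lborel_pair.AE_pair)
  then obtain N where N: "{x \<in> space lborel. \<not> (AE y in lborel. F (x, y) = g (x, y))} \<subseteq> N"
    "emeasure lborel N = 0" "N \<in> sets lborel" by (rule AE_E)
  have "N \<in> null_sets lebesgue" using N(2,3) by (intro null_sets_completionI) (simp add: null_sets_def)
  moreover have "{y \<in> {0..1}. W x y = c} \<in> sets lebesgue" if x: "x \<in> {0..1} - N" for x c
  proof -
    have "AE y in lborel. F (x, y) = g (x, y)" using N(1) x by auto
    then have ae: "AE y in lebesgue. g (x, y) = F (x, y)"
      by (intro AE_completion) (auto elim: eventually_mono)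
    have "g \<in> borel_measurable borel" using g(1) by simp
    then have "(\<lambda>y. g (x, y)) \<in> borel_measurable borel" by measurable
    then have "(\<lambda>y. g (x, y)) \<in> borel_measurable lebesgue" by (intro measurable_completion) simp
    then have "(\<lambda>y. F (x, y)) \<in> borel_measurable lebesgue" using ae by (rule borel_measurable_AE)
    then have "(\<lambda>y. F (x, y)) -` {c} \<inter> space lebesgue \<in> sets lebesgue" by (rule measurable_sets) simp
    then have "((\<lambda>y. F (x, y)) -` {c} \<inter> space lebesgue) \<inter> {0..1} \<in> sets lebesgue" by (rule sets.Int) simp
    moreover have "((\<lambda>y. F (x, y)) -` {c} \<inter> space lebesgue) \<inter> {0..1} = {y \<in> {0..1}. W x y = c}"
      using x by (auto simp: F_def U_def)
    ultimately show ?thesis by simp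
  qed
  ultimately show thesis by (rule that)
qed

text \<open>The given labelling need not be measurable. Labels whose rows agree on all labels of
  non-negligible type are merged; this changes the graphon only on a null set.\<close>

lemma measurable_labelling:
  assumes "W \<in> step_graphons k"
  obtains I :: "nat set" and \<phi> Q Z where
    "finite I" "card I \<le> k" "\<phi> ` {0..1} \<subseteq> I"
    "\<And>a. a \<in> I \<Longrightarrow> {t \<in> {0..1}. \<phi> t = a} \<in> sets lebesgue"
    "\<And>a. a \<in> I \<Longrightarrow> 0 < measure lebesgue {t \<in> {0..1}. \<phi> t = a}"
    "Z \<in> null_sets lebesgue" "Z \<subseteq> {0..1}"
    "\<And>x y. x \<in> {0..1} - Z \<Longrightarrow> y \<in> {0..1} - Z \<Longrightarrow> W x y = Q (\<phi> x) (\<phi> y)"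
    "\<And>a b. a \<in> I \<Longrightarrow> b \<in> I \<Longrightarrow> Q a b = Q b a"
    "\<And>a b. a \<in> I \<Longrightarrow> b \<in> I \<Longrightarrow> 0 \<le> Q a b \<and> Q a b \<le> (1::real)"
proof -
  obtain Q :: "nat \<Rightarrow> nat \<Rightarrow> real" and \<phi>0 :: "real \<Rightarrow> nat" where W: "W \<in> graphons"
    and Q: "\<forall>a\<in>{1..k}. \<forall>b\<in>{1..k}. Q a b = Q b a \<and> 0 \<le> Q a b \<and> Q a b \<le> 1"
    and \<phi>0: "\<phi>0 ` {0..1} \<subseteq> {1..k}" and WQ: "\<forall>x\<in>{0..1}. \<forall>y\<in>{0..1}. W x y = Q (\<phi>0 x) (\<phi>0 y)"
    using assms unfolding step_graphons_def by blast
  obtain N where N: "N \<in> null_sets lebesgue"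
    and sec: "\<And>x c. x \<in> {0..1} - N \<Longrightarrow> {y \<in> {0..1}. W x y = c} \<in> sets lebesgue"
    by (rule graphon_sections[OF W]) (rule that)
  \<comment> \<open>Labels that occur at a point with measurable sections. For such a label
    \<open>b\<close>, the column y -> \<open>Q (\<phi>0 y) b\<close> is a section of
    \<open>W\<close>.\<close>
  define H where "H = \<phi>0 ` ({0..1} - N)"
  have H: "H \<subseteq> {1..k}" using \<phi>0 by (auto simp: H_def)
  have finH: "finite H" using H finite_subset by blast
  have Q_sym: "Q a b = Q b a" if "a \<in> H" "b \<in> H" for a b using Q H that by blast
  have sec_Q: "{y \<in> {0..1}. Q (\<phi>0 y) b = c} \<in> sets lebesgue" if b: "b \<in> H" for b c
  proof -
    obtain x where x: "x \<in> {0..1} - N" "b = \<phi>0 x" using b by (auto simp: H_def)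
    have "W x y = Q (\<phi>0 y) b" if "y \<in> {0..1}" for y
    proof -
      have "\<phi>0 x \<in> {1..k}" "\<phi>0 y \<in> {1..k}" using subsetD[OF \<phi>0 imageI] x that by blast+
      then show ?thesis using WQ Q x that by auto
    qed
    then have "{y \<in> {0..1}. Q (\<phi>0 y) b = c} = {y \<in> {0..1}. W x y = c}" by auto
    then show ?thesis using sec[OF x(1)] by simp
  qed
  \<comment> \<open>Labels whose rows agree on \<open>H\<close> are merged; the least of them is a
    canonical representative. Its class is cut out by finitely many measurable columns.\<close>
  define twins where "twins a = {a' \<in> H. \<forall>b\<in>H. Q a' b = Q a b}" for a
  define rep where "rep a = Min (twins a)" for a
  have rep: "rep a \<in> H" "\<And>b. b \<in> H \<Longrightarrow> Q (rep a) b = Q a b" if "a \<in> H" for a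
  proof -
    have "finite (twins a)" "a \<in> twins a" using finH that by (auto simp: twins_def)
    then have "rep a \<in> twins a" unfolding rep_def by (intro Min_in) auto
    then show "rep a \<in> H" "\<And>b. b \<in> H \<Longrightarrow> Q (rep a) b = Q a b" by (auto simp: twins_def)
  qed
  have rep_eq: "rep a = rep a'" if "\<And>b. b \<in> H \<Longrightarrow> Q a b = Q a' b" for a a'
  proof -
    have "twins a = twins a'" using that by (auto simp: twins_def)
    then show ?thesis by (simp add: rep_def)
  qed
  define P where "P a = {x \<in> {0..1} - N. rep (\<phi>0 x) = a}" for a
  have unitN: "{0..1} - N \<in> sets lebesgue" using null_setsD2[OF N] by auto
  have P_sets: "P a \<in> sets lebesgue" if a: "a \<in> rep ` H" for a
  proof -
    obtain a0 where a0: "a0 \<in> H" "a = rep a0" using a by blast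
    have iff: "rep (\<phi>0 x) = a \<longleftrightarrow> (\<forall>b\<in>H. Q (\<phi>0 x) b = Q a b)" if x: "x \<in> {0..1} - N" for x
    proof -
      have xH: "\<phi>0 x \<in> H" using x by (auto simp: H_def)
      have "rep a = a"
        unfolding a0(2) by (rule rep_eq) (use rep[OF a0(1)] in simp)
      then show ?thesis using rep(2)[OF xH] rep_eq[of "\<phi>0 x" a] by auto
    qed
    have H0: "H \<noteq> {}" using a0 by auto
    have "P a = ({0..1} - N) \<inter> (\<Inter>b\<in>H. {x \<in> {0..1}. Q (\<phi>0 x) b = Q a b})"
      using iff H0 by (auto simp: P_def)
    also have "\<dots> \<in> sets lebesgue"
      by (rule sets.Int[OF unitN], rule sets.finite_INT[OF finH H0], rule sec_Q)
    finally show ?thesis .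
  qed
  have P_lm: "P a \<in> lmeasurable" if "a \<in> rep ` H" for a
    by (rule lmeasurable_subset_unit(1)[OF P_sets[OF that]]) (auto simp: P_def)
  define I where "I = {a \<in> rep ` H. 0 < measure lebesgue (P a)}"
  \<comment> \<open>Classes of measure 0 are discarded into \<open>Z\<close>, because the weights of
    the remaining labels must be positive.\<close>
  define Z where "Z = ({0..1} \<inter> N) \<union> (\<Union>a\<in>rep ` H - I. P a)"
  have finI: "finite I" using finH by (simp add: I_def)
  have "card I \<le> card (rep ` H)" using finH by (intro card_mono) (auto simp: I_def)
  also have "\<dots> \<le> card H" by (rule card_image_le[OF finH])
  also have "\<dots> \<le> k" using card_mono[OF _ H] by simp
  finally have cardI: "card I \<le> k" .
  have P_null: "P a \<in> null_sets lebesgue" if "a \<in> rep ` H - I" for a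
  proof -
    have "measure lebesgue (P a) = 0" using that by (auto simp: I_def less_le)
    then show ?thesis using P_lm[of a] that measure_eq_0_null_sets
      by (simp add: null_sets_def emeasure_eq_measure2 fmeasurableD)
  qed
  have "{0..1} \<inter> N \<in> null_sets lebesgue" using N by (rule null_sets_completion_subset[rotated]) auto
  moreover have "(\<Union>a\<in>rep ` H - I. P a) \<in> null_sets lebesgue"
    using finH P_null by (intro null_sets_UN') (auto intro: countable_finite)
  ultimately have Z: "Z \<in> null_sets lebesgue" unfolding Z_def by (rule null_sets.Un)
  have Z_sub: "Z \<subseteq> {0..1}" by (auto simp: Z_def P_def)
  have unit_not_null: "\<not> {0..1::real} \<subseteq> Z"
  proof
    assume "{0..1::real} \<subseteq> Z"
    then have "{0..1::real} \<in> null_sets lebesgue" using null_sets_completion_subset[OF _ Z] by blast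
    then show False by (auto simp: null_sets_def)
  qed
  have in_I: "rep (\<phi>0 x) \<in> I" "\<phi>0 x \<in> H" if "x \<in> {0..1} - Z" for x
    using that by (auto simp: Z_def P_def H_def)
  obtain x1 where "x1 \<in> {0..1} - Z" using unit_not_null by blast
  then obtain a1 where a1: "a1 \<in> I" using in_I by blast
  \<comment> \<open>On the null set \<open>Z\<close> the value is arbitrary; \<open>a1\<close> makes
    the labelling total with values in \<open>I\<close>.\<close>
  define \<phi> where "\<phi> x = (if x \<in> {0..1} - Z then rep (\<phi>0 x) else a1)" for x
  have PI: "P a \<inter> Z = {}" if "a \<in> I" for a using that by (auto simp: Z_def P_def)
  have class_eq: "{t \<in> {0..1}. \<phi> t = a} = P a \<union> (if a = a1 then Z else {})" if "a \<in> I" for a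
  proof -
    have "t \<in> {0..1} - Z \<and> rep (\<phi>0 t) = a \<longleftrightarrow> t \<in> P a" for t
      using PI[OF that] by (auto simp: P_def Z_def)
    then show ?thesis using Z_sub a1 by (auto simp: \<phi>_def)
  qed
  have cls: "{t \<in> {0..1}. \<phi> t = a} \<in> sets lebesgue" if "a \<in> I" for a
    unfolding class_eq[OF that] using P_sets[of a] that null_setsD2[OF Z] by (auto simp: I_def)
  show thesis
  proof (rule that[of I \<phi> Z Q])
    show "\<phi> ` {0..1} \<subseteq> I" using in_I(1) a1 by (auto simp: \<phi>_def)
    show "0 < measure lebesgue {t \<in> {0..1}. \<phi> t = a}" if "a \<in> I" for a
    proof -
      have "measure lebesgue (P a) \<le> measure lebesgue {t \<in> {0..1}. \<phi> t = a}"
      proof (rule measure_mono_fmeasurable)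
        show "P a \<subseteq> {t \<in> {0..1}. \<phi> t = a}" unfolding class_eq[OF that] by blast
        show "P a \<in> sets lebesgue" using P_sets[of a] that by (simp add: I_def)
        show "{t \<in> {0..1}. \<phi> t = a} \<in> lmeasurable" by (rule lmeasurable_subset_unit(1)[OF cls[OF that]]) auto
      qed
      then show ?thesis using that by (simp add: I_def)
    qed
    fix x y assume xy: "x \<in> {0..1} - Z" "y \<in> {0..1} - Z"
    have x: "\<phi>0 x \<in> H" and y: "\<phi>0 y \<in> H" using in_I xy by auto
    have "W x y = Q (\<phi>0 x) (\<phi>0 y)" using WQ xy by auto
    \<comment> \<open>Representatives are known to agree in the first argument only, so symmetry is
      used to replace the second.\<close>
    also have "\<dots> = Q (rep (\<phi>0 x)) (\<phi>0 y)" using rep(2)[OF x y] by simp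
    also have "\<dots> = Q (\<phi>0 y) (rep (\<phi>0 x))" by (rule Q_sym[OF rep(1)[OF x] y])
    also have "\<dots> = Q (rep (\<phi>0 y)) (rep (\<phi>0 x))" using rep(2)[OF y rep(1)[OF x]] by simp
    also have "\<dots> = Q (rep (\<phi>0 x)) (rep (\<phi>0 y))" by (rule Q_sym[OF rep(1)[OF y] rep(1)[OF x]])
    finally show "W x y = Q (\<phi> x) (\<phi> y)" using xy by (simp add: \<phi>_def)
  next
    fix a b assume "a \<in> I" "b \<in> I"
    then have ab: "a \<in> H" "b \<in> H" using rep(1) by (auto simp: I_def)
    show "Q a b = Q b a" by (rule Q_sym[OF ab])
    show "0 \<le> Q a b \<and> Q a b \<le> 1" using Q H ab by blast
  qed (use finI cardI cls Z Z_sub in auto)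
qed

section \<open>Expectations and conclusion\<close>

text \<open>A function of finitely many labels is a finite sum of products of class indicators,
  whose integrals factor. This identifies the integral over the sample with the weighted sum
  \<open>expec\<close>.\<close>

lemma integral_of_labels:
  fixes f :: "(nat \<Rightarrow> 'a) \<Rightarrow> real" and n :: nat
  assumes I: "finite I" and \<phi>: "\<phi> ` {0..1} \<subseteq> I"
    and meas: "\<And>a. a \<in> I \<Longrightarrow> {t \<in> {0..1}. \<phi> t = a} \<in> sets lebesgue"
  defines "M \<equiv> PiM {1..n} (\<lambda>_::nat. lebesgue_on {0..1::real})"
  shows "integrable M (\<lambda>\<xi>. f (\<lambda>i\<in>{1..n}. \<phi> (\<xi> i)))"
    and "(\<integral>\<xi>. f (\<lambda>i\<in>{1..n}. \<phi> (\<xi> i)) \<partial>M)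
      = (\<Sum>x\<in>{1..n} \<rightarrow>\<^sub>E I. (\<Prod>i\<in>{1..n}. measure lebesgue {t \<in> {0..1}. \<phi> t = x i}) * f x)"
proof -
  let ?L = "lebesgue_on {0..1::real}"
  let ?J = "{1..n}"
  interpret prob_space ?L
    by (rule prob_spaceI) (simp add: emeasure_restrict_space space_restrict_space)
  interpret product_sigma_finite "\<lambda>_::nat. ?L" by standard
  define P where "P a = {t \<in> {0..1}. \<phi> t = a}" for a
  have P: "P a \<in> sets ?L" "measure ?L (P a) = measure lebesgue (P a)" if "a \<in> I" for a
  proof -
    show "P a \<in> sets ?L" using meas[OF that] by (auto simp: P_def sets_restrict_space_iff)
    show "measure ?L (P a) = measure lebesgue (P a)"
      by (rule measure_restrict_space) (auto simp: P_def)
  qed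
  have ind: "integrable ?L (indicator (P a) :: real \<Rightarrow> real)" if "a \<in> I" for a
    using P[OF that] by (intro integrable_real_indicator) (auto simp: emeasure_eq_measure)
  have int: "integrable M (\<lambda>\<xi>. (\<Prod>i\<in>?J. indicator (P (x i)) (\<xi> i)) * f x)"
    "(\<integral>\<xi>. (\<Prod>i\<in>?J. indicator (P (x i)) (\<xi> i)) * f x \<partial>M) = (\<Prod>i\<in>?J. measure lebesgue (P (x i))) * f x"
    if x: "x \<in> ?J \<rightarrow>\<^sub>E I" for x
  proof -
    have xI: "x i \<in> I" if "i \<in> ?J" for i using x that by auto
    show "integrable M (\<lambda>\<xi>. (\<Prod>i\<in>?J. indicator (P (x i)) (\<xi> i)) * f x)"
      unfolding M_def by (intro integrable_mult_left product_integrable_prod ind xI) auto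
    have "(\<integral>\<xi>. (\<Prod>i\<in>?J. indicator (P (x i)) (\<xi> i) :: real) \<partial>M) = (\<Prod>i\<in>?J. (\<integral>t. indicator (P (x i)) t \<partial>?L))"
      unfolding M_def by (intro product_integral_prod ind xI) auto
    also have "\<dots> = (\<Prod>i\<in>?J. measure lebesgue (P (x i)))"
    proof (rule prod.cong[OF refl])
      fix i assume "i \<in> ?J"
      moreover have "P (x i) \<inter> {0..1} = P (x i)" by (auto simp: P_def)
      ultimately show "(\<integral>t. indicator (P (x i)) t \<partial>?L) = measure lebesgue (P (x i))"
        using P(2)[OF xI] by (simp add: space_restrict_space)
    qed
    finally show "(\<integral>\<xi>. (\<Prod>i\<in>?J. indicator (P (x i)) (\<xi> i)) * f x \<partial>M) = (\<Prod>i\<in>?J. measure lebesgue (P (x i))) * f x"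
      by simp
  qed
  have expand: "f (\<lambda>i\<in>?J. \<phi> (\<xi> i)) = (\<Sum>x\<in>?J \<rightarrow>\<^sub>E I. (\<Prod>i\<in>?J. indicator (P (x i)) (\<xi> i)) * f x)"
    if "\<xi> \<in> space M" for \<xi>
  proof -
    define y where "y = (\<lambda>i\<in>?J. \<phi> (\<xi> i))"
    have \<xi>: "\<xi> i \<in> {0..1}" if "i \<in> ?J" for i
      using \<open>\<xi> \<in> space M\<close> that by (auto simp: M_def space_PiM PiE_iff space_restrict_space)
    then have y: "y \<in> ?J \<rightarrow>\<^sub>E I" using \<phi> unfolding y_def by (intro restrict_PiE_iff[THEN iffD2]) auto
    have "(\<Prod>i\<in>?J. indicator (P (x i)) (\<xi> i)) = (if x = y then 1 else (0::real))" if x: "x \<in> ?J \<rightarrow>\<^sub>E I" for x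
    proof (cases "x = y")
      case True
      then show ?thesis using \<xi> by (auto simp: P_def y_def intro!: prod.neutral)
    next
      case False
      then obtain i where "i \<in> ?J" "x i \<noteq> y i" using x y by (metis PiE_ext)
      then have "indicator (P (x i)) (\<xi> i) = (0::real)" by (simp add: P_def y_def indicator_def)
      then have "(\<Prod>i\<in>?J. indicator (P (x i)) (\<xi> i)) = (0::real)"
        using \<open>i \<in> ?J\<close> by (intro prod_zero bexI[of _ i]) auto
      then show ?thesis using False by simp
    qed
    then have "(\<Sum>x\<in>?J \<rightarrow>\<^sub>E I. (\<Prod>i\<in>?J. indicator (P (x i)) (\<xi> i)) * f x) = (\<Sum>x\<in>?J \<rightarrow>\<^sub>E I. if x = y then f x else 0)"
      by (intro sum.cong refl) auto
    also have "\<dots> = f y" using y I by (simp add: finite_PiE)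
    finally show ?thesis by (simp add: y_def)
  qed
  have "integrable M (\<lambda>\<xi>. \<Sum>x\<in>?J \<rightarrow>\<^sub>E I. (\<Prod>i\<in>?J. indicator (P (x i)) (\<xi> i)) * f x)"
    by (intro Bochner_Integration.integrable_sum int)
  then show "integrable M (\<lambda>\<xi>. f (\<lambda>i\<in>?J. \<phi> (\<xi> i)))"
    by (subst Bochner_Integration.integrable_cong[OF refl expand]) auto
  have "(\<integral>\<xi>. f (\<lambda>i\<in>?J. \<phi> (\<xi> i)) \<partial>M) = (\<integral>\<xi>. (\<Sum>x\<in>?J \<rightarrow>\<^sub>E I. (\<Prod>i\<in>?J. indicator (P (x i)) (\<xi> i)) * f x) \<partial>M)"
    by (rule Bochner_Integration.integral_cong[OF refl expand])
  also have "\<dots> = (\<Sum>x\<in>?J \<rightarrow>\<^sub>E I. (\<Prod>i\<in>?J. measure lebesgue (P (x i))) * f x)"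
    by (subst Bochner_Integration.integral_sum, rule int(1), assumption, intro sum.cong refl int(2))
  finally show "(\<integral>\<xi>. f (\<lambda>i\<in>?J. \<phi> (\<xi> i)) \<partial>M)
      = (\<Sum>x\<in>?J \<rightarrow>\<^sub>E I. (\<Prod>i\<in>?J. measure lebesgue {t \<in> {0..1}. \<phi> t = x i}) * f x)"
    by (simp only: P_def)
qed

text \<open>\<open>D\<close> is compared with a function of the labels off a null set of samples. If
  \<open>D\<close> is not integrable, its integral is 0 by convention and \<open>0 \<le> C\<close>
  suffices.\<close>

lemma uniform_sample_bound:
  fixes f :: "(nat \<Rightarrow> 'a) \<Rightarrow> real" and D :: "(nat \<Rightarrow> real) \<Rightarrow> real"
  assumes I: "finite I" and \<phi>: "\<phi> ` {0..1} \<subseteq> I"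
    and meas: "\<And>a. a \<in> I \<Longrightarrow> {t \<in> {0..1}. \<phi> t = a} \<in> sets lebesgue"
    and Z: "Z \<in> null_sets lebesgue"
    and D: "\<And>\<xi>. (\<And>i. i \<in> {1..n} \<Longrightarrow> \<xi> i \<in> {0..1} - Z) \<Longrightarrow> D \<xi> \<le> f (\<lambda>i\<in>{1..n}. \<phi> (\<xi> i))"
    and bound: "(\<Sum>x\<in>{1..n} \<rightarrow>\<^sub>E I. (\<Prod>i\<in>{1..n}. measure lebesgue {t \<in> {0..1}. \<phi> t = x i}) * f x) \<le> C" "0 \<le> C"
  shows "(\<integral>\<xi>. D \<xi> \<partial>uniform_sample n) \<le> C"
proof (cases "integrable (uniform_sample n) D")
  case True
  let ?L = "lebesgue_on {0..1::real}"
  let ?M = "PiM {1..n} (\<lambda>_::nat. ?L)"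
  let ?g = "\<lambda>\<xi>. f (\<lambda>i\<in>{1..n}. \<phi> (\<xi> i))"
  have L: "prob_space ?L"
    by (rule prob_spaceI) (simp add: emeasure_restrict_space space_restrict_space)
  have int: "integrable ?M ?g" by (rule integral_of_labels(1)[OF I \<phi> meas])
  have "AE t in lebesgue. t \<in> {0..1} \<longrightarrow> t \<notin> Z" using AE_not_in[OF Z] by eventually_elim simp
  then have "AE t in ?L. t \<notin> Z" by (subst AE_restrict_space_iff) auto
  then have "AE \<xi> in ?M. \<forall>i\<in>{1..n}. \<xi> i \<notin> Z"
    by (intro AE_finite_allI AE_PiM_component[where P = "\<lambda>t. t \<notin> Z"] L) auto
  then have "AE \<xi> in ?M. D \<xi> \<le> ?g \<xi>"
  proof (rule AE_mp, intro AE_I2 impI)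
    fix \<xi> assume "\<xi> \<in> space ?M" "\<forall>i\<in>{1..n}. \<xi> i \<notin> Z"
    then show "D \<xi> \<le> ?g \<xi>"
      by (intro D) (auto simp: space_PiM PiE_iff space_restrict_space)
  qed
  then have ae: "AE \<xi> in uniform_sample n. D \<xi> \<le> ?g \<xi>" unfolding uniform_sample_def by (rule AE_completion)
  have g_meas: "?g \<in> borel_measurable ?M" using int by simp
  have "integrable (uniform_sample n) ?g"
    unfolding uniform_sample_def using int by (subst integrable_completion[OF g_meas])
  then have "(\<integral>\<xi>. D \<xi> \<partial>uniform_sample n) \<le> (\<integral>\<xi>. ?g \<xi> \<partial>uniform_sample n)"
    using True ae by (intro integral_mono_AE)
  also have "\<dots> = (\<integral>\<xi>. ?g \<xi> \<partial>?M)" unfolding uniform_sample_def by (rule integral_completion[OF g_meas])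
  also have "\<dots> \<le> C" using bound(1) by (simp only: integral_of_labels(2)[OF I \<phi> meas])
  finally show ?thesis .
next
  case False
  then show ?thesis using bound(2) by (simp add: not_integrable_integral_eq)
qed

section \<open>Invariance and continuity of the bounds\<close>

lemma freq_permute:
  assumes "\<pi> permutes J"
  shows "freq J (\<lambda>i. \<beta> (\<pi> i)) = freq J \<beta>"
proof
  fix a
  have "{i \<in> J. \<beta> i = a} = \<pi> ` {i \<in> J. \<beta> (\<pi> i) = a}"
    using permutes_image[OF assms] permutes_in_image[OF assms] by auto
  moreover have "inj_on \<pi> {i \<in> J. \<beta> (\<pi> i) = a}"
    using permutes_inj[OF assms] by (rule inj_on_subset) simp
  ultimately show "freq J (\<lambda>i. \<beta> (\<pi> i)) a = freq J \<beta> a" by (simp add: freq_def card_image)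
qed

lemma coarse_tendsto:
  assumes "\<And>a. a \<in> I \<Longrightarrow> (\<lambda>k. \<mu> k a) \<longlonglongrightarrow> \<nu> a"
  shows "(\<lambda>k. coarse I c (\<lambda>a. u a - \<mu> k a)) \<longlonglongrightarrow> coarse I c (\<lambda>a. u a - \<nu> a)"
  unfolding coarse_def
  by (intro tendsto_sum tendsto_rabs tendsto_diff tendsto_const assms) auto

context weighted_set
begin

lemma sqnorm_tendsto:
  assumes "\<And>a. a \<in> I \<Longrightarrow> (\<lambda>k. f k a) \<longlonglongrightarrow> g a"
  shows "(\<lambda>k. sqnorm (\<lambda>a. f k a / p a)) \<longlonglongrightarrow> sqnorm (\<lambda>a. g a / p a)"
  unfolding sqnorm_def
  by (intro tendsto_sum tendsto_mult tendsto_power tendsto_divide tendsto_const assms)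
    (auto dest: p_pos)

end

context regular_kernel
begin

lemma fine_bound_tendsto:
  assumes "\<And>a. a \<in> I \<Longrightarrow> (\<lambda>k. \<mu> k a) \<longlonglongrightarrow> \<nu> a"
  shows "(\<lambda>k. fine_bound u (\<mu> k)) \<longlonglongrightarrow> fine_bound u \<nu>"
  unfolding fine_bound_def
  by (intro tendsto_mult tendsto_add tendsto_const tendsto_real_sqrt sqnorm_tendsto tendsto_diff assms)

text \<open>Permuting the grid does not alter the frequencies of \<open>\<beta>\<close>. So the
  bounds depend on the grid labelling through its frequencies alone, as the limit in
  \<open>distance_le\<close> requires.\<close>

lemma exists_matching:
  assumes "finite J" "\<alpha> ` J \<subseteq> I" "\<beta> ` J \<subseteq> I"
  shows "\<exists>\<pi>. \<pi> permutes J \<and>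
      (\<forall>s t. (\<forall>i\<in>J. 0 \<le> s i \<and> s i \<le> (1::real)) \<longrightarrow> (\<forall>i\<in>J. 0 \<le> t i \<and> t i \<le> (1::real)) \<longrightarrow>
        \<bar>\<Sum>i\<in>J. \<Sum>j\<in>J. s i * t j * (Q (\<alpha> i) (\<alpha> j) - Q (\<beta> (\<pi> i)) (\<beta> (\<pi> j)))\<bar>
          \<le> (real (card J))\<^sup>2 * (2 * coarse I c (\<lambda>a. freq J \<alpha> a - freq J \<beta> a) + 2 * fine_bound (freq J \<alpha>) (freq J \<beta>)))"
    and "(\<And>x y. \<lbrakk>\<And>a. a \<in> I \<Longrightarrow> \<bar>x a\<bar> \<le> freq J \<alpha> a; \<And>a. a \<in> I \<Longrightarrow> \<bar>y a\<bar> \<le> freq J \<alpha> a\<rbrakk>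
        \<Longrightarrow> \<bar>\<Sum>a\<in>I. \<Sum>b\<in>I. x a * y b * R a b\<bar> \<le> F) \<Longrightarrow> \<exists>\<pi>. \<pi> permutes J \<and>
      (\<forall>s t. (\<forall>i\<in>J. 0 \<le> s i \<and> s i \<le> (1::real)) \<longrightarrow> (\<forall>i\<in>J. 0 \<le> t i \<and> t i \<le> (1::real)) \<longrightarrow>
        \<bar>\<Sum>i\<in>J. \<Sum>j\<in>J. s i * t j * (Q (\<alpha> i) (\<alpha> j) - Q (\<beta> (\<pi> i)) (\<beta> (\<pi> j)))\<bar>
          \<le> (real (card J))\<^sup>2 * (2 * coarse I c (\<lambda>a. freq J \<alpha> a - freq J \<beta> a) + (F + \<epsilon> * sqnorm (\<lambda>a. freq J \<beta> a / p a))))"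
proof -
  obtain \<pi> where \<pi>: "\<pi> permutes J"
    and fine: "\<And>i j. \<lbrakk>i \<in> J; j \<in> J; \<beta> (\<pi> i) \<noteq> \<alpha> i; \<beta> (\<pi> j) = \<alpha> i\<rbrakk> \<Longrightarrow> \<alpha> j = \<alpha> i"
    and crs: "\<And>i j. \<lbrakk>i \<in> J; j \<in> J; c (\<beta> (\<pi> i)) \<noteq> c (\<alpha> i); c (\<beta> (\<pi> j)) = c (\<alpha> i)\<rbrakk> \<Longrightarrow> c (\<alpha> j) = c (\<alpha> i)"
    by (rule optimal_matching[OF assms(1), of \<beta> \<alpha> c]) (rule that; assumption)
  have \<beta>\<pi>: "(\<lambda>i. \<beta> (\<pi> i)) ` J \<subseteq> I" using assms(3) permutes_in_image[OF \<pi>] by auto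
  show "\<exists>\<pi>. \<pi> permutes J \<and>
      (\<forall>s t. (\<forall>i\<in>J. 0 \<le> s i \<and> s i \<le> (1::real)) \<longrightarrow> (\<forall>i\<in>J. 0 \<le> t i \<and> t i \<le> (1::real)) \<longrightarrow>
        \<bar>\<Sum>i\<in>J. \<Sum>j\<in>J. s i * t j * (Q (\<alpha> i) (\<alpha> j) - Q (\<beta> (\<pi> i)) (\<beta> (\<pi> j)))\<bar>
          \<le> (real (card J))\<^sup>2 * (2 * coarse I c (\<lambda>a. freq J \<alpha> a - freq J \<beta> a) + 2 * fine_bound (freq J \<alpha>) (freq J \<beta>)))"
  proof (intro exI[of _ \<pi>] conjI allI impI \<pi>)
    fix s t assume "\<forall>i\<in>J. 0 \<le> s i \<and> s i \<le> (1::real)" "\<forall>i\<in>J. 0 \<le> t i \<and> t i \<le> (1::real)"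
    note st = this[rule_format]
    show "\<bar>\<Sum>i\<in>J. \<Sum>j\<in>J. s i * t j * (Q (\<alpha> i) (\<alpha> j) - Q (\<beta> (\<pi> i)) (\<beta> (\<pi> j)))\<bar>
          \<le> (real (card J))\<^sup>2 * (2 * coarse I c (\<lambda>a. freq J \<alpha> a - freq J \<beta> a) + 2 * fine_bound (freq J \<alpha>) (freq J \<beta>))"
      by (rule grid_bound_fine[OF assms(1,2) \<beta>\<pi> fine crs st, unfolded freq_permute[OF \<pi>, of \<beta>] of_nat_power])
  qed
  assume F: "\<And>x y. \<lbrakk>\<And>a. a \<in> I \<Longrightarrow> \<bar>x a\<bar> \<le> freq J \<alpha> a; \<And>a. a \<in> I \<Longrightarrow> \<bar>y a\<bar> \<le> freq J \<alpha> a\<rbrakk>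
        \<Longrightarrow> \<bar>\<Sum>a\<in>I. \<Sum>b\<in>I. x a * y b * R a b\<bar> \<le> F"
  show "\<exists>\<pi>. \<pi> permutes J \<and>
      (\<forall>s t. (\<forall>i\<in>J. 0 \<le> s i \<and> s i \<le> (1::real)) \<longrightarrow> (\<forall>i\<in>J. 0 \<le> t i \<and> t i \<le> (1::real)) \<longrightarrow>
        \<bar>\<Sum>i\<in>J. \<Sum>j\<in>J. s i * t j * (Q (\<alpha> i) (\<alpha> j) - Q (\<beta> (\<pi> i)) (\<beta> (\<pi> j)))\<bar>
          \<le> (real (card J))\<^sup>2 * (2 * coarse I c (\<lambda>a. freq J \<alpha> a - freq J \<beta> a) + (F + \<epsilon> * sqnorm (\<lambda>a. freq J \<beta> a / p a))))"
  proof (intro exI[of _ \<pi>] conjI allI impI \<pi>)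
    fix s t assume "\<forall>i\<in>J. 0 \<le> s i \<and> s i \<le> (1::real)" "\<forall>i\<in>J. 0 \<le> t i \<and> t i \<le> (1::real)"
    note st = this[rule_format]
    show "\<bar>\<Sum>i\<in>J. \<Sum>j\<in>J. s i * t j * (Q (\<alpha> i) (\<alpha> j) - Q (\<beta> (\<pi> i)) (\<beta> (\<pi> j)))\<bar>
          \<le> (real (card J))\<^sup>2 * (2 * coarse I c (\<lambda>a. freq J \<alpha> a - freq J \<beta> a) + (F + \<epsilon> * sqnorm (\<lambda>a. freq J \<beta> a / p a)))"
      by (rule grid_bound_sampled[OF assms(1,2) \<beta>\<pi> fine crs st F, unfolded freq_permute[OF \<pi>, of \<beta>] of_nat_power])
  qed
qed

end

text \<open>For \<open>k \<le> n\<close> the regularity lemma is applied with the mixed weights of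
  \<open>expec_fine\<close>. In the other regime it is applied with the label masses themselves,
  since the bound for sampled forms compares \<open>\<mu>\<close> with the law of the
  sample.\<close>

lemma expectation_bound:
  fixes W :: "real \<Rightarrow> real \<Rightarrow> real" and k n :: nat
  assumes W: "W \<in> step_graphons k" and k: "2 \<le> k" and n: "1 \<le> n" and \<rho>: "0 \<le> \<rho>"
  defines "E \<equiv> (\<integral>\<xi>. cut_distance (empirical_graphon n (random_matrix \<rho> W \<xi>)) (\<lambda>x y. \<rho> * W x y) \<partial>uniform_sample n)"
  shows "k \<le> n \<Longrightarrow> E \<le> \<rho> * (1 / n + (2 + 14 * sqrt (2 * regularity_const)) * sqrt (k / (n * ln k)))"
    and "2 \<le> n \<Longrightarrow> E \<le> \<rho> * (1 / n + (2 + sqrt (2 * regularity_const + 480) + sqrt (2 * regularity_const)) * sqrt (1 / ln n))"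
proof -
  obtain I :: "nat set" and \<phi> Q Z where
    I: "finite I" "card I \<le> k" and \<phi>: "\<phi> ` {0..1} \<subseteq> I"
    and meas: "\<And>a. a \<in> I \<Longrightarrow> {t \<in> {0..1}. \<phi> t = a} \<in> sets lebesgue"
    and pos: "\<And>a. a \<in> I \<Longrightarrow> 0 < measure lebesgue {t \<in> {0..1}. \<phi> t = a}"
    and Z: "Z \<in> null_sets lebesgue" "Z \<subseteq> {0..1}"
    and WQ: "\<And>x y. x \<in> {0..1} - Z \<Longrightarrow> y \<in> {0..1} - Z \<Longrightarrow> W x y = Q (\<phi> x) (\<phi> y)"
    and Q_sym: "\<And>a b. a \<in> I \<Longrightarrow> b \<in> I \<Longrightarrow> Q a b = Q b a"
    and Q_range: "\<And>a b. a \<in> I \<Longrightarrow> b \<in> I \<Longrightarrow> 0 \<le> Q a b \<and> Q a b \<le> (1::real)"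
    by (rule measurable_labelling[OF W]) (rule that; assumption)
  have W_range: "0 \<le> W x y \<and> W x y \<le> 1" if "x \<in> {0..1}" "y \<in> {0..1}" for x y
    using W that by (auto simp: step_graphons_def graphons_def)
  define p where "p a = measure lebesgue {t \<in> {0..1}. \<phi> t = a}" for a
  define J where "J = {1..n}"
  have J: "finite J" "J \<noteq> {}" "card J = n" using n by (auto simp: J_def)
  have sum_p: "sum p I = 1"
  proof -
    have "sum p I = measure lebesgue (\<Union>a\<in>I. {t \<in> {0..1}. \<phi> t = a})"
      unfolding p_def
    proof (rule measure_finite_Union[symmetric])
      show "emeasure lebesgue {t \<in> {0..1}. \<phi> t = a} \<noteq> \<infinity>" if "a \<in> I" for a
      proof -
        have "{t \<in> {0..1}. \<phi> t = a} \<in> lmeasurable"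
          by (rule lmeasurable_subset_unit(1)[OF meas[OF that]]) auto
        then show ?thesis by (simp only: infinity_ennreal_def fmeasurableD2 not_False_eq_True)
      qed
    qed (use I meas in \<open>auto simp: disjoint_family_on_def\<close>)
    also have "(\<Union>a\<in>I. {t \<in> {0..1}. \<phi> t = a}) = {0..1}" using \<phi> by auto
    finally show ?thesis by simp
  qed
  have Q_abs: "\<bar>Q a b\<bar> \<le> 1" if "a \<in> I" "b \<in> I" for a b using Q_range[OF that] by linarith
  interpret L: label_sample I p J
  proof unfold_locales
    show "0 < p a" if "a \<in> I" for a unfolding p_def by (rule pos[OF that])
  qed (simp_all add: I(1) sum_p J(1,2))
  have good: "sampled_graphon I \<phi> Q W Z \<rho> n \<xi>" if "\<And>i. i \<in> {1..n} \<Longrightarrow> \<xi> i \<in> {0..1} - Z" for \<xi>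
  proof unfold_locales
    show "W x y = Q (\<phi> x) (\<phi> y)" if "x \<in> {0..1} - Z" "y \<in> {0..1} - Z" for x y by (rule WQ[OF that])
    show "\<xi> i \<in> {0..1} - Z" if "i \<in> {1..n}" for i by (rule \<open>\<And>i. i \<in> {1..n} \<Longrightarrow> \<xi> i \<in> {0..1} - Z\<close>[OF that])
    show "{t \<in> {0..1}. \<phi> t = a} \<in> sets lebesgue" if "a \<in> I" for a by (rule meas[OF that])
    show "0 \<le> W x y \<and> W x y \<le> 1" if "x \<in> {0..1}" "y \<in> {0..1}" for x y by (rule W_range[OF that])
    show "0 \<le> Q a b \<and> Q a b \<le> 1" if "a \<in> I" "b \<in> I" for a b by (rule Q_range[OF that])
  qed (use n in \<open>simp_all add: I(1) \<phi> Z \<rho>\<close>)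
  \<comment> \<open>The bound on the distance depends on the sample only through its labels, so its
    mean is the finite sum \<open>L.expec G\<close>.\<close>
  have reduce: "E \<le> \<rho> * (1 / n + B)"
    if G: "\<And>\<xi> x. \<lbrakk>\<And>i. i \<in> {1..n} \<Longrightarrow> \<xi> i \<in> {0..1} - Z; x = (\<lambda>i\<in>J. \<phi> (\<xi> i))\<rbrakk>
        \<Longrightarrow> cut_distance (empirical_graphon n (random_matrix \<rho> W \<xi>)) (\<lambda>x y. \<rho> * W x y) \<le> \<rho> * (1 / n + G x)"
      and B: "L.expec G \<le> B" "0 \<le> B" for G B
    unfolding E_def
  proof (rule uniform_sample_bound[OF I(1) \<phi> meas Z(1), where f = "\<lambda>x. \<rho> * (1 / n + G x)"])
    show "cut_distance (empirical_graphon n (random_matrix \<rho> W \<xi>)) (\<lambda>x y. \<rho> * W x y)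
        \<le> \<rho> * (1 / n + G (\<lambda>i\<in>{1..n}. \<phi> (\<xi> i)))" if "\<And>i. i \<in> {1..n} \<Longrightarrow> \<xi> i \<in> {0..1} - Z" for \<xi>
      using G[OF that refl] by (simp only: J_def)
    have "L.expec (\<lambda>x. \<rho> * (1 / n + G x)) = \<rho> * (1 / n + L.expec G)"
      by (simp only: L.expec_cmult L.expec_add L.expec_const)
    also have "\<dots> \<le> \<rho> * (1 / n + B)" using B \<rho> by (intro mult_left_mono add_left_mono)
    finally have "L.expec (\<lambda>x. \<rho> * (1 / n + G x)) \<le> \<rho> * (1 / n + B)" .
    then show "(\<Sum>x\<in>{1..n} \<rightarrow>\<^sub>E I. (\<Prod>i\<in>{1..n}. measure lebesgue {t \<in> {0..1}. \<phi> t = x i}) * (\<rho> * (1 / n + G x)))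
        \<le> \<rho> * (1 / n + B)"
      unfolding L.expec_def unfolding J_def p_def .
    show "0 \<le> \<rho> * (1 / n + B)" using \<rho> B by simp
  qed
  have freq_sample: "freq J (\<lambda>i\<in>J. \<phi> (\<xi> i)) = freq J (\<lambda>i. \<phi> (\<xi> i))" for \<xi>
  proof -
    have "{i \<in> J. (\<lambda>i\<in>J. \<phi> (\<xi> i)) i = a} = {i \<in> J. \<phi> (\<xi> i) = a}" for a by auto
    then show ?thesis by (simp add: freq_def fun_eq_iff)
  qed
  have labels_blk: "(\<lambda>i. \<phi> (\<xi> (blk r i))) ` {1..n * r} \<subseteq> I"
    if "\<And>i. i \<in> {1..n} \<Longrightarrow> \<xi> i \<in> {0..1} - Z" "0 < r" for \<xi> r
    using that(1)[OF blk_in[OF that(2)]] \<phi> by blast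
  have freq_blk': "freq {1..n * r} (\<lambda>i. \<phi> (\<xi> (blk r i))) = freq J (\<lambda>i\<in>J. \<phi> (\<xi> i))" if "0 < r" for \<xi> r
    unfolding freq_sample unfolding J_def using freq_blk[of n r "\<lambda>i. \<phi> (\<xi> i)"] n that by (simp add: fun_eq_iff)
  have K: "0 < regularity_const" by (simp add: regularity_const_def)
  {
    assume kn: "k \<le> n"
    define \<epsilon> where "\<epsilon> = sqrt (2 * regularity_const / ln k)"
    have \<epsilon>: "0 < \<epsilon>" using K k by (simp add: \<epsilon>_def)
    define w where "w = (\<lambda>a. (p a + 1 / card I) / 2)"
    define nrm where "nrm = (\<lambda>u. \<Sum>a\<in>I. w a * (u a / w a)\<^sup>2)"
    have cI: "0 < card I" using I(1) sum_p by (auto simp: card_gt_0_iff)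
    have sum_w: "sum w I = 1"
      using cI by (simp add: w_def sum_divide_distrib[symmetric] sum.distrib sum_p)
    interpret S: weighted_set I w
      by unfold_locales (use I(1) L.p_pos cI sum_w in \<open>auto simp: w_def intro!: add_pos_pos\<close>)
    obtain R and c :: "nat \<Rightarrow> int list" where card_c: "real (card (c ` I)) \<le> exp (regularity_const / \<epsilon>\<^sup>2)"
      and cells: "\<And>a b a' b'. \<lbrakk>a \<in> I; b \<in> I; a' \<in> I; b' \<in> I; c a = c a'; c b = c b'\<rbrakk> \<Longrightarrow> Q a b - R a b = Q a' b' - R a' b'"
      and R: "S.form_bounded R \<epsilon>"
      by (rule S.operator_norm_regularity[OF Q_abs \<epsilon>], assumption, assumption) (rule that; assumption)
    interpret S: regular_kernel I w Q R c \<epsilon>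
    proof unfold_locales
      show "Q a b - R a b = Q a' b' - R a' b'"
        if "a \<in> I" "b \<in> I" "a' \<in> I" "b' \<in> I" "c a = c a'" "c b = c b'" for a b a' b'
        by (rule cells[OF that])
    next
      show "0 \<le> Q a b \<and> Q a b \<le> 1" if "a \<in> I" "b \<in> I" for a b by (rule Q_range[OF that])
      show "Q a b = Q b a" if "a \<in> I" "b \<in> I" for a b by (rule Q_sym[OF that])
    qed (use R \<epsilon> in simp_all)
    let ?G = "\<lambda>u \<mu>. 2 * coarse I c (\<lambda>a. u a - \<mu> a) + 2 * S.fine_bound u \<mu>"
    show "E \<le> \<rho> * (1 / n + (2 + 14 * sqrt (2 * regularity_const)) * sqrt (k / (n * ln k)))"
    proof (rule reduce[where G = "\<lambda>x. ?G (freq J x) p"])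
      fix \<xi> x assume \<xi>: "\<And>i. i \<in> {1..n} \<Longrightarrow> \<xi> i \<in> {0..1} - Z" and x: "x = (\<lambda>i\<in>J. \<phi> (\<xi> i))"
      interpret G: sampled_graphon I \<phi> Q W Z \<rho> n \<xi> by (rule good[OF \<xi>])
      have "G.distance \<le> \<rho> * (1 / n + ?G (freq J x) G.mass)"
      proof (rule G.distance_le)
        fix r and \<psi> :: "nat \<Rightarrow> nat" assume r: "0 < r" and \<psi>: "\<psi> ` {1..n * r} \<subseteq> I"
        have lb: "(\<lambda>i. \<phi> (\<xi> (blk r i))) ` {1..n * r} \<subseteq> I"
          by (rule labels_blk[OF _ r]) (rule \<xi>)
        show "\<exists>\<pi>. \<pi> permutes {1..n * r} \<and>
          (\<forall>s t. (\<forall>i\<in>{1..n * r}. 0 \<le> s i \<and> s i \<le> (1::real)) \<longrightarrow> (\<forall>i\<in>{1..n * r}. 0 \<le> t i \<and> t i \<le> (1::real)) \<longrightarrow>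
            \<bar>\<Sum>i\<in>{1..n * r}. \<Sum>j\<in>{1..n * r}. s i * t j *
              (Q (\<phi> (\<xi> (blk r i))) (\<phi> (\<xi> (blk r j))) - Q (\<psi> (\<pi> i)) (\<psi> (\<pi> j)))\<bar>
              \<le> (real (n * r))\<^sup>2 * ?G (freq J x) (freq {1..n * r} \<psi>))"
          by (rule S.exists_matching(1)[OF finite_atLeastAtMost lb \<psi>, unfolded freq_blk'[OF r, of \<xi>] x[symmetric] card_atLeastAtMost diff_Suc_1])
      next
        fix \<mu> assume \<mu>: "\<And>a. a \<in> I \<Longrightarrow> (\<lambda>k. \<mu> k a) \<longlonglongrightarrow> G.mass a"
        show "(\<lambda>k::nat. ?G (freq J x) (\<mu> k)) \<longlonglongrightarrow> ?G (freq J x) G.mass"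
          by (intro tendsto_add tendsto_mult tendsto_const coarse_tendsto S.fine_bound_tendsto \<mu>)
      qed
      then show "G.distance \<le> \<rho> * (1 / n + ?G (freq J x) p)" unfolding p_def .
    next
      have "S.fine_bound u v = \<epsilon> * sqrt (nrm (\<lambda>a. u a - v a)) * (sqrt (nrm u) + sqrt (nrm v))" for u v
        by (simp add: S.fine_bound_def S.sqnorm_def nrm_def)
      then show "L.expec (\<lambda>x. ?G (freq J x) p) \<le> (2 + 14 * sqrt (2 * regularity_const)) * sqrt (k / (n * ln k))"
        using L.many_samples_bound[OF k I(2) _ \<epsilon>_def card_c w_def nrm_def] kn unfolding J(3) by simp
    qed (use K k in simp)
  next
    assume n2: "2 \<le> n"
    define \<epsilon> where "\<epsilon> = sqrt (2 * regularity_const / ln (card J))"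
    have \<epsilon>: "0 < \<epsilon>" using K n2 by (simp add: \<epsilon>_def J)
    obtain R and c :: "nat \<Rightarrow> int list" where card_c: "real (card (c ` I)) \<le> exp (regularity_const / \<epsilon>\<^sup>2)"
      and cells: "\<And>a b a' b'. \<lbrakk>a \<in> I; b \<in> I; a' \<in> I; b' \<in> I; c a = c a'; c b = c b'\<rbrakk> \<Longrightarrow> Q a b - R a b = Q a' b' - R a' b'"
      and R: "L.form_bounded R \<epsilon>"
      and R_abs: "\<And>a b. a \<in> I \<Longrightarrow> b \<in> I \<Longrightarrow> \<bar>R a b\<bar> \<le> 1 + regularity_const / \<epsilon>\<^sup>2"
      by (rule L.operator_norm_regularity[OF Q_abs \<epsilon>], assumption, assumption) (rule that; assumption)
    interpret S: regular_kernel I p Q R c \<epsilon>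
    proof unfold_locales
      show "Q a b - R a b = Q a' b' - R a' b'"
        if "a \<in> I" "b \<in> I" "a' \<in> I" "b' \<in> I" "c a = c a'" "c b = c b'" for a b a' b'
        by (rule cells[OF that])
    next
      show "0 \<le> Q a b \<and> Q a b \<le> 1" if "a \<in> I" "b \<in> I" for a b by (rule Q_range[OF that])
      show "Q a b = Q b a" if "a \<in> I" "b \<in> I" for a b by (rule Q_sym[OF that])
    qed (use R \<epsilon> in simp_all)
    define F where "F u = sqrt (\<epsilon>\<^sup>2 + sqrt (L.row_dev R u) + sqrt (L.col_dev R u))" for u
    let ?G = "\<lambda>u \<mu>. 2 * coarse I c (\<lambda>a. u a - \<mu> a) + (F u + \<epsilon> * L.sqnorm (\<lambda>a. \<mu> a / p a))"
    \<comment> \<open>In the limit of fine grids the frequencies of the graphon side become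
      \<open>p\<close>, whose density is 1; this side then contributes just
      \<open>\<epsilon>\<close>.\<close>
    have sq1: "L.sqnorm (\<lambda>a. p a / p a) = 1"
    proof -
      have "L.sqnorm (\<lambda>a. p a / p a) = sum p I"
        unfolding L.sqnorm_def by (intro sum.cong refl) (use L.p_pos in fastforce)
      then show ?thesis by (simp add: sum_p)
    qed
    show "E \<le> \<rho> * (1 / n + (2 + sqrt (2 * regularity_const + 480) + sqrt (2 * regularity_const)) * sqrt (1 / ln n))"
    proof (rule reduce[where G = "\<lambda>x. ?G (freq J x) p"])
      fix \<xi> x assume \<xi>: "\<And>i. i \<in> {1..n} \<Longrightarrow> \<xi> i \<in> {0..1} - Z" and x: "x = (\<lambda>i\<in>J. \<phi> (\<xi> i))"
      interpret G: sampled_graphon I \<phi> Q W Z \<rho> n \<xi> by (rule good[OF \<xi>])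
      have x_in: "x \<in> J \<rightarrow>\<^sub>E I" unfolding x using \<phi> \<xi> by (auto simp: J_def)
      have F: "\<bar>\<Sum>a\<in>I. \<Sum>b\<in>I. u a * v b * R a b\<bar> \<le> F (freq J x)"
        if "\<And>a. a \<in> I \<Longrightarrow> \<bar>u a\<bar> \<le> freq J x a" "\<And>a. a \<in> I \<Longrightarrow> \<bar>v a\<bar> \<le> freq J x a" for u v
        unfolding F_def
        by (rule L.sampled_form_bound[OF R _ _ _ that]) (use \<epsilon> L.freq_total[OF x_in] in auto)
      have "G.distance \<le> \<rho> * (1 / n + ?G (freq J x) G.mass)"
      proof (rule G.distance_le)
        fix r and \<psi> :: "nat \<Rightarrow> nat" assume r: "0 < r" and \<psi>: "\<psi> ` {1..n * r} \<subseteq> I"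
        have F': "\<bar>\<Sum>a\<in>I. \<Sum>b\<in>I. u a * v b * R a b\<bar> \<le> F (freq J x)"
          if "\<And>a. a \<in> I \<Longrightarrow> \<bar>u a\<bar> \<le> freq {1..n * r} (\<lambda>i. \<phi> (\<xi> (blk r i))) a"
            "\<And>a. a \<in> I \<Longrightarrow> \<bar>v a\<bar> \<le> freq {1..n * r} (\<lambda>i. \<phi> (\<xi> (blk r i))) a" for u v
          by (rule F) (use that in \<open>simp_all only: freq_blk'[OF r] x[symmetric]\<close>)
        have lb: "(\<lambda>i. \<phi> (\<xi> (blk r i))) ` {1..n * r} \<subseteq> I"
          by (rule labels_blk[OF _ r]) (rule \<xi>)
        show "\<exists>\<pi>. \<pi> permutes {1..n * r} \<and>
          (\<forall>s t. (\<forall>i\<in>{1..n * r}. 0 \<le> s i \<and> s i \<le> (1::real)) \<longrightarrow> (\<forall>i\<in>{1..n * r}. 0 \<le> t i \<and> t i \<le> (1::real)) \<longrightarrow>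
            \<bar>\<Sum>i\<in>{1..n * r}. \<Sum>j\<in>{1..n * r}. s i * t j *
              (Q (\<phi> (\<xi> (blk r i))) (\<phi> (\<xi> (blk r j))) - Q (\<psi> (\<pi> i)) (\<psi> (\<pi> j)))\<bar>
              \<le> (real (n * r))\<^sup>2 * ?G (freq J x) (freq {1..n * r} \<psi>))"
          by (rule S.exists_matching(2)[OF finite_atLeastAtMost lb \<psi> F', unfolded freq_blk'[OF r, of \<xi>] x[symmetric] card_atLeastAtMost diff_Suc_1])
      next
        fix \<mu> assume \<mu>: "\<And>a. a \<in> I \<Longrightarrow> (\<lambda>k. \<mu> k a) \<longlonglongrightarrow> G.mass a"
        show "(\<lambda>k::nat. ?G (freq J x) (\<mu> k)) \<longlonglongrightarrow> ?G (freq J x) G.mass"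
          by (intro tendsto_add tendsto_mult tendsto_const coarse_tendsto L.sqnorm_tendsto \<mu>)
      qed
      then show "G.distance \<le> \<rho> * (1 / n + ?G (freq J x) p)" unfolding p_def .
    next
      show "L.expec (\<lambda>x. ?G (freq J x) p)
          \<le> (2 + sqrt (2 * regularity_const + 480) + sqrt (2 * regularity_const)) * sqrt (1 / ln n)"
        using L.few_samples_bound[OF _ \<epsilon>_def card_c R_abs] n2 unfolding sq1 F_def J(3) by simp
    qed (use K n2 in simp)
  }
qed

theorem theorem1:
  shows "\<exists>C::real. C > 0 \<and>
    (\<forall>(k::nat) (n::nat) (W\<^sub>0 :: real \<Rightarrow> real \<Rightarrow> real) (\<rho>::real).
       k \<ge> 2 \<longrightarrow> n \<ge> 1 \<longrightarrow> W\<^sub>0 \<in> step_graphons k \<longrightarrow> 0 < \<rho> \<longrightarrow> \<rho> \<le> 1 \<longrightarrow>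
       ereal (\<integral>\<xi>. cut_distance (empirical_graphon n (random_matrix \<rho> W\<^sub>0 \<xi>)) (\<lambda>x y. \<rho> * W\<^sub>0 x y)
                \<partial>uniform_sample n)
       \<le> ereal (C * \<rho>) *
           (if k \<le> n then ereal (sqrt (real k / (real n * ln (real k))))
            else if n = 1 then \<infinity>
            else ereal (sqrt (1 / ln (real n)))))"
proof -
  \<comment> \<open>Large enough to dominate 1 plus the constant of either regime; the 1 is for the
    diagonal blocks.\<close>
  define K where "K = 17 + 14 * sqrt (2 * regularity_const) + sqrt (2 * regularity_const + 480) + sqrt (2 * regularity_const)"
  have c: "0 \<le> sqrt (2 * regularity_const)" "0 \<le> sqrt (2 * regularity_const + 480)" by (simp_all add: regularity_const_def)
  show ?thesis
  proof (intro exI[of _ K] conjI allI impI)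
    show "0 < K" using c unfolding K_def by linarith
    fix k n :: nat and W\<^sub>0 :: "real \<Rightarrow> real \<Rightarrow> real" and \<rho> :: real
    assume k: "2 \<le> k" and n: "1 \<le> n" and W: "W\<^sub>0 \<in> step_graphons k" and \<rho>: "0 < \<rho>"
    let ?E = "\<integral>\<xi>. cut_distance (empirical_graphon n (random_matrix \<rho> W\<^sub>0 \<xi>)) (\<lambda>x y. \<rho> * W\<^sub>0 x y) \<partial>uniform_sample n"
    have sq: "(1 / real n)\<^sup>2 \<le> 1 / real n" using n by (simp add: field_simps power2_eq_square)
    \<comment> \<open>The diagonal contribution \<open>1 / n\<close> is below the target rate
      \<open>s\<close> in both regimes and is absorbed into the constant.\<close>
    have combine: "?E \<le> K * \<rho> * s" if "?E \<le> \<rho> * (1 / n + d * s)" "1 / n \<le> s" "1 + d \<le> K" for d s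
    proof -
      have "0 \<le> s" using that(2) n by (smt (verit) divide_nonneg_nonneg of_nat_0_le_iff)
      then have "(1 + d) * s \<le> K * s" using that(3) by (intro mult_right_mono)
      then have "1 / n + d * s \<le> K * s" using that(2) by (simp only: distrib_right mult_1_left)
      then have "\<rho> * (1 / n + d * s) \<le> \<rho> * (K * s)" using \<rho> by (intro mult_left_mono) auto
      then show ?thesis using that(1) by (simp only: mult_ac)
    qed
    show "ereal ?E \<le> ereal (K * \<rho>) * (if k \<le> n then ereal (sqrt (real k / (real n * ln (real k))))
            else if n = 1 then \<infinity> else ereal (sqrt (1 / ln (real n))))"
    proof (cases "k \<le> n")
      case True
      have lnk: "0 < ln (real k)" "ln (real k) \<le> real k" using k ln_le_minus_one[of "real k"] by auto
      have "(1 / real n)\<^sup>2 \<le> 1 / real n" by (rule sq)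
      also have "\<dots> \<le> real k / (real n * ln (real k))" using lnk n by (simp add: field_simps)
      finally have "1 / real n \<le> sqrt (real k / (real n * ln (real k)))" by (rule real_le_rsqrt)
      then have "?E \<le> K * \<rho> * sqrt (real k / (real n * ln (real k)))"
        using expectation_bound(1)[OF W k n less_imp_le[OF \<rho>] True] c by (intro combine) (auto simp: K_def)
      then show ?thesis using True by simp
    next
      case False
      show ?thesis
      proof (cases "n = 1")
        case True
        \<comment> \<open>The right-hand side is infinite because \<open>K * \<rho>\<close> is
          strictly positive.\<close>
        then show ?thesis using False \<rho> \<open>0 < K\<close> by simp
      next
        case n1: False
        then have n2: "2 \<le> n" using n by simp
        have lnn: "0 < ln (real n)" "ln (real n) \<le> real n" using n2 ln_le_minus_one[of "real n"] by auto
        have "(1 / real n)\<^sup>2 \<le> 1 / real n" by (rule sq)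
        also have "\<dots> \<le> 1 / ln (real n)" using lnn n by (intro divide_left_mono) auto
        finally have "1 / real n \<le> sqrt (1 / ln (real n))" by (rule real_le_rsqrt)
        then have "?E \<le> K * \<rho> * sqrt (1 / ln (real n))"
          using expectation_bound(2)[OF W k n less_imp_le[OF \<rho>] n2] c by (intro combine) (auto simp: K_def)
        then show ?thesis using False n1 by simp
      qed
    qed
  qed
qed

end
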